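(* Let $n\ge 2$. There is a constant $c>0$ depending only on $n$ such that the following holds. Let $\Omega\subset\mathbb{R}^{n+1}$ be a bounded open connected set, and let $B=B(x_0,r)$ be a closed ball with $x_0\in\partial\Omega$ and $0<r<\operatorname{diam}(\partial\Omega)$. Then, for all $a>0$, $$\omega^{x}(aB)\ \ge\ c\,\Bigl(\inf_{z\in 2B\cap\Omega}\omega^{z}(aB)\Bigr)\, r^{n-1}\, G(x,y)\qquad\text{for all } x\in\Omega\setminus 2B \text{ and } y\in B\cap\Omega.$$ In particular, the constant $c$ is independent of $a$.
   Context: For a ball $B=B(x_0,r)$ and $\lambda>0$, $\lambda B=B(x_0,\lambda r)$ denotes the concentric ball of radius $\lambda r$. Harmonic measure: for $f$ continuous on $\partial\Omega$, the upper functions for $f$ are the superharmonic functions $h$ on $\Omega$ with $\liminf_{\Omega\ni x\to\xi}h(x)\ge f(\xi)$ for all $\xi\in\partial\Omega$; the function $u_f(x)=\inf\{h(x): h \text{ an upper function for } f\}$ is harmonic in $\Omega$, and $\omega^x$, the harmonic measure of $\Omega$ with pole at $x\in\Omega$, is the Radon measure on $\partial\Omega$ with $u_f(x)=\int_{\partial\Omega} f\,d\omega^x$ for all continuous $f$. For a ball $B$, $\omega^x(B)$ means $\omega^x(B\cap\partial\Omega)$. Green function: let $\mathcal{E}(x)=c_n|x|^{1-n}$, $c_n>0$, be the fundamental solution for the Laplace equation in $\mathbb{R}^{n+1}$, $n\ge2$. For $x,y\in\Omega$ with $x\ne y$, the Green function of the bounded open set $\Omega$ is $$G(x,y)=\mathcal{E}(x-y)-\int_{\partial\Omega}\mathcal{E}(x-z)\,d\omega^y(z).$$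 *)

theory Defs
  imports "HOL-Analysis.Analysis"
begin

text \<open>
  The mean over a closed ball of an extended real function, as the difference of the integrals of
  its positive and negative parts (\<^const>\<open>e2ennreal\<close> sends negative values to 0). For a lower
  semicontinuous \<^term>\<open>h\<close> with \<^term>\<open>h z \<noteq> -\<infinity>\<close> on the ball, the second integral is finite.
\<close>

definition ball_mean :: "('a::euclidean_space \<Rightarrow> ereal) \<Rightarrow> 'a \<Rightarrow> real \<Rightarrow> ereal" where
  "ball_mean h x r =
     (enn2ereal (\<integral>\<^sup>+z\<in>cball x r. e2ennreal (h z) \<partial>lborel)
      - enn2ereal (\<integral>\<^sup>+z\<in>cball x r. e2ennreal (- h z) \<partial>lborel))
     / ereal (measure lborel (cball x r))"

text \<open>
  Superharmonic functions on an open set take values in \<open>(-\<infinity>, \<infinity>]\<close>, are lower semicontinuous, not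
  identically \<open>\<infinity>\<close> on any component, and satisfy the super-mean-value inequality on closed balls.
  Values of \<^term>\<open>h\<close> outside \<^term>\<open>\<Omega>\<close> are irrelevant.
\<close>

definition superharmonic_on :: "'a::euclidean_space set \<Rightarrow> ('a \<Rightarrow> ereal) \<Rightarrow> bool" where
  "superharmonic_on \<Omega> h \<longleftrightarrow>
     (\<forall>x\<in>\<Omega>. h x \<noteq> -\<infinity>) \<and>
     (\<forall>x\<in>\<Omega>. h x \<le> Liminf (at x within \<Omega>) h) \<and>
     (\<forall>C\<in>components \<Omega>. \<exists>x\<in>C. h x \<noteq> \<infinity>) \<and>
     (\<forall>x r. 0 < r \<longrightarrow> cball x r \<subseteq> \<Omega> \<longrightarrow> ball_mean h x r \<le> h x)"

definition upper_function ::
  "'a::euclidean_space set \<Rightarrow> ('a \<Rightarrow> real) \<Rightarrow> ('a \<Rightarrow> ereal) \<Rightarrow> bool" where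
  "upper_function \<Omega> f h \<longleftrightarrow>
     superharmonic_on \<Omega> h \<and> (\<forall>\<xi>\<in>frontier \<Omega>. ereal (f \<xi>) \<le> Liminf (at \<xi> within \<Omega>) h)"

definition perron_solution ::
  "'a::euclidean_space set \<Rightarrow> ('a \<Rightarrow> real) \<Rightarrow> 'a \<Rightarrow> ereal" where
  "perron_solution \<Omega> f x = (INF h\<in>{h. upper_function \<Omega> f h}. h x)"

text \<open>
  For bounded \<^term>\<open>\<Omega>\<close> the boundary is a compact metric space, so the Radon measures on it are
  exactly the finite Borel measures.
\<close>

definition is_harmonic_measure ::
  "'a::euclidean_space set \<Rightarrow> 'a \<Rightarrow> 'a measure \<Rightarrow> bool" where
  "is_harmonic_measure \<Omega> x \<mu> \<longleftrightarrow>
     finite_measure \<mu> \<and>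
     sets \<mu> = sets (restrict_space borel (frontier \<Omega>)) \<and>
     (\<forall>f. continuous_on (frontier \<Omega>) f \<longrightarrow>
        perron_solution \<Omega> f x = ereal (\<integral>\<xi>. f \<xi> \<partial>\<mu>))"

definition harmonic_measure :: "'a::euclidean_space set \<Rightarrow> 'a \<Rightarrow> 'a measure" where
  "harmonic_measure \<Omega> x = (THE \<mu>. is_harmonic_measure \<Omega> x \<mu>)"

text \<open>
  In dimension \<open>d = n + 1\<close> this is \<open>c\<^sub>n |x|\<close> to the power \<open>1 - n\<close>. The area of the unit sphere is
  \<open>d\<close> times the volume of the unit ball, so the normalisation is the one for which
  \<open>-\<Delta>\<close> of this function is the Dirac mass at 0.
\<close>

definition fundamental_solution :: "'a::euclidean_space \<Rightarrow> real" where
  "fundamental_solution x =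
     1 / ((real DIM('a) - 2) * (real DIM('a) * unit_ball_vol (real DIM('a))))
     * norm x powr (2 - real DIM('a))"

definition green_function :: "'a::euclidean_space set \<Rightarrow> 'a \<Rightarrow> 'a \<Rightarrow> real" where
  "green_function \<Omega> x y =
     fundamental_solution (x - y) - (\<integral>z. fundamental_solution (x - z) \<partial>harmonic_measure \<Omega> y)"

text \<open>Balls of the ambient space are intersected with the boundary before being measured.\<close>

definition hm :: "'a::euclidean_space set \<Rightarrow> 'a \<Rightarrow> 'a set \<Rightarrow> real" where
  "hm \<Omega> x A = measure (harmonic_measure \<Omega> x) (A \<inter> frontier \<Omega>)"

end

theory Submission
  imports Defs "HOL-Probability.Probability"
begin

text \<open>
  Write \<open>d\<close> for the dimension and \<open>K(x) = |x|\<close> to the power \<open>2 - d\<close> for the Newton kernel. Up to the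
  normalising constant, the Green function with \<open>y\<close> fixed is \<open>K(x - y) - p(x, y)\<close>, where \<open>p(x, y)\<close> is
  the potential at \<open>x\<close> of the harmonic measure with pole \<open>y\<close>. The inequality is an instance of the
  minimum principle on \<open>D = \<Omega> - 2B\<close>. The value \<open>\<omega>\<^sup>x(aB)\<close> is a limit of Perron solutions for
  continuous \<open>f\<close> above the indicator of \<open>aB\<close>, and an upper function \<open>h\<close> for such an \<open>f\<close> is nonnegative
  in the limit at the boundary of \<open>\<Omega>\<close> and at least \<open>I = inf \<omega>\<^sup>z(aB)\<close> on \<open>2B \<inter> \<Omega>\<close>. On the sphere
  bounding \<open>2B\<close> the point \<open>y\<close> is at distance at least \<open>r\<close>, so \<open>I r\<^sup>n\<^sup>-\<^sup>1 K(\<cdot> - y)\<close> is at most \<open>I\<close>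
  there. Hence \<open>h\<close> should dominate \<open>I r\<^sup>n\<^sup>-\<^sup>1 (K(\<cdot> - y) - p(\<cdot>, y))\<close> on \<open>D\<close>.

  Two points need care. The Green function need not tend to zero at irregular boundary points, and
  the harmonic measure is only described by the Perron solutions, so that its existence is part of
  what has to be proved. One device settles both: a random walk which from \<open>x \<in> \<Omega>\<close> jumps to a
  uniform point of the ball about \<open>x\<close> whose radius is half the distance to the complement.

  The walk is an \<open>L\<^sup>2\<close>-bounded martingale, so it converges along a subsequence to a point of the
  boundary; the law of the limit is the candidate for the harmonic measure. Fatou's lemma shows that
  every upper function lies above the integral of its boundary data against this law
  (\<open>upper_function_ge_exit_integral\<close>). This contains the minimum principle, on every bounded open set.

  Conversely, spread the unit mass at \<open>y\<close> by \<open>k\<close> steps of the walk. The potential of the resulting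
  mass is superharmonic on the whole space. Outside \<open>\<Omega>\<close> it is still equal to \<open>K(\<cdot> - y)\<close>, because a
  uniform ball has outside of itself the potential of its centre; inside \<open>\<Omega>\<close> it decreases to
  \<open>p(\<cdot>, y)\<close>. Thus these potentials are upper functions whose limit is \<open>p(\<cdot>, y)\<close>, with no regularity of
  the boundary. They are what is compared with \<open>h\<close> on \<open>D\<close>. They also give \<open>p(y, x) \<le> p(x, y)\<close>, hence
  the symmetry of \<open>p\<close> (\<open>exit_potential_commute\<close>). With symmetry, potentials of bounded densities and
  their negatives have upper functions whose values come arbitrarily close to the integral against
  the exit law. Differences of such potentials are uniformly dense in the continuous functions on the boundary
  (\<open>potential_differences_dense\<close>), so every continuous boundary function is resolutive and the exit
  law is the harmonic measure (\<open>harmonic_measure_eq_exit_law\<close>).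

  All of this rests on a single computation: the mean of \<open>K\<close> over a ball is at most its value at the
  centre, with equality when the ball avoids the origin (\<open>newton_mean_le\<close>, \<open>newton_mean_eq\<close>).
\<close>

section \<open>Ball means of the Newton kernel\<close>

lemma DERIV_integral_dominated:
  fixes g :: "real \<Rightarrow> 'b \<Rightarrow> real"
  assumes int: "\<And>h. integrable M (g h)"
    and der: "AE z in M. ((\<lambda>h. g h z) has_real_derivative g' z) (at 0)"
    and [measurable]: "g' \<in> borel_measurable M"
    and L: "integrable M L" "\<And>h z. \<bar>h\<bar> \<le> 1 \<Longrightarrow> z \<in> space M \<Longrightarrow> \<bar>g h z - g 0 z\<bar> \<le> L z * \<bar>h\<bar>"
  shows "((\<lambda>h. LINT z|M. g h z) has_real_derivative (LINT z|M. g' z)) (at 0)"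
  unfolding has_field_derivative_iff tendsto_at_iff_sequentially comp_def
proof (intro allI impI)
  fix X :: "nat \<Rightarrow> real" assume X: "\<forall>i. X i \<in> UNIV - {0}" "X \<longlonglongrightarrow> 0"
  from X(2) have "\<forall>\<^sub>F n in sequentially. \<bar>X n\<bar> < 1"
    by (metis abs_zero order_tendstoD(2) tendsto_rabs zero_less_one)
  then obtain N where N: "\<And>n. n \<ge> N \<Longrightarrow> \<bar>X n\<bar> < 1" by (auto simp: eventually_sequentially)
  define Y where "Y n = X (n + N)" for n
  have Y: "Y n \<noteq> 0" "\<bar>Y n\<bar> \<le> 1" for n using X(1) N[of "n+N"] by (auto simp: Y_def)
  have Ylim: "Y \<longlonglongrightarrow> 0" unfolding Y_def using X(2) by (rule LIMSEQ_ignore_initial_segment)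
  have "(\<lambda>n. LINT z|M. (g (Y n) z - g 0 z) / Y n) \<longlonglongrightarrow> (LINT z|M. g' z)"
  proof (rule integral_dominated_convergence[where w=L])
    show "AE z in M. (\<lambda>n. (g (Y n) z - g 0 z) / Y n) \<longlonglongrightarrow> g' z"
      using der
    proof eventually_elim
      case (elim z)
      then show ?case using Y(1) Ylim
        unfolding has_field_derivative_iff tendsto_at_iff_sequentially comp_def by auto
    qed
    show "AE z in M. norm ((g (Y n) z - g 0 z) / Y n) \<le> L z" for n
      using L(2)[OF Y(2)[of n]] Y(1)[of n] by (intro AE_I2) (auto simp: divide_simps)
    show "(\<lambda>z. (g (Y n) z - g 0 z) / Y n) \<in> borel_measurable M" for n
      using int by (intro borel_measurable_divide borel_measurable_diff) auto
  qed (use L(1) in auto)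
  moreover have "(LINT z|M. (g (Y n) z - g 0 z) / Y n) = ((LINT z|M. g (Y n) z) - (LINT z|M. g 0 z)) / Y n" for n
    using int by simp
  ultimately have "(\<lambda>n. ((LINT z|M. g (X (n+N)) z) - (LINT z|M. g 0 z)) / X (n+N)) \<longlonglongrightarrow> (LINT z|M. g' z)"
    by (simp only: Y_def)
  then show "(\<lambda>n. ((LINT z|M. g (X n) z) - (LINT z|M. g 0 z)) / (X n - 0)) \<longlonglongrightarrow> (LINT z|M. g' z)"
    by (auto dest: LIMSEQ_offset)
qed

text \<open>
  The Newton kernel is singular at the origin. With \<open>p = d/2 - 1\<close> this smooth function increases
  to it as \<open>\<epsilon>\<close> decreases to 0, and it is superharmonic on the whole space.
\<close>

definition reg_power :: "real \<Rightarrow> real \<Rightarrow> 'a::real_inner \<Rightarrow> real" where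
  "reg_power \<epsilon> p y = (y \<bullet> y + \<epsilon>) powr (- p)"

lemma continuous_on_reg_power [continuous_intros]:
  "\<epsilon> > 0 \<Longrightarrow> continuous_on A f \<Longrightarrow> continuous_on A (\<lambda>x. reg_power \<epsilon> p (f x))"
  unfolding reg_power_def
  by (intro continuous_intros) (auto simp: add_nonneg_eq_0_iff)

lemma borel_measurable_reg_power [measurable]:
  "\<epsilon> > 0 \<Longrightarrow> reg_power \<epsilon> p \<in> borel_measurable (borel :: 'a::euclidean_space measure)"
  by (intro borel_measurable_continuous_onI continuous_intros) auto

lemma reg_power_pos: "\<epsilon> > 0 \<Longrightarrow> reg_power \<epsilon> p y > 0"
  unfolding reg_power_def by (auto simp: add_nonneg_eq_0_iff intro!: add_nonneg_pos)

lemma reg_power_nonneg [simp]: "0 \<le> reg_power \<epsilon> p y"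
  by (simp add: reg_power_def)

lemma reg_power_le: "\<epsilon> > 0 \<Longrightarrow> p \<ge> 0 \<Longrightarrow> reg_power \<epsilon> p y \<le> \<epsilon> powr (- p)"
  unfolding reg_power_def by (intro powr_mono2') auto

lemma reg_power_Suc: "\<epsilon> > 0 \<Longrightarrow> reg_power \<epsilon> p y = reg_power \<epsilon> (p + 1) y * (y \<bullet> y + \<epsilon>)"
proof -
  assume "\<epsilon> > 0"
  then have "y \<bullet> y + \<epsilon> > 0" by (intro add_nonneg_pos) auto
  moreover have "- p = - (p + 1) + 1" by simp
  ultimately show ?thesis unfolding reg_power_def by (metis less_imp_le powr_add powr_one)
qed

lemma DERIV_inner_line:
  fixes a v :: "'a::real_inner"
  shows "((\<lambda>h. (a + h *\<^sub>R v) \<bullet> (a + h *\<^sub>R v)) has_real_derivative 2 * ((a + h *\<^sub>R v) \<bullet> v)) (at h)"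
proof -
  have "((\<lambda>h. a \<bullet> a + 2 * h * (a \<bullet> v) + h\<^sup>2 * (v \<bullet> v)) has_real_derivative 2 * (a \<bullet> v) + 2 * h * (v \<bullet> v)) (at h)"
    by (auto intro!: derivative_eq_intros)
  then show ?thesis
    by (simp add: inner_simps inner_commute power2_eq_square algebra_simps)
qed

lemma DERIV_reg_power_line:
  fixes a v :: "'a::real_inner"
  assumes "\<epsilon> > 0"
  shows "((\<lambda>h. reg_power \<epsilon> p (a + h *\<^sub>R v)) has_real_derivative
           - 2 * p * reg_power \<epsilon> (p + 1) (a + h *\<^sub>R v) * ((a + h *\<^sub>R v) \<bullet> v)) (at h)"
proof -
  have D: "((\<lambda>h. (a + h *\<^sub>R v) \<bullet> (a + h *\<^sub>R v) + \<epsilon>) has_real_derivative 2 * ((a + h *\<^sub>R v) \<bullet> v)) (at h)"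
    using DERIV_add[OF DERIV_inner_line DERIV_const] by simp
  have pos: "(a + h *\<^sub>R v) \<bullet> (a + h *\<^sub>R v) + \<epsilon> > 0" using assms by (intro add_nonneg_pos) auto
  have e: "- p - 1 = - (p + 1)" by simp
  show ?thesis
    unfolding reg_power_def
    by (rule DERIV_cong[OF DERIV_chain2[OF has_real_derivative_powr[OF pos, of "- p"] D]]) (unfold e, simp add: mult_ac)
qed

lemma reg_power_lipschitz:
  fixes a b :: "'a::real_inner"
  assumes \<epsilon>: "\<epsilon> > 0" and p: "p \<ge> 0" and "norm a \<le> T" "norm b \<le> T"
  shows "\<bar>reg_power \<epsilon> p b - reg_power \<epsilon> p a\<bar> \<le> 2 * p * \<epsilon> powr (- p - 1) * T * norm (b - a)"
proof -
  define f where "f h = reg_power \<epsilon> p (a + h *\<^sub>R (b - a))" for h :: real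
  define f' where "f' h = - 2 * p * reg_power \<epsilon> (p + 1) (a + h *\<^sub>R (b - a)) * ((a + h *\<^sub>R (b - a)) \<bullet> (b - a))" for h
  have "(f has_real_derivative f' h) (at h)" for h
    unfolding f_def f'_def by (rule DERIV_reg_power_line[OF \<epsilon>])
  from MVT2[of 0 1 f f', OF _ this] obtain h where h: "0 < h" "h < 1" "f 1 - f 0 = f' h" by auto
  have "a + h *\<^sub>R (b - a) = (1 - h) *\<^sub>R a + h *\<^sub>R b" by (simp add: algebra_simps)
  also have "norm \<dots> \<le> (1 - h) * T + h * T"
    using h assms by (intro norm_triangle_le add_mono) (auto intro!: mult_left_mono)
  finally have n: "norm (a + h *\<^sub>R (b - a)) \<le> T" by (simp add: algebra_simps)
  have "\<bar>f' h\<bar> = 2 * p * reg_power \<epsilon> (p + 1) (a + h *\<^sub>R (b - a)) * \<bar>(a + h *\<^sub>R (b - a)) \<bullet> (b - a)\<bar>"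
    using p reg_power_pos[OF \<epsilon>, of "p+1" "a + h *\<^sub>R (b - a)"] by (simp add: f'_def abs_mult)
  also have "\<dots> \<le> 2 * p * \<epsilon> powr (- (p + 1)) * (T * norm (b - a))"
  proof (intro mult_mono reg_power_le \<epsilon>)
    have "\<bar>(a + h *\<^sub>R (b - a)) \<bullet> (b - a)\<bar> \<le> norm (a + h *\<^sub>R (b - a)) * norm (b - a)"
      by (rule Cauchy_Schwarz_ineq2)
    also have "\<dots> \<le> T * norm (b - a)" using n by (intro mult_right_mono) auto
    finally show "\<bar>(a + h *\<^sub>R (b - a)) \<bullet> (b - a)\<bar> \<le> T * norm (b - a)" .
  qed (use p reg_power_pos[OF \<epsilon>, of "p + 1"] in \<open>auto intro: less_imp_le\<close>)
  moreover have "- (p + 1) = - p - 1" by simp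
  ultimately show ?thesis using h(3) by (simp add: f_def mult.assoc)
qed

text \<open>
  On the unit ball the gradient of this function is \<open>- z\<close>; it vanishes on the unit sphere. It
  therefore turns the derivative of a ball mean with respect to the radius into an integral of a
  Laplacian.
\<close>

definition bump :: "'a::real_inner \<Rightarrow> real" where
  "bump z = max 0 ((1 - z \<bullet> z) / 2)"

lemma bump_bounds: "0 \<le> bump z" "bump z \<le> 1"
proof -
  have "z \<bullet> z \<ge> 0" by simp
  then have "- 1 \<le> z \<bullet> z" by linarith
  then show "0 \<le> bump z" "bump z \<le> 1" by (simp_all add: bump_def)
qed

lemma continuous_on_bump [continuous_intros]: "continuous_on A f \<Longrightarrow> continuous_on A (\<lambda>x. bump (f x))"
  unfolding bump_def by (intro continuous_intros) auto

lemma bump_lipschitz: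
  assumes "norm a \<le> T" "norm b \<le> T"
  shows "\<bar>bump b - bump a\<bar> \<le> T * norm (b - a)"
proof -
  have "\<bar>bump b - bump a\<bar> \<le> \<bar>(1 - b \<bullet> b) / 2 - (1 - a \<bullet> a) / 2\<bar>" unfolding bump_def by linarith
  also have "(1 - b \<bullet> b) / 2 - (1 - a \<bullet> a) / 2 = - ((b + a) \<bullet> (b - a)) / 2"
    by (simp add: inner_simps inner_commute field_simps)
  also have "\<bar>\<dots>\<bar> = \<bar>(b + a) \<bullet> (b - a)\<bar> / 2" by simp
  also have "\<dots> \<le> (norm (b + a) * norm (b - a)) / 2"
    by (intro divide_right_mono Cauchy_Schwarz_ineq2) auto
  also have "\<dots> \<le> ((T + T) * norm (b - a)) / 2"
    using assms by (intro divide_right_mono mult_right_mono norm_triangle_le) auto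
  finally show ?thesis by simp
qed

text \<open>
  The integral of \<open>f (z + h v)\<close> does not depend on \<open>h\<close>, by translation invariance of Lebesgue
  measure; differentiating at \<open>h = 0\<close> gives the claim. This takes the place of the divergence
  theorem.
\<close>

lemma integral_directional_derivative_eq_0:
  fixes f :: "'a::euclidean_space \<Rightarrow> real"
  assumes cont: "continuous_on UNIV f" and supp: "\<And>z. norm z > 1 \<Longrightarrow> f z = 0"
    and lip: "\<And>a b. norm a \<le> 3 \<Longrightarrow> norm b \<le> 3 \<Longrightarrow> \<bar>f b - f a\<bar> \<le> C * norm (b - a)"
    and v: "norm v = 1"
    and der: "AE z in lborel. ((\<lambda>h. f (z + h *\<^sub>R v)) has_real_derivative f' z) (at 0)"
    and [measurable]: "f' \<in> borel_measurable borel"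
  shows "(LINT z|lborel. f' z) = 0"
proof -
  have C: "C \<ge> 0" using lip[of 0 v] v by auto
  have f0: "integrable lborel f"
  proof (rule integrable_cong_AE_imp[of _ "\<lambda>z. indicator (cball 0 1) z *\<^sub>R f z"])
    show "integrable lborel (\<lambda>z. indicator (cball 0 1) z *\<^sub>R f z)"
      by (intro borel_integrable_compact continuous_on_subset[OF cont]) auto
    show "f \<in> borel_measurable lborel" using cont by (auto intro: borel_measurable_continuous_onI)
    show "AE z in lborel. indicator (cball 0 1) z *\<^sub>R f z = f z"
      using supp by (auto simp: indicator_def not_le)
  qed
  have tr: "integrable lborel (\<lambda>z. f (z + a))" "(LINT z|lborel. f (z + a)) = (LINT z|lborel. f z)" for a
  proof -
    have *: "(\<lambda>z. f (z + a)) = (\<lambda>z. f (a + z))" by (simp add: add.commute)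
    have "integrable (distr lborel borel ((+) a)) f" using f0 by (simp add: lborel_distr_plus)
    then show "integrable lborel (\<lambda>z. f (z + a))" unfolding * by (subst (asm) integrable_distr_eq) (use f0 in auto)
    have "(LINT z|distr lborel borel ((+) a). f z) = (LINT z|lborel. f (a + z))"
      using f0 by (intro integral_distr) auto
    then show "(LINT z|lborel. f (z + a)) = (LINT z|lborel. f z)" unfolding * by (simp add: lborel_distr_plus)
  qed
  have "((\<lambda>h. LINT z|lborel. f (z + h *\<^sub>R v)) has_real_derivative (LINT z|lborel. f' z)) (at 0)"
  proof (rule DERIV_integral_dominated[where L="\<lambda>z. indicator (cball 0 2) z *\<^sub>R C"])
    fix z :: 'a and h :: real assume h: "\<bar>h\<bar> \<le> 1"
    show "\<bar>f (z + h *\<^sub>R v) - f (z + 0 *\<^sub>R v)\<bar> \<le> indicator (cball 0 2) z *\<^sub>R C * \<bar>h\<bar>"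
    proof (cases "norm z \<le> 2")
      case True
      then have "norm (z + h *\<^sub>R v) \<le> 3" using h v by (intro order_trans[OF norm_triangle_ineq]) auto
      then show ?thesis using True lip[of z "z + h *\<^sub>R v"] v by auto
    next
      case False
      have "norm z \<le> norm (z + h *\<^sub>R v) + norm (h *\<^sub>R v)" by (metis add_diff_cancel norm_triangle_ineq4)
      then have "norm (z + h *\<^sub>R v) > 1" using False h v by auto
      then show ?thesis using supp[of z] supp[of "z + h *\<^sub>R v"] False by auto
    qed
  next
    show "integrable lborel (\<lambda>z::'a. indicator (cball 0 2) z *\<^sub>R C)"
      by (intro borel_integrable_compact) auto
  qed (use der tr(1) in auto)
  then have "((\<lambda>h::real. LINT z|lborel. f z) has_real_derivative (LINT z|lborel. f' z)) (at 0)"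
    by (simp only: tr(2))
  moreover have "((\<lambda>h::real. LINT z|lborel. f z) has_real_derivative 0) (at 0)" by simp
  ultimately show ?thesis by (rule DERIV_unique)
qed

lemma integrable_cball_continuous:
  fixes f :: "'a::euclidean_space \<Rightarrow> real"
  assumes "continuous_on UNIV f"
  shows "integrable lborel (\<lambda>z. indicator (cball a r) z * f z)"
  using borel_integrable_compact[of "cball a r" f] continuous_on_subset[OF assms]
  by simp

lemma AE_not_sphere: "AE z in lborel. dist x (z::'a::euclidean_space) \<noteq> r"
proof -
  have "sphere x r \<in> null_sets lebesgue" using negligible_sphere by (simp add: negligible_iff_null_sets)
  then have "sphere x r \<in> null_sets lborel" by (simp add: null_sets_completion_iff)
  from AE_not_in[OF this] show ?thesis by eventually_elim auto
qed

text \<open>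
  Apply \<open>integral_directional_derivative_eq_0\<close> to the \<open>i\<close>-th component of the bump function times
  the vector field \<open>reg_power \<epsilon> p (x + t z) (x + t z)\<close>, and sum over \<open>i\<close>. For \<open>p = d/2\<close> this field
  is a multiple of the gradient of \<open>reg_power \<epsilon> (d/2 - 1)\<close>, and its divergence is the multiple \<open>t
  d \<epsilon>\<close> of \<open>reg_power \<epsilon> (p + 1)\<close>: the terms which survive \<open>\<epsilon> = 0\<close> cancel, since \<open>K\<close> is harmonic.
\<close>

lemma integral_by_parts_reg_power:
  fixes x :: "'a::euclidean_space"
  assumes \<epsilon>: "\<epsilon> > 0" and p: "2 * p = real DIM('a)" and t: "t \<ge> 0"
  shows "(LINT z|lborel. indicator (cball 0 1) z * (reg_power \<epsilon> p (x + t *\<^sub>R z) * ((x + t *\<^sub>R z) \<bullet> z))) =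
         (LINT z|lborel. indicator (cball 0 1) z * (bump z * t * real DIM('a) * \<epsilon> * reg_power \<epsilon> (p + 1) (x + t *\<^sub>R z)))"
proof -
  define y where "y z = x + t *\<^sub>R z" for z
  define g where "g i z = bump z * (reg_power \<epsilon> p (y z) * (y z \<bullet> i))" for i z
  define g1 where "g1 i z = indicator (cball 0 1) z * ((z \<bullet> i) * (reg_power \<epsilon> p (y z) * (y z \<bullet> i)))" for i z
  define g2 where "g2 i z = indicator (cball 0 1) z * (bump z * (-2 * p * reg_power \<epsilon> (p + 1) (y z) * (y z \<bullet> i)\<^sup>2 * t
      + reg_power \<epsilon> p (y z) * t))" for i z
  have p0: "p > 0" using p DIM_positive[where 'a='a] by linarith
  note [continuous_intros] = continuous_on_reg_power[OF \<epsilon>]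
  have contg: "continuous_on UNIV (g i)" for i
    unfolding g_def y_def by (intro continuous_intros)
  have [measurable]: "y \<in> borel_measurable borel" unfolding y_def by measurable
  have I1: "integrable lborel (g1 i)" and I2: "integrable lborel (g2 i)" for i
    unfolding g1_def g2_def y_def by (intro integrable_cball_continuous continuous_intros)+
  have zero: "(LINT z|lborel. g2 i z - g1 i z) = 0" if i: "i \<in> Basis" for i
  proof -
    define T where "T = norm x + 3 * t"
    define C1 where "C1 = 2 * p * \<epsilon> powr (- p - 1) * T"
    have T: "norm (y z) \<le> T" if "norm z \<le> 3" for z
      unfolding y_def T_def using t that by (intro order_trans[OF norm_triangle_ineq]) (auto simp: mult.commute intro: mult_left_mono)
    have T0: "T \<ge> 0" using t by (simp add: T_def)
    show ?thesis
    proof (rule integral_directional_derivative_eq_0[OF contg[of i]])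
      show "g i z = 0" if "norm z > 1" for z
      proof -
        have "z \<bullet> z > 1" using that by (simp add: dot_square_norm)
        then show ?thesis by (simp add: g_def bump_def)
      qed
      fix a b :: 'a assume ab: "norm a \<le> 3" "norm b \<le> 3"
      let ?R = "\<lambda>z. reg_power \<epsilon> p (y z)"
      have yab: "norm (y b - y a) = t * norm (b - a)" using t
        by (simp add: y_def flip: scaleR_diff_right)
      have yi: "\<bar>y b \<bullet> i - y a \<bullet> i\<bar> \<le> t * norm (b - a)"
        using Basis_le_norm[OF i, of "y b - y a"] by (simp add: yab inner_diff_left)
      have yb: "\<bar>y b \<bullet> i\<bar> \<le> T" using Basis_le_norm[OF i, of "y b"] T[OF ab(2)] by simp
      have Rb: "\<bar>?R b\<bar> \<le> \<epsilon> powr - p" "\<bar>?R a\<bar> \<le> \<epsilon> powr - p"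
        using reg_power_le[OF \<epsilon>, of p "y a"] reg_power_le[OF \<epsilon>, of p "y b"] p0
          reg_power_pos[OF \<epsilon>, of p "y a"] reg_power_pos[OF \<epsilon>, of p "y b"] by auto
      have Rab: "\<bar>?R b - ?R a\<bar> \<le> C1 * (t * norm (b - a))"
        using reg_power_lipschitz[OF \<epsilon>, of p "y a" T "y b"] T ab p0 by (simp add: C1_def yab)
      have C10: "C1 \<ge> 0" using p0 T0 by (simp add: C1_def)
      have "g i b - g i a = (bump b - bump a) * (?R b * (y b \<bullet> i))
          + bump a * ((?R b - ?R a) * (y b \<bullet> i)) + bump a * (?R a * (y b \<bullet> i - y a \<bullet> i))"
        unfolding g_def by (simp add: algebra_simps)
      also have "\<bar>\<dots>\<bar> \<le> (3 * norm (b - a)) * (\<epsilon> powr - p * T)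
          + 1 * (C1 * (t * norm (b - a)) * T) + 1 * (\<epsilon> powr - p * (t * norm (b - a)))"
      proof (intro order_trans[OF abs_triangle_ineq] add_mono)
        show "\<bar>(bump b - bump a) * (?R b * (y b \<bullet> i))\<bar> \<le> (3 * norm (b - a)) * (\<epsilon> powr - p * T)"
          unfolding abs_mult by (intro mult_mono bump_lipschitz ab Rb yb) (use T0 in auto)
        show "\<bar>bump a * ((?R b - ?R a) * (y b \<bullet> i))\<bar> \<le> 1 * (C1 * (t * norm (b - a)) * T)"
          unfolding abs_mult by (intro mult_mono Rab yb) (use T0 C10 t bump_bounds[of a] in auto)
        show "\<bar>bump a * (?R a * (y b \<bullet> i - y a \<bullet> i))\<bar> \<le> 1 * (\<epsilon> powr - p * (t * norm (b - a)))"
          unfolding abs_mult by (intro mult_mono Rb yi) (use t bump_bounds[of a] in auto)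
      qed
      finally show "\<bar>g i b - g i a\<bar> \<le> (3 * (\<epsilon> powr - p * T) + C1 * t * T + \<epsilon> powr - p * t) * norm (b - a)"
        by (simp add: algebra_simps)
    next
      show "norm i = 1" using i by simp
      show "AE z in lborel. ((\<lambda>h. g i (z + h *\<^sub>R i)) has_real_derivative g2 i z - g1 i z) (at 0)"
        using AE_not_sphere[of 0 1]
      proof eventually_elim
        case (elim z)
        then have ne: "norm z \<noteq> 1" by simp
        have lim: "((\<lambda>h. norm (z + h *\<^sub>R i)) \<longlongrightarrow> norm (z + 0 *\<^sub>R i)) (nhds 0)"
          by (intro tendsto_intros filterlim_ident)
        show ?case
        proof (cases "norm z < 1")
          case True
          have ev: "eventually (\<lambda>h. norm (z + h *\<^sub>R i) < 1) (nhds 0)"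
            using order_tendstoD(2)[OF lim] True by simp
          have "((\<lambda>h. (1 - (z + h *\<^sub>R i) \<bullet> (z + h *\<^sub>R i)) / 2 *
                 (reg_power \<epsilon> p (y z + h *\<^sub>R (t *\<^sub>R i)) * ((y z + h *\<^sub>R (t *\<^sub>R i)) \<bullet> i)))
              has_real_derivative g2 i z - g1 i z) (at 0)"
          proof (rule DERIV_cong)
            have A: "((\<lambda>h. (1 - (z + h *\<^sub>R i) \<bullet> (z + h *\<^sub>R i)) / 2) has_real_derivative - (z \<bullet> i)) (at 0)"
              using DERIV_cdivide[OF DERIV_diff[OF DERIV_const[of 1] DERIV_inner_line[of z i 0]], of 2] by simp
            have "((\<lambda>h. y z \<bullet> i + h * t) has_real_derivative t) (at 0)" by (auto intro!: derivative_eq_intros)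
            then have C: "((\<lambda>h. (y z + h *\<^sub>R (t *\<^sub>R i)) \<bullet> i) has_real_derivative t) (at 0)"
              using i by (simp add: inner_add_left)
            show "((\<lambda>h. (1 - (z + h *\<^sub>R i) \<bullet> (z + h *\<^sub>R i)) / 2 *
                 (reg_power \<epsilon> p (y z + h *\<^sub>R (t *\<^sub>R i)) * ((y z + h *\<^sub>R (t *\<^sub>R i)) \<bullet> i)))
              has_real_derivative - (z \<bullet> i) * (reg_power \<epsilon> p (y z + 0 *\<^sub>R (t *\<^sub>R i)) * ((y z + 0 *\<^sub>R (t *\<^sub>R i)) \<bullet> i)) +
                 (- 2 * p * reg_power \<epsilon> (p + 1) (y z + 0 *\<^sub>R (t *\<^sub>R i)) * ((y z + 0 *\<^sub>R (t *\<^sub>R i)) \<bullet> (t *\<^sub>R i)) *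
                   ((y z + 0 *\<^sub>R (t *\<^sub>R i)) \<bullet> i) + t * reg_power \<epsilon> p (y z + 0 *\<^sub>R (t *\<^sub>R i))) *
                 ((1 - (z + 0 *\<^sub>R i) \<bullet> (z + 0 *\<^sub>R i)) / 2)) (at 0)"
              by (rule DERIV_mult[OF A DERIV_mult[OF DERIV_reg_power_line[OF \<epsilon>] C]])
            have "z \<bullet> z \<le> 1" using True by (simp add: dot_square_norm power_le_one)
            then have b: "bump z = (1 - z \<bullet> z) / 2" by (simp add: bump_def)
            show "- (z \<bullet> i) * (reg_power \<epsilon> p (y z + 0 *\<^sub>R (t *\<^sub>R i)) * ((y z + 0 *\<^sub>R (t *\<^sub>R i)) \<bullet> i)) +
                 (- 2 * p * reg_power \<epsilon> (p + 1) (y z + 0 *\<^sub>R (t *\<^sub>R i)) * ((y z + 0 *\<^sub>R (t *\<^sub>R i)) \<bullet> (t *\<^sub>R i)) *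
                   ((y z + 0 *\<^sub>R (t *\<^sub>R i)) \<bullet> i) + t * reg_power \<epsilon> p (y z + 0 *\<^sub>R (t *\<^sub>R i))) *
                 ((1 - (z + 0 *\<^sub>R i) \<bullet> (z + 0 *\<^sub>R i)) / 2) = g2 i z - g1 i z"
              using True by (simp add: g1_def g2_def b power2_eq_square algebra_simps diff_divide_distrib add_divide_distrib)
          qed
          then show ?thesis
          proof (rule DERIV_cong_ev[THEN iffD1, rotated -1])
            show "\<forall>\<^sub>F h in nhds 0. (1 - (z + h *\<^sub>R i) \<bullet> (z + h *\<^sub>R i)) / 2 *
                 (reg_power \<epsilon> p (y z + h *\<^sub>R (t *\<^sub>R i)) * ((y z + h *\<^sub>R (t *\<^sub>R i)) \<bullet> i)) = g i (z + h *\<^sub>R i)"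
              using ev
            proof eventually_elim
              case (elim h)
              then have "(z + h *\<^sub>R i) \<bullet> (z + h *\<^sub>R i) \<le> 1" by (simp only: dot_square_norm) (simp add: power_le_one)
              then show ?case by (simp add: g_def bump_def max_def y_def algebra_simps)
            qed
          qed auto
        next
          case False
          with ne have gt: "norm z > 1" by simp
          have ev: "eventually (\<lambda>h. norm (z + h *\<^sub>R i) > 1) (nhds 0)"
            using order_tendstoD(1)[OF lim] gt by simp
          have "((\<lambda>h. 0) has_real_derivative g2 i z - g1 i z) (at 0)" using gt by (simp add: g1_def g2_def)
          then show ?thesis
          proof (rule DERIV_cong_ev[THEN iffD1, rotated -1])
            show "\<forall>\<^sub>F h in nhds 0. 0 = g i (z + h *\<^sub>R i)"
              using ev
            proof eventually_elim
              case (elim h)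
              then have "(z + h *\<^sub>R i) \<bullet> (z + h *\<^sub>R i) > 1" by (simp only: dot_square_norm) simp
              then show ?case by (simp add: g_def bump_def)
            qed
          qed auto
        qed
      qed
      show "(\<lambda>z. g2 i z - g1 i z) \<in> borel_measurable borel"
        using I1[of i] I2[of i] by auto
    qed
  qed
  have "(LINT z|lborel. (\<Sum>i\<in>Basis. g2 i z)) = (LINT z|lborel. (\<Sum>i\<in>Basis. g1 i z))"
    using zero I1 I2 by simp
  moreover have "(\<Sum>i\<in>Basis. g1 i z) = indicator (cball 0 1) z * (reg_power \<epsilon> p (y z) * (y z \<bullet> z))" for z
  proof -
    have "(\<Sum>i\<in>Basis. g1 i z) = (\<Sum>i\<in>Basis. (indicator (cball 0 1) z * reg_power \<epsilon> p (y z)) * ((y z \<bullet> i) * (z \<bullet> i)))"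
      unfolding g1_def by (intro sum.cong) (auto simp: algebra_simps)
    also have "\<dots> = (indicator (cball 0 1) z * reg_power \<epsilon> p (y z)) * (y z \<bullet> z)"
      by (subst euclidean_inner[of "y z" z]) (simp only: sum_distrib_left)
    finally show ?thesis by simp
  qed
  moreover have "(\<Sum>i\<in>Basis. g2 i z) = indicator (cball 0 1) z * (bump z * t * real DIM('a) * \<epsilon> * reg_power \<epsilon> (p + 1) (y z))" for z
  proof -
    let ?c = "indicator (cball 0 1) z * bump z * t :: real"
    have "(\<Sum>i\<in>Basis. g2 i z) = (\<Sum>i\<in>Basis. ?c * (-2 * p) * reg_power \<epsilon> (p + 1) (y z) * ((y z \<bullet> i) * (y z \<bullet> i)) + ?c * reg_power \<epsilon> p (y z))"
      unfolding g2_def by (intro sum.cong) (auto simp: algebra_simps power2_eq_square)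
    also have "\<dots> = ?c * (-2 * p) * reg_power \<epsilon> (p + 1) (y z) * (y z \<bullet> y z) + real DIM('a) * (?c * reg_power \<epsilon> p (y z))"
      by (subst euclidean_inner[of "y z" "y z"]) (simp only: sum.distrib sum_distrib_left sum_constant)
    also have "\<dots> = ?c * real DIM('a) * \<epsilon> * reg_power \<epsilon> (p + 1) (y z)"
      unfolding reg_power_Suc[OF \<epsilon>, of p] using p by (simp add: algebra_simps)
    finally show ?thesis by simp
  qed
  ultimately show ?thesis by (simp add: y_def)
qed

text \<open>
  The derivative with respect to the radius is minus an integral of the nonnegative function \<open>- \<Delta>
  reg_power\<close> against the bump function, by \<open>integral_by_parts_reg_power\<close>.
\<close>

lemma reg_power_ball_integral:
  fixes x :: "'a::euclidean_space"
  defines "s \<equiv> real DIM('a) / 2 - 1"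
  defines "\<phi> \<equiv> \<lambda>\<epsilon> t. LINT z|lborel. indicator (cball 0 1) z * reg_power \<epsilon> s (x + t *\<^sub>R z)"
  defines "\<beta> \<equiv> \<lambda>\<epsilon> t. LINT z|lborel. indicator (cball 0 1) z * (bump z * t * real DIM('a) * \<epsilon> * reg_power \<epsilon> (s + 2) (x + t *\<^sub>R z))"
  assumes d: "DIM('a) \<ge> 3" and \<epsilon>: "\<epsilon> > 0" and t: "t \<ge> 0"
  shows "(\<phi> \<epsilon> has_real_derivative - 2 * s * \<beta> \<epsilon> t) (at t)"
proof -
  have s: "s > 0" using d by (simp add: s_def)
  define T where "T = norm x + t + 1"
  note [continuous_intros] = continuous_on_reg_power[OF \<epsilon>]
  have "((\<lambda>h. LINT z|lborel. indicator (cball 0 1) z * reg_power \<epsilon> s (x + (h + t) *\<^sub>R z)) has_real_derivative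
     (LINT z|lborel. indicator (cball 0 1) z * (- 2 * s * reg_power \<epsilon> (s + 1) (x + t *\<^sub>R z) * ((x + t *\<^sub>R z) \<bullet> z)))) (at 0)"
  proof (rule DERIV_integral_dominated[where L="\<lambda>z. indicator (cball 0 1) z * (2 * s * \<epsilon> powr (- s - 1) * T)"])
    show "integrable lborel (\<lambda>z. indicator (cball 0 1) z * reg_power \<epsilon> s (x + (h + t) *\<^sub>R z))" for h
      by (intro integrable_cball_continuous continuous_intros)
    show "integrable lborel (\<lambda>z::'a. indicator (cball 0 1) z * (2 * s * \<epsilon> powr (- s - 1) * T))"
      by (intro integrable_cball_continuous continuous_intros)
    show "(\<lambda>z. indicator (cball 0 1) z * (- 2 * s * reg_power \<epsilon> (s + 1) (x + t *\<^sub>R z) * ((x + t *\<^sub>R z) \<bullet> z))) \<in> borel_measurable lborel"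
      by (rule borel_measurable_integrable[OF integrable_cball_continuous]) (intro continuous_intros)
    show "AE z in lborel. ((\<lambda>h. indicator (cball 0 1) z * reg_power \<epsilon> s (x + (h + t) *\<^sub>R z)) has_real_derivative
         indicator (cball 0 1) z * (- 2 * s * reg_power \<epsilon> (s + 1) (x + t *\<^sub>R z) * ((x + t *\<^sub>R z) \<bullet> z))) (at 0)"
    proof (rule AE_I2)
      fix z :: 'a
      have e: "x + t *\<^sub>R z + h *\<^sub>R z = x + (h + t) *\<^sub>R z" for h by (simp add: algebra_simps)
      have "((\<lambda>h. reg_power \<epsilon> s (x + (h + t) *\<^sub>R z)) has_real_derivative
         (- 2 * s * reg_power \<epsilon> (s + 1) (x + t *\<^sub>R z) * ((x + t *\<^sub>R z) \<bullet> z))) (at 0)"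
        using DERIV_reg_power_line[OF \<epsilon>, of s "x + t *\<^sub>R z" z 0] unfolding e by simp
      then show "((\<lambda>h. indicator (cball 0 1) z * reg_power \<epsilon> s (x + (h + t) *\<^sub>R z)) has_real_derivative
         indicator (cball 0 1) z * (- 2 * s * reg_power \<epsilon> (s + 1) (x + t *\<^sub>R z) * ((x + t *\<^sub>R z) \<bullet> z))) (at 0)"
        by (rule DERIV_cmult)
    qed
    fix h :: real and z :: 'a assume h: "\<bar>h\<bar> \<le> 1"
    show "\<bar>indicator (cball 0 1) z * reg_power \<epsilon> s (x + (h + t) *\<^sub>R z) - indicator (cball 0 1) z * reg_power \<epsilon> s (x + (0 + t) *\<^sub>R z)\<bar>
        \<le> indicator (cball 0 1) z * (2 * s * \<epsilon> powr (- s - 1) * T) * \<bar>h\<bar>"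
    proof (cases "norm z \<le> 1")
      case True
      have n: "norm (x + k *\<^sub>R z) \<le> T" if "\<bar>k\<bar> \<le> t + 1" for k
      proof -
        have "norm (x + k *\<^sub>R z) \<le> norm x + \<bar>k\<bar> * norm z" by (metis norm_scaleR norm_triangle_ineq)
        also have "\<dots> \<le> norm x + (t + 1) * 1" using that True t by (intro add_mono mult_mono) auto
        finally show ?thesis by (simp add: T_def)
      qed
      have T: "T \<ge> 0" using t by (simp add: T_def)
      have "\<bar>reg_power \<epsilon> s (x + (h + t) *\<^sub>R z) - reg_power \<epsilon> s (x + t *\<^sub>R z)\<bar>
          \<le> 2 * s * \<epsilon> powr (- s - 1) * T * norm ((x + (h + t) *\<^sub>R z) - (x + t *\<^sub>R z))"
        using n[of "h+t"] n[of t] h t s by (intro reg_power_lipschitz \<epsilon>) auto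
      also have "(x + (h + t) *\<^sub>R z) - (x + t *\<^sub>R z) = h *\<^sub>R z" by (simp add: algebra_simps)
      also have "2 * s * \<epsilon> powr (- s - 1) * T * norm (h *\<^sub>R z) \<le> 2 * s * \<epsilon> powr (- s - 1) * T * \<bar>h\<bar>"
        using True s T by (intro mult_left_mono) (auto intro: mult_left_le)
      finally show ?thesis using True by simp
    qed simp
  qed
  then have "((\<lambda>h. \<phi> \<epsilon> (h + t)) has_real_derivative
     (LINT z|lborel. indicator (cball 0 1) z * (- 2 * s * reg_power \<epsilon> (s + 1) (x + t *\<^sub>R z) * ((x + t *\<^sub>R z) \<bullet> z)))) (at 0)"
    by (simp only: \<phi>_def)
  also have "(LINT z|lborel. indicator (cball 0 1) z * (- 2 * s * reg_power \<epsilon> (s + 1) (x + t *\<^sub>R z) * ((x + t *\<^sub>R z) \<bullet> z)))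
     = (LINT z|lborel. (- 2 * s) * (indicator (cball 0 1) z * (reg_power \<epsilon> (s + 1) (x + t *\<^sub>R z) * ((x + t *\<^sub>R z) \<bullet> z))))"
    by (intro Bochner_Integration.integral_cong) auto
  also have "\<dots> = - 2 * s * \<beta> \<epsilon> t"
  proof -
    have e: "2 * (s + 1) = real DIM('a)" "s + 1 + 1 = s + 2" by (simp_all add: s_def)
    show ?thesis
      using integral_by_parts_reg_power[OF \<epsilon> e(1) t, of x] unfolding e(2)
      by (simp add: \<beta>_def)
  qed
  finally show ?thesis using DERIV_shift[of "\<phi> \<epsilon>" _ 0 t] by simp
qed

text \<open>
  The derivative just computed is nonpositive, and of order \<open>\<epsilon>\<close> as long as the ball stays away
  from the origin. The second part yields equality in the limit.
\<close>

lemma reg_power_mean: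
  fixes x :: "'a::euclidean_space"
  defines "s \<equiv> real DIM('a) / 2 - 1"
  defines "\<phi> \<equiv> \<lambda>\<epsilon> t. LINT z|lborel. indicator (cball 0 1) z * reg_power \<epsilon> s (x + t *\<^sub>R z)"
  assumes d: "DIM('a) \<ge> 3" and r: "r \<ge> 0"
  shows "\<epsilon> > 0 \<Longrightarrow> 0 \<le> r0 \<Longrightarrow> r0 \<le> r \<Longrightarrow> \<phi> \<epsilon> r \<le> \<phi> \<epsilon> r0"
    and "r < norm x \<Longrightarrow> \<exists>C. \<forall>\<epsilon>>0. \<phi> \<epsilon> r \<ge> \<phi> \<epsilon> 0 - C * \<epsilon>"
proof -
  have s: "s > 0" using d by (simp add: s_def)
  define \<beta> where "\<beta> \<epsilon> t = (LINT z|lborel. indicator (cball 0 1) z * (bump z * t * real DIM('a) * \<epsilon> * reg_power \<epsilon> (s + 2) (x + t *\<^sub>R z)))" for \<epsilon> t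
  have der: "(\<phi> \<epsilon> has_real_derivative - 2 * s * \<beta> \<epsilon> t) (at t)" if "t \<ge> 0" "\<epsilon> > 0" for t \<epsilon>
    unfolding \<phi>_def \<beta>_def s_def by (rule reg_power_ball_integral[OF d that(2,1)])
  have \<beta>0: "\<beta> \<epsilon> t \<ge> 0" if "t \<ge> 0" "\<epsilon> > 0" for t \<epsilon>
    unfolding \<beta>_def using that bump_bounds
    by (intro integral_nonneg_AE AE_I2 mult_nonneg_nonneg) auto
  show "\<phi> \<epsilon> r \<le> \<phi> \<epsilon> r0" if \<epsilon>: "\<epsilon> > 0" and r0: "0 \<le> r0" "r0 \<le> r"
  proof (rule DERIV_nonpos_imp_nonincreasing[OF r0(2)])
    fix t :: real assume "r0 \<le> t" "t \<le> r"
    then have t: "0 \<le> t" using r0 by simp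
    have "- 2 * s * \<beta> \<epsilon> t \<le> 0" using \<beta>0[OF t \<epsilon>] s by simp
    then show "\<exists>y. (\<phi> \<epsilon> has_real_derivative y) (at t) \<and> y \<le> 0" using der[OF t \<epsilon>] by blast
  qed
  show "\<exists>C. \<forall>\<epsilon>>0. \<phi> \<epsilon> r \<ge> \<phi> \<epsilon> 0 - C * \<epsilon>" if rx: "r < norm x"
  proof -
    define \<delta> where "\<delta> = norm x - r"
    have \<delta>: "\<delta> > 0" using rx by (simp add: \<delta>_def)
    define V where "V = (LINT z|lborel. indicator (cball (0::'a) 1) z * (1::real))"
    define C where "C = r * real DIM('a) * (\<delta>\<^sup>2) powr (- (s + 2))"
    have \<beta>C: "\<beta> \<epsilon> t \<le> C * \<epsilon> * V" if t: "t \<ge> 0" "t \<le> r" and \<epsilon>: "\<epsilon> > 0" for t \<epsilon>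
    proof -
      note [continuous_intros] = continuous_on_reg_power[OF \<epsilon>]
      have "\<beta> \<epsilon> t \<le> (LINT z|lborel. indicator (cball (0::'a) 1) z * (C * \<epsilon>))"
        unfolding \<beta>_def
      proof (rule integral_mono)
        fix z :: 'a
        show "indicator (cball 0 1) z * (bump z * t * real DIM('a) * \<epsilon> * reg_power \<epsilon> (s + 2) (x + t *\<^sub>R z))
          \<le> indicator (cball (0::'a) 1) z * (C * \<epsilon>)"
        proof (cases "norm z \<le> 1")
          case True
          have "norm (t *\<^sub>R z) \<le> r" using True t mult_mono[of t r "norm z" 1] by simp
          then have "\<delta> \<le> norm (x + t *\<^sub>R z)" unfolding \<delta>_def
            using norm_triangle_ineq4[of "x + t *\<^sub>R z" "t *\<^sub>R z"] by simp
          then have "\<delta>\<^sup>2 \<le> (x + t *\<^sub>R z) \<bullet> (x + t *\<^sub>R z) + \<epsilon>"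
            using \<delta> \<epsilon> power_mono[of \<delta> "norm (x + t *\<^sub>R z)" 2] unfolding dot_square_norm by linarith
          then have R: "reg_power \<epsilon> (s + 2) (x + t *\<^sub>R z) \<le> (\<delta>\<^sup>2) powr (- (s + 2))"
            unfolding reg_power_def using s \<delta> by (intro powr_mono2') auto
          have "bump z * t * real DIM('a) * \<epsilon> * reg_power \<epsilon> (s + 2) (x + t *\<^sub>R z)
            \<le> 1 * r * real DIM('a) * \<epsilon> * (\<delta>\<^sup>2) powr (- (s + 2))"
            using t \<epsilon> bump_bounds[of z] reg_power_pos[OF \<epsilon>, of "s + 2" "x + t *\<^sub>R z"]
            by (intro mult_mono R) auto
          also have "\<dots> = C * \<epsilon>" by (simp add: C_def)
          finally show ?thesis using True by simp
        qed simp
      qed (intro integrable_cball_continuous continuous_intros)+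
      also have "\<dots> = C * \<epsilon> * V" unfolding V_def by (simp add: mult.commute)
      finally show ?thesis .
    qed
    have "\<phi> \<epsilon> r \<ge> \<phi> \<epsilon> 0 - (2 * s * C * V * r) * \<epsilon>" if \<epsilon>: "\<epsilon> > 0" for \<epsilon>
    proof -
      have "\<phi> \<epsilon> 0 + 2 * s * C * \<epsilon> * V * 0 \<le> \<phi> \<epsilon> r + 2 * s * C * \<epsilon> * V * r"
      proof (rule DERIV_nonneg_imp_nondecreasing[OF r, of "\<lambda>t. \<phi> \<epsilon> t + 2 * s * C * \<epsilon> * V * t"])
        fix t :: real assume t: "0 \<le> t" "t \<le> r"
        have "((\<lambda>t. \<phi> \<epsilon> t + 2 * s * C * \<epsilon> * V * t) has_real_derivative - 2 * s * \<beta> \<epsilon> t + 2 * s * C * \<epsilon> * V) (at t)"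
          using der[OF t(1) \<epsilon>] by (auto intro!: derivative_eq_intros)
        moreover have "2 * s * \<beta> \<epsilon> t \<le> 2 * s * (C * \<epsilon> * V)"
          using \<beta>C[OF t \<epsilon>] s by (intro mult_left_mono) auto
        ultimately show "\<exists>y. ((\<lambda>t. \<phi> \<epsilon> t + 2 * s * C * \<epsilon> * V * t) has_real_derivative y) (at t) \<and> y \<ge> 0"
          by (intro exI[of _ "- 2 * s * \<beta> \<epsilon> t + 2 * s * C * \<epsilon> * V"]) (auto simp: algebra_simps)
      qed
      then show ?thesis by (simp add: algebra_simps)
    qed
    then show ?thesis by blast
  qed
qed

text \<open>
  The extended real value \<open>\<infinity>\<close> at the origin makes the kernel lower semicontinuous and
  superharmonic there; as a real function it would have the value 0 at the origin.
\<close>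

definition newton :: "'a::euclidean_space \<Rightarrow> ennreal" where
  "newton x = (if x = 0 then top else ennreal (norm x powr (2 - real DIM('a))))"

text \<open>
  Means over the ball \<open>B(x, r)\<close> are expressed as expectations of \<open>f (x + r u)\<close> with \<open>u\<close> uniform in
  the unit ball. In this form radii may depend on \<open>x\<close>, and a radius 0 is allowed.
\<close>

definition unit_ball_dist :: "'a::euclidean_space measure" where
  "unit_ball_dist = uniform_measure lborel (cball 0 1)"

lemma cball_emeasure:
  "r > 0 \<Longrightarrow> emeasure lborel (cball (x::'a::euclidean_space) r) = ennreal (measure lborel (cball x r))"
  "r > 0 \<Longrightarrow> measure lborel (cball (x::'a::euclidean_space) r) > 0"
proof -
  assume r: "r > 0"
  have fin: "emeasure lborel (cball x r) < \<infinity>" by (intro emeasure_bounded_finite) auto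
  then show "emeasure lborel (cball (x::'a::euclidean_space) r) = ennreal (measure lborel (cball x r))"
    by (intro emeasure_eq_ennreal_measure) auto
  show "measure lborel (cball (x::'a::euclidean_space) r) > 0"
    using r content_cball_pos[of r x] by (simp add: measure_completion)
qed

lemma emeasure_cball_center: "emeasure lborel (cball (x::'a::euclidean_space) r) = emeasure lborel (cball (0::'a) r)"
proof (cases "r > 0")
  case True
  have "measure lborel (cball x r) = measure lborel (cball (0::'a) r)"
    using content_cball[of r x] content_cball[of r "0::'a"] True by (simp add: measure_completion)
  then show ?thesis using cball_emeasure(1)[OF True, of x] cball_emeasure(1)[OF True, of "0::'a"] by simp
next
  case False
  then show ?thesis by (cases "r = 0") auto
qed

lemma sets_unit_ball_dist [simp, measurable_cong]: "sets unit_ball_dist = sets borel"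
  by (simp add: unit_ball_dist_def)

lemma space_unit_ball_dist [simp]: "space unit_ball_dist = UNIV"
  by (simp add: unit_ball_dist_def)

lemma prob_space_unit_ball_dist: "prob_space unit_ball_dist"
  unfolding unit_ball_dist_def
  by (rule prob_space_uniform_measure) (use cball_emeasure[of 1 "0::'a"] in auto)

interpretation unit_ball_dist: prob_space unit_ball_dist
  by (rule prob_space_unit_ball_dist)

lemma nn_integral_unit_ball_dist:
  fixes f :: "'a::euclidean_space \<Rightarrow> ennreal"
  assumes [measurable]: "f \<in> borel_measurable borel"
  shows "(\<integral>\<^sup>+u. f u \<partial>unit_ball_dist) = (\<integral>\<^sup>+u. indicator (cball 0 1) u * f u \<partial>lborel) / emeasure lborel (cball (0::'a::euclidean_space) 1)"
  unfolding unit_ball_dist_def by (subst nn_integral_uniform_measure) (auto simp: mult.commute)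

lemma AE_unit_ball_dist: "AE u in unit_ball_dist. norm u \<le> 1"
  unfolding unit_ball_dist_def
  by (rule AE_uniform_measureI) auto

lemma newton_measurable [measurable]: "newton \<in> borel_measurable borel"
  unfolding newton_def by measurable

lemma newton_eq_norm_cong:
  fixes x y :: "'a::euclidean_space"
  shows "norm x = norm y \<Longrightarrow> newton x = newton y"
  by (cases "x = 0"; cases "y = 0") (auto simp: newton_def)

lemma newton_minus [simp]: "newton (- x) = newton x"
  by (rule newton_eq_norm_cong) simp

lemma newton_minus_commute: "newton (x - y) = newton (y - x)"
  by (rule newton_eq_norm_cong) (rule norm_minus_commute)

lemma newton_antimono:
  fixes x y :: "'a::euclidean_space"
  assumes "DIM('a) \<ge> 3" "norm x \<le> norm y"
  shows "newton y \<le> newton x"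
  using assms by (auto simp: newton_def intro!: ennreal_leI powr_mono2')

lemma newton_finite: "x \<noteq> 0 \<Longrightarrow> newton x < top"
  by (simp add: newton_def)

lemma reg_power_LIMSEQ_newton:
  fixes x :: "'a::euclidean_space"
  assumes d: "DIM('a) \<ge> 3"
  shows "incseq (\<lambda>n. ennreal (reg_power (1 / Suc n) (real DIM('a) / 2 - 1) x))"
    and "(SUP n. ennreal (reg_power (1 / Suc n) (real DIM('a) / 2 - 1) x)) = newton x"
proof -
  define s where "s = real DIM('a) / 2 - 1"
  have s: "s > 0" using d by (simp add: s_def)
  show inc: "incseq (\<lambda>n. ennreal (reg_power (1 / Suc n) (real DIM('a) / 2 - 1) x))"
    unfolding s_def[symmetric]
  proof (intro monoI ennreal_leI)
    fix m n :: nat assume "m \<le> n"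
    then have "1 / real (Suc n) \<le> 1 / real (Suc m)" by (simp add: field_simps)
    then show "reg_power (1 / Suc m) s x \<le> reg_power (1 / Suc n) s x"
      unfolding reg_power_def using s by (intro powr_mono2') (auto intro!: add_nonneg_pos)
  qed
  have eps: "(\<lambda>n. 1 / real (Suc n)) \<longlonglongrightarrow> 0" using LIMSEQ_inverse_real_of_nat by (simp add: inverse_eq_divide)
  have "(\<lambda>n. ennreal (reg_power (1 / Suc n) s x)) \<longlonglongrightarrow> newton x"
  proof (cases "x = 0")
    case False
    have "(\<lambda>n. reg_power (1 / Suc n) s x) \<longlonglongrightarrow> (x \<bullet> x + 0) powr (- s)"
      unfolding reg_power_def using False by (intro tendsto_intros eps) auto
    also have "(x \<bullet> x + 0) powr (- s) = norm x powr (2 - real DIM('a))"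
      using False by (simp add: dot_square_norm powr_powr s_def flip: powr_numeral)
    finally show ?thesis using False by (auto simp: newton_def intro!: tendsto_intros)
  next
    case True
    have "filterlim (\<lambda>n. real (Suc n) powr s) at_top sequentially"
      using s by real_asymp
    also have "(\<lambda>n. real (Suc n) powr s) = (\<lambda>n. reg_power (1 / Suc n) s x)"
      using True by (auto simp: reg_power_def powr_minus powr_divide fun_eq_iff)
    finally show ?thesis using True
      by (simp add: newton_def tendsto_top_iff_ennreal filterlim_at_top_dense ennreal_less_iff)
  qed
  then show "(SUP n. ennreal (reg_power (1 / Suc n) (real DIM('a) / 2 - 1) x)) = newton x"
    unfolding s_def[symmetric] using LIMSEQ_SUP[OF inc] LIMSEQ_unique unfolding s_def by blast
qed

lemma nn_integral_reg_power_unit_ball: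
  fixes x :: "'a::euclidean_space"
  assumes \<epsilon>: "\<epsilon> > 0"
  shows "(\<integral>\<^sup>+u. ennreal (reg_power \<epsilon> p (x + r *\<^sub>R u)) \<partial>unit_ball_dist)
     = ennreal ((LINT z|lborel. indicator (cball 0 1) z * reg_power \<epsilon> p (x + r *\<^sub>R z)) / measure lborel (cball (0::'a) 1))"
proof -
  note [continuous_intros] = continuous_on_reg_power[OF \<epsilon>]
  have [measurable]: "(\<lambda>u. reg_power \<epsilon> p (x + r *\<^sub>R u)) \<in> borel_measurable borel"
    by (intro borel_measurable_continuous_onI continuous_intros)
  have "(\<integral>\<^sup>+u. ennreal (reg_power \<epsilon> p (x + r *\<^sub>R u)) \<partial>unit_ball_dist)
     = (\<integral>\<^sup>+u. ennreal (indicator (cball 0 1) u * reg_power \<epsilon> p (x + r *\<^sub>R u)) \<partial>lborel) / emeasure lborel (cball (0::'a) 1)"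
    by (subst nn_integral_unit_ball_dist) (auto simp: ennreal_mult' ennreal_indicator)
  also have "\<dots> = ennreal (LINT z|lborel. indicator (cball 0 1) z * reg_power \<epsilon> p (x + r *\<^sub>R z)) / ennreal (measure lborel (cball (0::'a) 1))"
    by (subst nn_integral_eq_integral)
       (auto intro!: integrable_cball_continuous continuous_intros simp: cball_emeasure(1))
  also have "\<dots> = ennreal ((LINT z|lborel. indicator (cball 0 1) z * reg_power \<epsilon> p (x + r *\<^sub>R z)) / measure lborel (cball (0::'a) 1))"
    by (intro divide_ennreal cball_emeasure integral_nonneg_AE AE_I2) (auto intro: mult_nonneg_nonneg)
  finally show ?thesis .
qed

lemma newton_mean_antimono:
  fixes x :: "'a::euclidean_space"
  assumes d: "DIM('a) \<ge> 3" and r: "0 \<le> r" "r \<le> R"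
  shows "(\<integral>\<^sup>+u. newton (x + R *\<^sub>R u) \<partial>unit_ball_dist) \<le> (\<integral>\<^sup>+u. newton (x + r *\<^sub>R u) \<partial>unit_ball_dist)"
proof -
  let ?R = "\<lambda>n. reg_power (1 / Suc n) (real DIM('a) / 2 - 1) :: 'a \<Rightarrow> real"
  have R: "0 \<le> R" using r by simp
  have eps: "1 / real (Suc n) > 0" for n by simp
  have [measurable]: "(\<lambda>u. ?R n (x + r *\<^sub>R u)) \<in> borel_measurable borel" for n r
    by (intro borel_measurable_continuous_onI continuous_intros continuous_on_reg_power) auto
  have *: "(\<integral>\<^sup>+u. newton (x + r *\<^sub>R u) \<partial>unit_ball_dist) = (SUP n. \<integral>\<^sup>+u. ennreal (?R n (x + r *\<^sub>R u)) \<partial>unit_ball_dist)" for r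
  proof -
    have "(\<integral>\<^sup>+u. newton (x + r *\<^sub>R u) \<partial>unit_ball_dist) = (\<integral>\<^sup>+u. (SUP n. ennreal (?R n (x + r *\<^sub>R u))) \<partial>unit_ball_dist)"
      by (simp only: reg_power_LIMSEQ_newton(2)[OF d])
    also have "\<dots> = (SUP n. \<integral>\<^sup>+u. ennreal (?R n (x + r *\<^sub>R u)) \<partial>unit_ball_dist)"
      using reg_power_LIMSEQ_newton(1)[OF d]
      by (intro nn_integral_monotone_convergence_SUP) (auto simp: incseq_def le_fun_def)
    finally show ?thesis .
  qed
  show ?thesis unfolding *
  proof (rule SUP_mono)
    fix n :: nat
    let ?I = "\<lambda>r. LINT z|lborel. indicator (cball 0 1) z * ?R n (x + r *\<^sub>R z)"
    have "?I R / measure lborel (cball (0::'a) 1) \<le> ?I r / measure lborel (cball (0::'a) 1)"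
      by (intro divide_right_mono reg_power_mean(1)[OF d R] r) auto
    then show "\<exists>m\<in>UNIV. (\<integral>\<^sup>+u. ennreal (?R n (x + R *\<^sub>R u)) \<partial>unit_ball_dist)
        \<le> (\<integral>\<^sup>+u. ennreal (?R m (x + r *\<^sub>R u)) \<partial>unit_ball_dist)"
      using nn_integral_reg_power_unit_ball[OF eps[of n], of "real DIM('a) / 2 - 1" x]
      by (intro bexI[of _ n]) (auto intro!: ennreal_leI)
  qed
qed

lemma newton_mean_le:
  fixes x :: "'a::euclidean_space"
  assumes d: "DIM('a) \<ge> 3" and r: "r \<ge> 0"
  shows "(\<integral>\<^sup>+u. newton (x + r *\<^sub>R u) \<partial>unit_ball_dist) \<le> newton x"
  using newton_mean_antimono[OF d order.refl r, of x] by (simp add: unit_ball_dist.emeasure_space_1 flip: space_unit_ball_dist)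

text \<open>
  For the regularised kernels equality holds up to an error of order \<open>\<epsilon>\<close>, by \<open>reg_power_mean\<close>.
\<close>

lemma newton_mean_eq:
  fixes x :: "'a::euclidean_space"
  assumes d: "DIM('a) \<ge> 3" and r: "r \<ge> 0" and rx: "r < norm x"
  shows "(\<integral>\<^sup>+u. newton (x + r *\<^sub>R u) \<partial>unit_ball_dist) = newton x"
proof (rule antisym[OF newton_mean_le[OF d r]])
  let ?R = "\<lambda>n. reg_power (1 / Suc n) (real DIM('a) / 2 - 1) :: 'a \<Rightarrow> real"
  let ?V = "measure lborel (cball (0::'a) 1)"
  have V: "?V > 0" by (rule cball_emeasure) simp
  have eps: "1 / real (Suc n) > 0" for n by simp
  from reg_power_mean(2)[OF d r rx] obtain C where
    C: "\<And>\<epsilon>. \<epsilon> > 0 \<Longrightarrow> (LINT z|lborel. indicator (cball 0 1) z * reg_power \<epsilon> (real DIM('a) / 2 - 1) (x + r *\<^sub>R z))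
      \<ge> (LINT z|lborel. indicator (cball 0 1) z * reg_power \<epsilon> (real DIM('a) / 2 - 1) (x + 0 *\<^sub>R z)) - C * \<epsilon>" by blast
  define C' where "C' = \<bar>C\<bar> / ?V"
  have C'0: "C' \<ge> 0" using V by (simp add: C'_def)
  let ?N = "\<integral>\<^sup>+u. newton (x + r *\<^sub>R u) \<partial>unit_ball_dist"
  have le: "ennreal (?R n x) \<le> ?N + ennreal (C' * (1 / Suc n))" for n
  proof -
    let ?I = "\<lambda>r. LINT z|lborel. indicator (cball 0 1) z * ?R n (x + r *\<^sub>R z)"
    have "?R n x = ?I 0 / ?V" using V by simp
    also have "\<dots> \<le> (?I r + \<bar>C\<bar> * (1 / Suc n)) / ?V"
      using C[OF eps[of n]] abs_ge_self[of "C * (1 / Suc n)"] V by (intro divide_right_mono) (auto simp: abs_mult)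
    also have "\<dots> = ?I r / ?V + C' * (1 / Suc n)" by (simp add: C'_def add_divide_distrib)
    finally have "ennreal (?R n x) \<le> ennreal (?I r / ?V + C' * (1 / Suc n))" by (rule ennreal_leI)
    also have "\<dots> = ennreal (?I r / ?V) + ennreal (C' * (1 / Suc n))"
      using V C'0 by (intro ennreal_plus divide_nonneg_nonneg integral_nonneg_AE AE_I2) auto
    also have "ennreal (?I r / ?V) = (\<integral>\<^sup>+u. ennreal (?R n (x + r *\<^sub>R u)) \<partial>unit_ball_dist)"
      by (rule nn_integral_reg_power_unit_ball[OF eps, symmetric])
    also have "\<dots> \<le> ?N"
      by (intro nn_integral_mono) (metis reg_power_LIMSEQ_newton(2)[OF d] SUP_upper UNIV_I)
    finally show ?thesis by (simp add: add_right_mono)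
  qed
  have "(\<lambda>n. ennreal (?R n x)) \<longlonglongrightarrow> newton x"
    using LIMSEQ_SUP[OF reg_power_LIMSEQ_newton(1)[OF d, of x]] by (simp only: reg_power_LIMSEQ_newton(2)[OF d])
  moreover have "(\<lambda>n. ?N + ennreal (C' * (1 / Suc n))) \<longlonglongrightarrow> ?N + ennreal (C' * 0)"
    using LIMSEQ_inverse_real_of_nat by (intro tendsto_intros) (simp add: inverse_eq_divide)
  ultimately show "newton x \<le> ?N" using le by (auto intro: LIMSEQ_le)
qed

lemma nn_integral_unit_ball_affine:
  fixes f :: "'a::euclidean_space \<Rightarrow> ennreal"
  assumes [measurable]: "f \<in> borel_measurable borel" and r: "r \<noteq> 0"
  shows "(\<integral>\<^sup>+u. f (x + r *\<^sub>R u) \<partial>unit_ball_dist)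
    = (\<integral>\<^sup>+z. indicator (cball x \<bar>r\<bar>) z * f z \<partial>lborel) / emeasure lborel (cball x \<bar>r\<bar>)"
proof -
  define c :: ennreal where "c = ennreal (\<bar>r\<bar> ^ DIM('a))"
  have c: "c \<noteq> 0" "c \<noteq> top" using r by (simp_all add: c_def)
  have [measurable]: "cball y s \<in> sets borel" for y :: 'a and s by simp
  have *: "(\<integral>\<^sup>+z. indicator (cball x \<bar>r\<bar>) z * g z \<partial>lborel) = c * (\<integral>\<^sup>+u. indicator (cball 0 1) u * g (x + r *\<^sub>R u) \<partial>lborel)"
    if [measurable]: "g \<in> borel_measurable borel" for g :: "'a \<Rightarrow> ennreal"
  proof -
    have ind: "indicator (cball x \<bar>r\<bar>) (x + r *\<^sub>R u) = (indicator (cball 0 1) u :: ennreal)" for u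
      using r by (auto simp: indicator_def dist_norm)
    have "(\<integral>\<^sup>+z. indicator (cball x \<bar>r\<bar>) z * g z \<partial>lborel)
      = (\<integral>\<^sup>+z. indicator (cball x \<bar>r\<bar>) z * g z \<partial>density (distr lborel borel (\<lambda>u. x + r *\<^sub>R u)) (\<lambda>_. \<bar>r\<bar> ^ DIM('a)))"
      by (subst lborel_affine[OF r, of x]) simp
    also have "\<dots> = c * (\<integral>\<^sup>+u. indicator (cball x \<bar>r\<bar>) (x + r *\<^sub>R u) * g (x + r *\<^sub>R u) \<partial>lborel)"
      by (subst nn_integral_density; (subst nn_integral_distr)?) (auto simp: nn_integral_cmult nn_integral_distr c_def)
    finally show ?thesis by (simp add: ind)
  qed
  have "emeasure lborel (cball x \<bar>r\<bar>) = c * emeasure lborel (cball (0::'a) 1)"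
    using *[of "\<lambda>_. 1"] by simp
  then show ?thesis
    using *[of f] c by (simp add: nn_integral_unit_ball_dist mult.commute[of c] divide_mult_eq)
qed

lemma nn_integral_unit_ball_uminus:
  fixes f :: "'a::euclidean_space \<Rightarrow> ennreal"
  assumes "f \<in> borel_measurable borel"
  shows "(\<integral>\<^sup>+u. f (- u) \<partial>unit_ball_dist) = (\<integral>\<^sup>+u. f u \<partial>unit_ball_dist)"
  using nn_integral_unit_ball_affine[OF assms, of "-1" 0] nn_integral_unit_ball_affine[OF assms, of 1 0] by simp

lemma ennreal_divide_mult_cancel: "a \<noteq> 0 \<Longrightarrow> a \<noteq> top \<Longrightarrow> x / a * a = (x :: ennreal)"
proof -
  assume a: "a \<noteq> 0" "a \<noteq> top"
  have "x / a * a = a * (x / a)" by (rule mult.commute)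
  also have "\<dots> = a * x / a" by (rule ennreal_times_divide)
  also have "a * x = x * a" by (rule mult.commute)
  also have "x * a / a = x" by (rule mult_divide_eq_ennreal[OF a])
  finally show ?thesis .
qed

text \<open>
  Far from the origin the mean is at most the value at the centre. Near the origin the ball of
  radius \<open>r\<close> is contained in a larger ball whose centre \<open>p\<close> is not the origin, and the mean over
  that one is at most \<open>newton p\<close>.
\<close>

lemma newton_mean_bounded:
  assumes d: "DIM('a::euclidean_space) \<ge> 3" and r: "r > 0"
  shows "\<exists>C\<ge>0. \<forall>x::'a. (\<integral>\<^sup>+u. newton (x + r *\<^sub>R u) \<partial>unit_ball_dist) \<le> ennreal C"
proof -
  obtain e :: 'a where e: "e \<in> Basis" using nonempty_Basis by blast
  define p where "p = (3 * r) *\<^sub>R e"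
  have np: "norm p = 3 * r" using e r by (simp add: p_def)
  then have p0: "p \<noteq> 0" using r by auto
  define K where "K = newton p * emeasure lborel (cball (p::'a) (7 * r)) / emeasure lborel (cball (p::'a) r)"
  have ce: "emeasure lborel (cball x r) = emeasure lborel (cball p r)" for x :: 'a
    by (simp only: emeasure_cball_center[of x] emeasure_cball_center[of p])
  have Kfin: "K < top" unfolding K_def
    using newton_finite[OF p0] cball_emeasure[OF r, of p] cball_emeasure(1)[of "7 * r" p] r
    by (auto simp flip: top.not_eq_extremum simp: ennreal_mult_eq_top_iff ennreal_divide_eq_top_iff)
  have *: "(\<integral>\<^sup>+u. newton (x + r *\<^sub>R u) \<partial>unit_ball_dist) \<le> max K (newton p)" for x :: 'a
  proof (cases "norm x \<ge> 3 * r")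
    case True
    have "(\<integral>\<^sup>+u. newton (x + r *\<^sub>R u) \<partial>unit_ball_dist) \<le> newton x" using r by (intro newton_mean_le d) auto
    also have "\<dots> \<le> newton p" by (rule newton_antimono[OF d]) (use True np in simp)
    finally show ?thesis by (simp add: le_max_iff_disj)
  next
    case False
    have sub: "cball x r \<subseteq> cball p (7 * r)"
    proof
      fix z assume "z \<in> cball x r"
      then have "norm (z - x) \<le> r" by (simp add: dist_norm norm_minus_commute)
      moreover have "p - z = p - x - (z - x)" by simp
      then have "norm (p - z) \<le> norm p + norm x + norm (z - x)"
        by (metis norm_triangle_ineq4 norm_triangle_le_diff order_trans add_right_mono)
      ultimately show "z \<in> cball p (7 * r)" using False np by (simp add: dist_norm)
    qed
    have "(\<integral>\<^sup>+z. indicator (cball x r) z * newton z \<partial>lborel) \<le> (\<integral>\<^sup>+z. indicator (cball p (7 * r)) z * newton z \<partial>lborel)"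
      using sub by (intro nn_integral_mono) (auto simp: indicator_def)
    also have "\<dots> = (\<integral>\<^sup>+u. newton (p + (7 * r) *\<^sub>R u) \<partial>unit_ball_dist) * emeasure lborel (cball p (7 * r))"
    proof -
      have "emeasure lborel (cball p (7 * r)) \<noteq> 0" "emeasure lborel (cball p (7 * r)) \<noteq> top"
        using cball_emeasure[of "7 * r" p] r by auto
      then show ?thesis
        using nn_integral_unit_ball_affine[of newton "7 * r" p] r by (simp add: ennreal_divide_mult_cancel)
    qed
    also have "\<dots> \<le> newton p * emeasure lborel (cball p (7 * r))"
      using r by (intro mult_right_mono newton_mean_le d) auto
    finally have "(\<integral>\<^sup>+u. newton (x + r *\<^sub>R u) \<partial>unit_ball_dist) \<le> K"
      using nn_integral_unit_ball_affine[of newton r x] r by (simp add: K_def ce[of x] divide_right_mono_ennreal)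
    then show ?thesis by (simp add: le_max_iff_disj)
  qed
  have "max K (newton p) < top" using Kfin newton_finite[OF p0] by simp
  then obtain C where "C \<ge> 0" "max K (newton p) = ennreal C" by (cases "max K (newton p)") auto
  then show ?thesis using * by auto
qed

section \<open>The walk on balls\<close>

abbreviation paths :: "(nat \<Rightarrow> 'a::euclidean_space) measure" where
  "paths \<equiv> (\<Pi>\<^sub>M i\<in>UNIV. unit_ball_dist)"

interpretation paths: sequence_space unit_ball_dist
  by unfold_locales

lemma path_component_measurable: "(\<lambda>\<omega>. \<omega> i) \<in> paths \<rightarrow>\<^sub>M borel"
proof -
  have "(\<lambda>\<omega>. \<omega> i) \<in> paths \<rightarrow>\<^sub>M unit_ball_dist"
    by (rule measurable_component_singleton) simp
  then show ?thesis by (simp cong: measurable_cong_sets)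
qed

lemma path_shift_measurable: "(\<lambda>\<omega> n. \<omega> (Suc n)) \<in> paths \<rightarrow>\<^sub>M paths"
  by (rule measurable_PiM_single') (auto simp: space_PiM)

text \<open>
  The first jump is split off; this is the Markov property of the walk.
\<close>

lemma nn_integral_paths_iterate:
  assumes [measurable]: "F \<in> borel_measurable paths"
  shows "(\<integral>\<^sup>+\<omega>. F \<omega> \<partial>paths) = (\<integral>\<^sup>+u. (\<integral>\<^sup>+\<omega>. F (case_nat u \<omega>) \<partial>paths) \<partial>unit_ball_dist)"
proof -
  have "(\<integral>\<^sup>+\<omega>. F \<omega> \<partial>paths) = (\<integral>\<^sup>+\<omega>. F \<omega> \<partial>distr (unit_ball_dist \<Otimes>\<^sub>M paths) paths (\<lambda>(s, \<omega>). case_nat s \<omega>))"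
    by (subst paths.PiM_iter) simp
  also have "\<dots> = (\<integral>\<^sup>+z. F (case z of (s, \<omega>) \<Rightarrow> case_nat s \<omega>) \<partial>(unit_ball_dist \<Otimes>\<^sub>M paths))"
    by (subst nn_integral_distr) auto
  also have "\<dots> = (\<integral>\<^sup>+u. (\<integral>\<^sup>+\<omega>. F (case_nat u \<omega>) \<partial>paths) \<partial>unit_ball_dist)"
    by (subst paths.nn_integral_fst[symmetric]) auto
  finally show ?thesis .
qed

lemma AE_paths_bounded: "AE \<omega> in paths. \<forall>i. norm (\<omega> i) \<le> 1"
  unfolding AE_all_countable
  by (intro allI AE_PiM_component AE_unit_ball_dist prob_space_unit_ball_dist) auto

lemma AE_summable_of_finite_integral_sum:
  assumes [measurable]: "\<And>i. f i \<in> borel_measurable M" and fin: "(\<Sum>i. \<integral>\<^sup>+z. ennreal (f i z) \<partial>M) < top"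
    and nn: "\<And>i z. f i z \<ge> 0"
  shows "AE z in M. summable (\<lambda>i. f i z)"
proof -
  have "(\<integral>\<^sup>+z. (\<Sum>i. ennreal (f i z)) \<partial>M) < top" using fin by (simp add: nn_integral_suminf)
  then have "AE z in M. (\<Sum>i. ennreal (f i z)) \<noteq> top"
    by (intro nn_integral_noteq_infinite[unfolded infinity_ennreal_def]) auto
  then show ?thesis by eventually_elim (rule summable_suminf_not_top[OF nn])
qed

locale bounded_open_set =
  fixes \<Omega> :: "'a::euclidean_space set"
  assumes open_\<Omega>: "open \<Omega>" and bounded_\<Omega>: "bounded \<Omega>" and dim: "DIM('a) \<ge> 3"
begin

text \<open>
  Half the distance to the complement: the closed ball of this radius stays inside \<open>\<Omega>\<close>, and the
  radius vanishes exactly outside \<open>\<Omega>\<close>, where the walk therefore stands still.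
\<close>

definition rho :: "'a \<Rightarrow> real" where "rho x = infdist x (- \<Omega>) / 2"

lemma compl_nonempty: "- \<Omega> \<noteq> {}"
  using bounded_\<Omega> not_bounded_UNIV by (metis Compl_empty_eq double_complement)

lemma continuous_on_rho [continuous_intros]: "continuous_on A f \<Longrightarrow> continuous_on A (\<lambda>x. rho (f x))"
  unfolding rho_def by (intro continuous_intros) auto

lemma rho_measurable [measurable]: "rho \<in> borel_measurable borel"
  by (intro borel_measurable_continuous_onI continuous_intros)

lemma rho_nonneg [simp]: "rho x \<ge> 0"
  by (simp add: rho_def infdist_nonneg)

lemma rho_less_dist: "x \<in> \<Omega> \<Longrightarrow> z \<notin> \<Omega> \<Longrightarrow> rho x < dist x z"
proof -
  assume x: "x \<in> \<Omega>" and z: "z \<notin> \<Omega>"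
  have "infdist x (- \<Omega>) \<le> dist x z" using z by (intro infdist_le) auto
  moreover have "dist x z > 0" using x z by auto
  ultimately show "rho x < dist x z" unfolding rho_def by linarith
qed

lemma rho_eq_0_iff: "rho x = 0 \<longleftrightarrow> x \<notin> \<Omega>"
  using in_closed_iff_infdist_zero[of "- \<Omega>" x] open_\<Omega> compl_nonempty by (auto simp: rho_def)

lemma rho_pos: "x \<in> \<Omega> \<Longrightarrow> rho x > 0"
  using rho_eq_0_iff[of x] rho_nonneg[of x] by linarith

lemma cball_rho_subset: "x \<in> \<Omega> \<Longrightarrow> cball x (rho x) \<subseteq> \<Omega>"
  using rho_less_dist by force

lemma step_in: "x \<in> \<Omega> \<Longrightarrow> norm u \<le> 1 \<Longrightarrow> x + rho x *\<^sub>R u \<in> \<Omega>"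
  using cball_rho_subset[of x] rho_nonneg[of x] by (auto simp: subset_iff dist_norm mult_left_le)

primrec walk :: "nat \<Rightarrow> 'a \<Rightarrow> (nat \<Rightarrow> 'a) \<Rightarrow> 'a" where
  "walk 0 x \<omega> = x"
| "walk (Suc k) x \<omega> = walk k (x + rho x *\<^sub>R \<omega> 0) (\<lambda>n. \<omega> (Suc n))"

lemma walk_measurable2: "(\<lambda>(x, \<omega>). walk k x \<omega>) \<in> borel \<Otimes>\<^sub>M paths \<rightarrow>\<^sub>M borel"
proof (induction k)
  case 0
  then show ?case by simp
next
  case (Suc k)
  have m: "(\<lambda>p :: 'a \<times> (nat \<Rightarrow> 'a). snd p 0) \<in> borel \<Otimes>\<^sub>M paths \<rightarrow>\<^sub>M borel"
    "(\<lambda>p :: 'a \<times> (nat \<Rightarrow> 'a). \<lambda>n. snd p (Suc n)) \<in> borel \<Otimes>\<^sub>M paths \<rightarrow>\<^sub>M paths"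
    by (rule measurable_compose[OF measurable_snd path_component_measurable],
        rule measurable_compose[OF measurable_snd path_shift_measurable])
  have "(\<lambda>p :: 'a \<times> (nat \<Rightarrow> 'a). (fst p + rho (fst p) *\<^sub>R snd p 0, \<lambda>n. snd p (Suc n))) \<in> borel \<Otimes>\<^sub>M paths \<rightarrow>\<^sub>M borel \<Otimes>\<^sub>M paths"
    by (intro measurable_Pair m borel_measurable_add borel_measurable_scaleR measurable_compose[OF measurable_fst rho_measurable] measurable_fst)
  from measurable_compose[OF this Suc] show ?case by (simp add: case_prod_beta)
qed

lemma walk_measurable [measurable (raw)]:
  "f \<in> M \<rightarrow>\<^sub>M borel \<Longrightarrow> g \<in> M \<rightarrow>\<^sub>M paths \<Longrightarrow> (\<lambda>z. walk k (f z) (g z)) \<in> M \<rightarrow>\<^sub>M borel"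
proof -
  assume f: "f \<in> M \<rightarrow>\<^sub>M borel" and g: "g \<in> M \<rightarrow>\<^sub>M paths"
  show "(\<lambda>z. walk k (f z) (g z)) \<in> M \<rightarrow>\<^sub>M borel"
    using measurable_compose[OF measurable_Pair[OF f g] walk_measurable2] by simp
qed

lemma walk_in: "x \<in> \<Omega> \<Longrightarrow> (\<And>i. norm (\<omega> i) \<le> 1) \<Longrightarrow> walk k x \<omega> \<in> \<Omega>"
proof (induction k arbitrary: x \<omega>)
  case (Suc k)
  show ?case by simp (intro Suc.IH step_in Suc.prems)
qed simp

lemma AE_walk_in: "x \<in> \<Omega> \<Longrightarrow> AE \<omega> in paths. \<forall>k. walk k x \<omega> \<in> \<Omega>"
  using AE_paths_bounded by eventually_elim (auto intro: walk_in)

lemma walk_outside: "x \<notin> \<Omega> \<Longrightarrow> walk k x \<omega> = x"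
  by (induction k arbitrary: \<omega>) (auto simp: rho_eq_0_iff[THEN iffD2])

definition walk_mean :: "nat \<Rightarrow> ('a \<Rightarrow> ennreal) \<Rightarrow> 'a \<Rightarrow> ennreal" where
  "walk_mean k f x = (\<integral>\<^sup>+\<omega>. f (walk k x \<omega>) \<partial>paths)"

lemma walk_mean_0 [simp]: "walk_mean 0 f x = f x"
  by (simp add: walk_mean_def paths.emeasure_space_1)

lemma walk_mean_measurable [measurable]:
  assumes [measurable]: "f \<in> borel_measurable borel"
  shows "walk_mean k f \<in> borel_measurable borel"
  unfolding walk_mean_def by measurable

lemma walk_mean_Suc:
  assumes [measurable]: "f \<in> borel_measurable borel"
  shows "walk_mean (Suc k) f x = (\<integral>\<^sup>+u. walk_mean k f (x + rho x *\<^sub>R u) \<partial>unit_ball_dist)"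
proof -
  have "(\<lambda>\<omega>. f (walk (Suc k) x \<omega>)) \<in> borel_measurable paths" by measurable
  from nn_integral_paths_iterate[OF this] show ?thesis by (simp add: walk_mean_def)
qed

text \<open>
  Here the last step is split off instead of the first one.
\<close>

lemma walk_mean_Suc':
  assumes [measurable]: "f \<in> borel_measurable borel"
  shows "walk_mean (Suc k) f x = walk_mean k (\<lambda>y. \<integral>\<^sup>+u. f (y + rho y *\<^sub>R u) \<partial>unit_ball_dist) x"
proof (induction k arbitrary: x)
  case 0
  show ?case by (subst walk_mean_Suc) auto
next
  case (Suc k)
  show ?case by (subst walk_mean_Suc, simp, subst Suc, subst walk_mean_Suc) auto
qed

lemma walk_mean_mono: "(\<And>y. f y \<le> g y) \<Longrightarrow> walk_mean k f x \<le> walk_mean k g x"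
  unfolding walk_mean_def by (intro nn_integral_mono) auto

lemma walk_mean_cong_in: "x \<in> \<Omega> \<Longrightarrow> (\<And>y. y \<in> \<Omega> \<Longrightarrow> f y = g y) \<Longrightarrow> walk_mean k f x = walk_mean k g x"
  unfolding walk_mean_def using AE_walk_in[of x] by (intro nn_integral_cong_AE) (auto elim!: eventually_mono)

definition ball_second_moment :: ennreal where
  "ball_second_moment = (\<integral>\<^sup>+u. ennreal ((norm (u::'a))\<^sup>2) \<partial>unit_ball_dist)"

lemma ball_second_moment_pos: "ball_second_moment > 0"
proof (rule ccontr)
  assume "\<not> ball_second_moment > 0"
  then have "AE u in unit_ball_dist. ennreal ((norm (u::'a))\<^sup>2) = 0"
    unfolding ball_second_moment_def by (subst (asm) zero_less_iff_neq_zero) (auto simp: nn_integral_0_iff_AE)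
  then have "AE u in unit_ball_dist. u = (0::'a)" by eventually_elim (simp add: ennreal_eq_0_iff)
  then have "emeasure unit_ball_dist {0::'a} = 1"
    by (intro unit_ball_dist.emeasure_eq_1_AE) auto
  moreover have "emeasure unit_ball_dist {0::'a} = 0"
    unfolding unit_ball_dist_def by (subst emeasure_uniform_measure) auto
  ultimately show False by simp
qed

text \<open>
  The cross term cancels by symmetry of the uniform distribution. The parallelogram law expresses
  this without signed integrals.
\<close>

lemma step_second_moment:
  fixes x a :: 'a
  shows
  "(\<integral>\<^sup>+u. ennreal ((norm (x + r *\<^sub>R u - a))\<^sup>2) \<partial>unit_ball_dist) = ennreal ((norm (x - a))\<^sup>2) + ennreal (r\<^sup>2) * ball_second_moment"
    (is "?L = ?R")
proof -
  have sym: "(\<integral>\<^sup>+u. ennreal ((norm (x - r *\<^sub>R u - a))\<^sup>2) \<partial>unit_ball_dist) = ?L"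
    using nn_integral_unit_ball_uminus[of "\<lambda>u. ennreal ((norm (x + r *\<^sub>R u - a))\<^sup>2)"] by simp
  have par: "(norm (x + r *\<^sub>R u - a))\<^sup>2 + (norm (x - r *\<^sub>R u - a))\<^sup>2 = 2 * ((norm (x - a))\<^sup>2 + r\<^sup>2 * (norm u)\<^sup>2)" for u
    unfolding power2_norm_eq_inner by (simp add: inner_simps inner_commute power2_eq_square algebra_simps)
  have "?L + ?L = (\<integral>\<^sup>+u. ennreal ((norm (x + r *\<^sub>R u - a))\<^sup>2) + ennreal ((norm (x - r *\<^sub>R u - a))\<^sup>2) \<partial>unit_ball_dist)"
    by (subst nn_integral_add) (auto simp: sym)
  also have "\<dots> = (\<integral>\<^sup>+u. 2 * (ennreal ((norm (x - a))\<^sup>2) + ennreal (r\<^sup>2) * ennreal ((norm (u::'a))\<^sup>2)) \<partial>unit_ball_dist)"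
  proof (intro nn_integral_cong)
    fix u :: 'a
    have "ennreal ((norm (x + r *\<^sub>R u - a))\<^sup>2) + ennreal ((norm (x - r *\<^sub>R u - a))\<^sup>2)
        = ennreal (2 * ((norm (x - a))\<^sup>2 + r\<^sup>2 * (norm u)\<^sup>2))"
      unfolding par[symmetric] by (rule ennreal_plus[symmetric]) auto
    also have "\<dots> = 2 * ennreal ((norm (x - a))\<^sup>2 + r\<^sup>2 * (norm u)\<^sup>2)"
      by (subst ennreal_mult) auto
    also have "ennreal ((norm (x - a))\<^sup>2 + r\<^sup>2 * (norm u)\<^sup>2) = ennreal ((norm (x - a))\<^sup>2) + ennreal (r\<^sup>2) * ennreal ((norm u)\<^sup>2)"
      by (subst ennreal_plus; (subst ennreal_mult)?) auto
    finally show "ennreal ((norm (x + r *\<^sub>R u - a))\<^sup>2) + ennreal ((norm (x - r *\<^sub>R u - a))\<^sup>2)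
        = 2 * (ennreal ((norm (x - a))\<^sup>2) + ennreal (r\<^sup>2) * ennreal ((norm u)\<^sup>2))" .
  qed
  also have "\<dots> = 2 * ?R"
    by (simp add: nn_integral_cmult nn_integral_add ball_second_moment_def unit_ball_dist.emeasure_space_1 flip: space_unit_ball_dist)
  finally have "2 * ?L = 2 * ?R" by (simp only: mult_2)
  then show ?thesis unfolding ennreal_mult_cancel_left by simp
qed

text \<open>
  The second moment of the displacement after \<open>k\<close> steps, by recursion on the first step.
\<close>

primrec walk_var :: "nat \<Rightarrow> 'a \<Rightarrow> ennreal" where
  "walk_var 0 x = 0"
| "walk_var (Suc k) x = ennreal ((rho x)\<^sup>2) * ball_second_moment + (\<integral>\<^sup>+u. walk_var k (x + rho x *\<^sub>R u) \<partial>unit_ball_dist)"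

lemma walk_var_measurable [measurable]: "walk_var k \<in> borel_measurable borel"
  by (induction k) auto

text \<open>
  Expanding both sides in \<open>a\<close> shows that the identity for all \<open>a\<close> contains the martingale
  property, in a form that can be proved by induction on nonnegative integrals alone.
\<close>

lemma walk_second_moment: "walk_mean k (\<lambda>y. ennreal ((norm (y - a))\<^sup>2)) x = ennreal ((norm (x - a))\<^sup>2) + walk_var k x"
proof (induction k arbitrary: x)
  case (Suc k)
  show ?case
    by (subst walk_mean_Suc) (auto simp: Suc nn_integral_add step_second_moment add.assoc)
qed simp

lemma walk_var_add: "walk_var (k + j) x = walk_var k x + walk_mean k (walk_var j) x"
proof (induction k arbitrary: x)
  case (Suc k)
  show ?case
    by (subst walk_mean_Suc) (auto simp: Suc nn_integral_add add.assoc)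
qed simp

text \<open>
  Together with \<open>walk_var_add\<close>: the mean square of an increment is the increment of the bounded
  increasing sequence \<open>walk_var\<close>, so the walk is a Cauchy sequence in mean square.
\<close>

lemma walk_increment_moment:
  "(\<integral>\<^sup>+\<omega>. ennreal ((norm (walk (k + j) x \<omega> - walk k x \<omega>))\<^sup>2) \<partial>paths) = walk_mean k (walk_var j) x"
proof (induction k arbitrary: x)
  case 0
  show ?case unfolding walk_mean_0 using walk_second_moment[of j x x] by (simp add: walk_mean_def[of j])
next
  case (Suc k)
  have "(\<lambda>\<omega>. ennreal ((norm (walk (Suc k + j) x \<omega> - walk (Suc k) x \<omega>))\<^sup>2)) \<in> borel_measurable paths" by measurable
  from nn_integral_paths_iterate[OF this] show ?case by (simp add: Suc walk_mean_Suc)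
qed

lemma walk_var_bounded: "x \<in> \<Omega> \<Longrightarrow> \<exists>C\<ge>0. \<forall>k. walk_var k x \<le> ennreal C"
proof -
  assume x: "x \<in> \<Omega>"
  from bounded_\<Omega> obtain D where D: "\<And>y. y \<in> \<Omega> \<Longrightarrow> norm (y - x) \<le> D"
    using bounded_any_center[of \<Omega> x] by (auto simp: dist_norm norm_minus_commute)
  have "walk_var k x \<le> ennreal (D\<^sup>2)" for k
  proof -
    have "walk_var k x = walk_mean k (\<lambda>y. ennreal ((norm (y - x))\<^sup>2)) x"
      by (simp add: walk_second_moment)
    also have "\<dots> \<le> (\<integral>\<^sup>+\<omega>. ennreal (D\<^sup>2) \<partial>(paths :: (nat \<Rightarrow> 'a) measure))"
      unfolding walk_mean_def using AE_walk_in[OF x]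
      by (intro nn_integral_mono_AE) (auto elim!: eventually_mono intro!: ennreal_leI power_mono D)
    also have "\<dots> = ennreal (D\<^sup>2)" by (simp add: paths.emeasure_space_1)
    finally show ?thesis .
  qed
  then show ?thesis by (intro exI[of _ "D\<^sup>2"]) auto
qed

text \<open>
  Along a suitable subsequence the mean square increments decay geometrically, uniformly in their
  length.
\<close>

lemma walk_fast_subsequence:
  assumes x: "x \<in> \<Omega>"
  shows "\<exists>r. strict_mono r \<and> (\<forall>i j. walk_mean (r i) (walk_var j) x \<le> ennreal ((1/4) ^ i))"
proof -
  from walk_var_bounded[OF x] obtain C where C: "C \<ge> 0" "\<And>k. walk_var k x \<le> ennreal C" by blast
  define \<beta> where "\<beta> k = enn2real (walk_var k x)" for k
  have \<beta>: "walk_var k x = ennreal (\<beta> k)" for k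
    using le_less_trans[OF C(2)[of k] ennreal_less_top] by (simp add: \<beta>_def)
  have \<beta>0: "\<beta> k \<ge> 0" for k by (simp add: \<beta>_def)
  have \<beta>C: "\<beta> k \<le> C" for k using C(2)[of k] C(1) by (simp add: \<beta>)
  have inc: "incseq \<beta>"
  proof (rule incseq_SucI)
    fix k
    have "ennreal (\<beta> k) \<le> ennreal (\<beta> (Suc k))" using walk_var_add[of k 1 x] by (simp flip: \<beta>)
    then show "\<beta> k \<le> \<beta> (Suc k)" using \<beta>0 by simp
  qed
  obtain L where L: "\<beta> \<longlonglongrightarrow> L" "\<And>i. \<beta> i \<le> L"
    using incseq_convergent[OF inc, of C] \<beta>C by blast
  have "\<exists>N. \<forall>k\<ge>N. L - \<beta> k < (1/4) ^ i" for i :: nat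
  proof -
    have "\<forall>\<^sub>F k in sequentially. L - (1/4) ^ i < \<beta> k" by (rule order_tendstoD(1)[OF L(1)]) simp
    then show ?thesis by (auto simp: eventually_sequentially algebra_simps)
  qed
  then obtain N where N: "\<And>i k. k \<ge> N i \<Longrightarrow> L - \<beta> k < (1/4) ^ (i::nat)" by metis
  define r where "r i = i + (\<Sum>j\<le>i. N j)" for i :: nat
  have "strict_mono r" by (rule strict_monoI_Suc) (simp add: r_def)
  moreover have "walk_mean (r i) (walk_var j) x \<le> ennreal ((1/4) ^ i)" for i j
  proof -
    have "N i \<le> (\<Sum>j\<le>i. N j)" by (rule member_le_sum) auto
    then have "r i \<ge> N i" by (simp add: r_def)
    then have "L - \<beta> (r i) < (1/4) ^ i" by (rule N)
    then have "\<beta> (r i + j) \<le> \<beta> (r i) + (1/4) ^ i" using L(2)[of "r i + j"] by simp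
    then have "ennreal (\<beta> (r i + j)) \<le> ennreal (\<beta> (r i)) + ennreal ((1/4) ^ i)"
      using \<beta>0 by (simp flip: ennreal_plus)
    then have "ennreal (\<beta> (r i)) + walk_mean (r i) (walk_var j) x \<le> ennreal (\<beta> (r i)) + ennreal ((1/4) ^ i)"
      using walk_var_add[of "r i" j x] by (simp add: \<beta>)
    then show ?thesis by (simp add: ennreal_add_left_cancel_le)
  qed
  ultimately show ?thesis by blast
qed

text \<open>
  Geometric decay makes the increments along the subsequence summable almost surely. The next jump
  of the walk has mean square proportional to the square of the current radius, so the radii tend
  to 0 and the limit lies on the boundary.
\<close>

lemma walk_limit:
  assumes x: "x \<in> \<Omega>"
  shows "\<exists>Y r. strict_mono r \<and> Y \<in> borel_measurable paths \<and> (\<forall>\<omega>. Y \<omega> \<in> frontier \<Omega>) \<and>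
           (AE \<omega> in paths. (\<lambda>i. walk (r i) x \<omega>) \<longlonglongrightarrow> Y \<omega>)"
proof -
  from walk_fast_subsequence[OF x] obtain r where r: "strict_mono r"
    "\<And>i j. walk_mean (r i) (walk_var j) x \<le> ennreal ((1/4) ^ i)" by blast
  define Z where "Z i \<omega> = walk (r i) x \<omega>" for i \<omega>
  have [measurable]: "Z i \<in> borel_measurable paths" for i unfolding Z_def by measurable
  have geo: "(\<Sum>i. ennreal (c * (1/2) ^ i)) < top" if "c \<ge> 0" for c
    by (subst suminf_ennreal2) (use that in \<open>auto intro!: summable_mult summable_geometric\<close>)
  have inc: "(\<integral>\<^sup>+\<omega>. ennreal (norm (Z (Suc i) \<omega> - Z i \<omega>)) \<partial>paths) \<le> ennreal (2 * (1/2) ^ i)" for i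
  proof -
    have "r i \<le> r (Suc i)" using r(1) by (simp add: strict_mono_less_eq)
    then have e: "r i + (r (Suc i) - r i) = r (Suc i)" by simp
    \<comment> \<open>This bounds first moments by second moments without the Cauchy-Schwarz inequality:
      expand \<open>0 \<le> 2\<^sup>-\<^sup>i (1 - 2\<^sup>i |v|)\<^sup>2\<close>.\<close>
    have "ennreal (norm v) \<le> ennreal ((1/2) ^ i) + ennreal (2 ^ i) * ennreal ((norm v)\<^sup>2)" for v :: 'a
    proof -
      have "0 \<le> (1/2) ^ i * (1 - 2 ^ i * norm v)\<^sup>2" by simp
      also have "\<dots> = (1/2) ^ i - 2 * norm v + 2 ^ i * (norm v)\<^sup>2"
        by (simp add: power2_eq_square algebra_simps power_divide)
      finally have "norm v \<le> (1/2) ^ i + 2 ^ i * (norm v)\<^sup>2" using norm_ge_zero[of v] by linarith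
      then have "ennreal (norm v) \<le> ennreal ((1/2) ^ i + 2 ^ i * (norm v)\<^sup>2)" by (rule ennreal_leI)
      also have "\<dots> = ennreal ((1/2) ^ i) + ennreal (2 ^ i * (norm v)\<^sup>2)" by (rule ennreal_plus) auto
      also have "ennreal (2 ^ i * (norm v)\<^sup>2) = ennreal (2 ^ i) * ennreal ((norm v)\<^sup>2)" by (rule ennreal_mult) auto
      finally show ?thesis .
    qed
    then have "(\<integral>\<^sup>+\<omega>. ennreal (norm (Z (Suc i) \<omega> - Z i \<omega>)) \<partial>paths)
      \<le> (\<integral>\<^sup>+\<omega>. ennreal ((1/2) ^ i) + ennreal (2 ^ i) * ennreal ((norm (Z (Suc i) \<omega> - Z i \<omega>))\<^sup>2) \<partial>paths)"
      by (intro nn_integral_mono)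
    also have "\<dots> = ennreal ((1/2) ^ i) + ennreal (2 ^ i) * walk_mean (r i) (walk_var (r (Suc i) - r i)) x"
      using walk_increment_moment[of "r i" "r (Suc i) - r i" x] unfolding e
      by (simp add: nn_integral_add nn_integral_cmult paths.emeasure_space_1 Z_def)
    also have "\<dots> \<le> ennreal ((1/2) ^ i) + ennreal (2 ^ i) * ennreal ((1/4) ^ i)"
      by (intro add_mono mult_left_mono r) auto
    also have "\<dots> = ennreal ((1/2) ^ i + 2 ^ i * (1/4) ^ i)"
      by (subst ennreal_plus; (subst ennreal_mult)?) auto
    also have "2 ^ i * (1/4) ^ i = (1/2 :: real) ^ i" by (simp flip: power_mult_distrib)
    also have "(1/2) ^ i + (1/2) ^ i = 2 * (1/2 :: real) ^ i" by simp
    finally show ?thesis .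
  qed
  have "AE \<omega> in paths. summable (\<lambda>i. norm (Z (Suc i) \<omega> - Z i \<omega>))"
  proof (rule AE_summable_of_finite_integral_sum)
    have "(\<Sum>i. \<integral>\<^sup>+\<omega>. ennreal (norm (Z (Suc i) \<omega> - Z i \<omega>)) \<partial>paths) \<le> (\<Sum>i. ennreal (2 * (1/2) ^ i))"
      by (intro suminf_le inc) auto
    then show "(\<Sum>i. \<integral>\<^sup>+\<omega>. ennreal (norm (Z (Suc i) \<omega> - Z i \<omega>)) \<partial>paths) < top"
      using geo[of 2] by (rule le_less_trans) simp
  qed auto
  then have conv: "AE \<omega> in paths. convergent (\<lambda>i. Z i \<omega>)"
  proof eventually_elim
    case (elim \<omega>)
    have "summable (\<lambda>i. Z (Suc i) \<omega> - Z i \<omega>)" using elim by (rule summable_norm_cancel)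
    then have "convergent (\<lambda>n. \<Sum>i<n. Z (Suc i) \<omega> - Z i \<omega>)" by (simp add: summable_iff_convergent)
    moreover have "(\<lambda>n. \<Sum>i<n. Z (Suc i) \<omega> - Z i \<omega>) = (\<lambda>n. Z n \<omega> - Z 0 \<omega>)"
      by (intro ext sum_lessThan_telescope)
    ultimately have "convergent (\<lambda>n. Z n \<omega> - Z 0 \<omega>)" by simp
    then have "convergent (\<lambda>n. (Z n \<omega> - Z 0 \<omega>) + Z 0 \<omega>)" by (intro convergent_add convergent_const)
    then show ?case by simp
  qed
  have "AE \<omega> in paths. summable (\<lambda>i. (rho (Z i \<omega>))\<^sup>2)"
  proof (rule AE_summable_of_finite_integral_sum)
    have step: "(\<integral>\<^sup>+\<omega>. ennreal ((rho (Z i \<omega>))\<^sup>2) \<partial>paths) * ball_second_moment \<le> ennreal (1 * (1/2) ^ i)" for i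
    proof -
      have "(\<integral>\<^sup>+\<omega>. ennreal ((rho (Z i \<omega>))\<^sup>2) \<partial>paths) * ball_second_moment = walk_mean (r i) (walk_var 1) x"
        by (simp add: walk_mean_def Z_def nn_integral_multc)
      also have "\<dots> \<le> ennreal ((1/4) ^ i)" by (rule r)
      also have "\<dots> \<le> ennreal (1 * (1/2) ^ i)" by (auto intro!: ennreal_leI power_mono)
      finally show ?thesis .
    qed
    have "(\<Sum>i. \<integral>\<^sup>+\<omega>. ennreal ((rho (Z i \<omega>))\<^sup>2) \<partial>paths) * ball_second_moment = (\<Sum>i. (\<integral>\<^sup>+\<omega>. ennreal ((rho (Z i \<omega>))\<^sup>2) \<partial>paths) * ball_second_moment)"
      by (rule ennreal_suminf_multc[symmetric])
    also have "\<dots> \<le> (\<Sum>i. ennreal (1 * (1/2) ^ i))" by (intro suminf_le step) auto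
    also have "\<dots> < top" by (rule geo) simp
    finally show "(\<Sum>i. \<integral>\<^sup>+\<omega>. ennreal ((rho (Z i \<omega>))\<^sup>2) \<partial>paths) < top"
      using ball_second_moment_pos by (auto simp: ennreal_mult_less_top)
  qed auto
  then have rho0: "AE \<omega> in paths. (\<lambda>i. rho (Z i \<omega>)) \<longlonglongrightarrow> 0"
  proof eventually_elim
    case (elim \<omega>)
    then have "(\<lambda>i. (rho (Z i \<omega>))\<^sup>2) \<longlonglongrightarrow> 0" by (rule summable_LIMSEQ_zero)
    then have "(\<lambda>i. sqrt ((rho (Z i \<omega>))\<^sup>2)) \<longlonglongrightarrow> sqrt 0" by (rule tendsto_real_sqrt)
    then show ?case by simp
  qed
  have ae: "AE \<omega> in paths. lim (\<lambda>i. Z i \<omega>) \<in> frontier \<Omega> \<and> (\<lambda>i. Z i \<omega>) \<longlonglongrightarrow> lim (\<lambda>i. Z i \<omega>)"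
    using conv rho0 AE_walk_in[OF x]
  proof eventually_elim
    case (elim \<omega>)
    let ?l = "lim (\<lambda>i. Z i \<omega>)"
    have l: "(\<lambda>i. Z i \<omega>) \<longlonglongrightarrow> ?l" using elim(1) by (simp add: convergent_LIMSEQ_iff)
    have "(\<lambda>i. rho (Z i \<omega>)) \<longlonglongrightarrow> rho ?l"
      using continuous_on_rho[OF continuous_on_id, of UNIV] l
      by (auto intro: continuous_on_tendsto_compose)
    then have "rho ?l = 0" using elim(2) LIMSEQ_unique by blast
    then have "?l \<notin> \<Omega>" by (simp add: rho_eq_0_iff)
    moreover have "?l \<in> closure \<Omega>"
      unfolding closure_sequential using l elim(3) by (auto simp: Z_def intro!: exI[of _ "\<lambda>i. Z i \<omega>"])
    ultimately show ?case using l open_\<Omega> by (simp add: frontier_def interior_open)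
  qed
  have "\<Omega> \<noteq> UNIV" using compl_nonempty by auto
  then have "frontier \<Omega> \<noteq> {}" using x frontier_eq_empty by blast
  then obtain \<xi> where \<xi>: "\<xi> \<in> frontier \<Omega>" by blast
  have [measurable]: "frontier \<Omega> \<in> sets borel" by (intro borel_closed) simp
  \<comment> \<open>On the null set where the limit fails to exist or to lie on the boundary, any
    boundary point will do.\<close>
  define Y where "Y \<omega> = (if lim (\<lambda>i. Z i \<omega>) \<in> frontier \<Omega> then lim (\<lambda>i. Z i \<omega>) else \<xi>)" for \<omega>
  have [measurable]: "(\<lambda>\<omega>. lim (\<lambda>i. Z i \<omega>)) \<in> borel_measurable paths"
    by (rule borel_measurable_lim_metric) measurable
  have "Y \<in> borel_measurable paths" unfolding Y_def by measurable
  moreover have "\<forall>\<omega>. Y \<omega> \<in> frontier \<Omega>" using \<xi> by (simp add: Y_def)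
  moreover have "AE \<omega> in paths. (\<lambda>i. walk (r i) x \<omega>) \<longlonglongrightarrow> Y \<omega>"
    using ae by eventually_elim (simp add: Y_def Z_def)
  ultimately show ?thesis using r(1) by blast
qed

end

section \<open>Finite measures tested on continuous functions\<close>

definition closed_cutoff :: "'a::metric_space set \<Rightarrow> nat \<Rightarrow> 'a \<Rightarrow> real" where
  "closed_cutoff C n z = max 0 (1 - real n * infdist z C)"

lemma closed_cutoff_bounds: "0 \<le> closed_cutoff C n z" "closed_cutoff C n z \<le> 1"
  by (auto simp: closed_cutoff_def infdist_nonneg)

lemma closed_cutoff_eq_1: "z \<in> C \<Longrightarrow> closed_cutoff C n z = 1"
  by (simp add: closed_cutoff_def)

lemma continuous_on_closed_cutoff: "C \<noteq> {} \<Longrightarrow> continuous_on A (closed_cutoff C n)"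
  unfolding closed_cutoff_def by (intro continuous_intros)

lemma continuous_on_imp_measurable_restrict_space:
  fixes f :: "'a::euclidean_space \<Rightarrow> real"
  assumes "sets M = sets (restrict_space borel K)" "continuous_on K f"
  shows "f \<in> borel_measurable M"
  using borel_measurable_continuous_on_restrict[OF assms(2)] by (simp add: measurable_cong_sets[OF assms(1) refl])

text \<open>
  Dominated convergence: the cutoffs decrease to the indicator of the closed set. It identifies a
  measure from its integrals of continuous functions, and it brings \<open>\<omega>\<^sup>x(aB)\<close> within reach of
  Perron solutions.
\<close>

lemma closed_cutoff_integral_tendsto:
  fixes M :: "'a::euclidean_space measure"
  assumes M: "finite_measure M" "sets M = sets (restrict_space borel K)" and K: "closed K"
    and C: "closed C" "C \<noteq> {}"
  shows "(\<lambda>n. LINT z|M. closed_cutoff C n z) \<longlonglongrightarrow> measure M (C \<inter> K)"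
proof -
  interpret finite_measure M by (rule M(1))
  have sp: "space M = K" using sets_eq_imp_space_eq[OF M(2)] by (simp add: space_restrict_space)
  have CK: "C \<inter> K \<in> sets M" unfolding M(2) using C(1) K by (auto simp: sets_restrict_space)
  have "(\<lambda>n. LINT z|M. closed_cutoff C n z) \<longlonglongrightarrow> (LINT z|M. indicator (C \<inter> K) z)"
  proof (rule integral_dominated_convergence[where w="\<lambda>_. 1"])
    show "closed_cutoff C n \<in> borel_measurable M" for n
      by (rule continuous_on_imp_measurable_restrict_space[OF M(2)]) (rule continuous_on_closed_cutoff[OF C(2)])
    show "AE z in M. (\<lambda>n. closed_cutoff C n z) \<longlonglongrightarrow> indicator (C \<inter> K) z"
    proof (rule AE_I2)
      fix z assume z: "z \<in> space M"
      show "(\<lambda>n. closed_cutoff C n z) \<longlonglongrightarrow> indicator (C \<inter> K) z"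
      proof (cases "z \<in> C")
        case True
        then show ?thesis using z sp by (simp add: closed_cutoff_eq_1)
      next
        case False
        then have d: "infdist z C > 0" using C in_closed_iff_infdist_zero[of C z] infdist_nonneg[of z C] by auto
        obtain N where N: "real N * infdist z C > 1" using reals_Archimedean3[OF d] by blast
        have "closed_cutoff C n z = 0" if "n \<ge> N" for n
        proof -
          have "real N * infdist z C \<le> real n * infdist z C" using that d by (intro mult_right_mono) auto
          then show ?thesis using N by (simp add: closed_cutoff_def)
        qed
        then have "\<forall>\<^sub>F n in sequentially. closed_cutoff C n z = 0" by (auto simp: eventually_sequentially)
        then show ?thesis using False by (simp add: tendsto_eventually)
      qed
    qed
    show "AE z in M. norm (closed_cutoff C n z) \<le> 1" for n
      using closed_cutoff_bounds[of C n] by (intro AE_I2) (auto simp: abs_le_iff intro: order_trans[of _ 0])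
  qed (use CK in auto)
  then show ?thesis using CK by simp
qed

text \<open>
  The cutoffs show that the measures agree on closed sets, which generate the Borel sets and are
  stable under intersection.
\<close>

lemma finite_measure_eqI_continuous:
  fixes M N :: "'a::euclidean_space measure"
  assumes M: "finite_measure M" "sets M = sets (restrict_space borel K)"
    and N: "finite_measure N" "sets N = sets (restrict_space borel K)" and K: "closed K"
    and eq: "\<And>f. continuous_on K f \<Longrightarrow> (LINT z|M. f z :: real) = (LINT z|N. f z)"
  shows "M = N"
proof -
  have sp: "space M = K" "space N = K" using sets_eq_imp_space_eq[OF M(2)] sets_eq_imp_space_eq[OF N(2)]
    by (simp_all add: space_restrict_space)
  have id: "(\<lambda>z. z) \<in> M \<rightarrow>\<^sub>M borel" "(\<lambda>z. z) \<in> N \<rightarrow>\<^sub>M borel"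
    by (simp_all add: measurable_cong_sets[OF M(2) refl] measurable_cong_sets[OF N(2) refl] measurable_restrict_space1)
  have em: "emeasure M (C \<inter> K) = emeasure N (C \<inter> K)" if C: "closed C" for C
  proof (cases "C = {}")
    case False
    have "measure M (C \<inter> K) = measure N (C \<inter> K)"
    proof (rule LIMSEQ_unique)
      show "(\<lambda>n. LINT z|M. closed_cutoff C n z) \<longlonglongrightarrow> measure M (C \<inter> K)"
        by (rule closed_cutoff_integral_tendsto[OF M K C False])
      show "(\<lambda>n. LINT z|M. closed_cutoff C n z) \<longlonglongrightarrow> measure N (C \<inter> K)"
        using closed_cutoff_integral_tendsto[OF N K C False] eq[OF continuous_on_closed_cutoff[OF False]] by simp
    qed
    then show ?thesis by (simp add: finite_measure.emeasure_eq_measure[OF M(1)] finite_measure.emeasure_eq_measure[OF N(1)])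
  qed simp
  have D: "distr M borel (\<lambda>z. z) = distr N borel (\<lambda>z. z)"
  proof (rule measure_eqI_generator_eq[where E="Collect closed" and \<Omega>=UNIV and A="\<lambda>_. UNIV"])
    show "Int_stable (Collect closed :: 'a set set)" by (auto simp: Int_stable_def)
    show "sets (distr M borel (\<lambda>z. z)) = sigma_sets UNIV (Collect closed)"
      "sets (distr N borel (\<lambda>z. z)) = sigma_sets UNIV (Collect closed)"
      by (simp_all add: borel_eq_closed)
    show "emeasure (distr M borel (\<lambda>z. z)) X = emeasure (distr N borel (\<lambda>z. z)) X" if "X \<in> Collect closed" for X
      using that em[of X] id by (simp add: emeasure_distr sp)
    show "emeasure (distr M borel (\<lambda>z. z)) UNIV \<noteq> \<infinity>" for i :: nat
      using id finite_measure.emeasure_finite[OF M(1)] by (simp add: emeasure_distr)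
  qed auto
  show ?thesis
  proof (rule measure_eqI)
    show "sets M = sets N" using M N by simp
    fix A assume A: "A \<in> sets M"
    then have A': "A \<in> sets borel" "A \<subseteq> K" unfolding M(2) using K
      by (auto simp: sets_restrict_space)
    have "emeasure (distr M borel (\<lambda>z. z)) A = emeasure (distr N borel (\<lambda>z. z)) A" by (simp add: D)
    then show "emeasure M A = emeasure N A" using A' id sp by (simp add: emeasure_distr Int_absorb2)
  qed
qed

section \<open>Superharmonic functions and upper functions\<close>

text \<open>
  A form of superharmonicity for bounded real functions that is stable under sums. Global
  measurability spares measurability on the open set in every integral.
\<close>

definition real_superharmonic :: "'a::euclidean_space set \<Rightarrow> ('a \<Rightarrow> real) \<Rightarrow> bool" where
  "real_superharmonic S h \<longleftrightarrow>
     h \<in> borel_measurable borel \<and> bounded (h ` S) \<and>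
     (\<forall>x\<in>S. \<forall>a<h x. \<forall>\<^sub>F y in at x within S. a < h y) \<and>
     (\<forall>x r. 0 < r \<longrightarrow> cball x r \<subseteq> S \<longrightarrow> (LINT u|unit_ball_dist. h (x + r *\<^sub>R u)) \<le> h x)"

lemma cball_param:
  fixes x :: "'a::euclidean_space"
  assumes "0 \<le> r" "norm u \<le> 1" shows "x + r *\<^sub>R u \<in> cball x r"
  using assms by (simp add: dist_norm mult_left_le)

lemma integrable_ball_bounded:
  fixes h :: "'a::euclidean_space \<Rightarrow> real"
  assumes [measurable]: "h \<in> borel_measurable borel" and b: "bounded (h ` S)" and "0 < r" "cball x r \<subseteq> S"
  shows "integrable unit_ball_dist (\<lambda>u. h (x + r *\<^sub>R u))"
proof -
  from b obtain C where C: "\<And>y. y \<in> S \<Longrightarrow> \<bar>h y\<bar> \<le> C" by (auto simp: bounded_iff)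
  show ?thesis
  proof (rule unit_ball_dist.integrable_const_bound[of _ C])
    show "AE u in unit_ball_dist. norm (h (x + r *\<^sub>R u)) \<le> C"
      using AE_unit_ball_dist
    proof eventually_elim
      case (elim u)
      then have "x + r *\<^sub>R u \<in> S" using cball_param[of r u x] assms by auto
      then show ?case using C by simp
    qed
  qed measurable
qed

lemma real_superharmonic_subset:
  "real_superharmonic S h \<Longrightarrow> T \<subseteq> S \<Longrightarrow> real_superharmonic T h"
  unfolding real_superharmonic_def
  by (auto intro: bounded_subset filter_leD[OF at_le])

lemma real_superharmonic_add:
  assumes f: "real_superharmonic S f" and g: "real_superharmonic S g"
  shows "real_superharmonic S (\<lambda>x. f x + g x)"
  unfolding real_superharmonic_def
proof (intro conjI ballI allI impI)
  show "(\<lambda>x. f x + g x) \<in> borel_measurable borel"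
    using f g by (auto simp: real_superharmonic_def)
  from f g obtain A B where AB: "\<And>y. y \<in> S \<Longrightarrow> \<bar>f y\<bar> \<le> A" "\<And>y. y \<in> S \<Longrightarrow> \<bar>g y\<bar> \<le> B"
    by (auto simp: real_superharmonic_def bounded_iff)
  show "bounded ((\<lambda>x. f x + g x) ` S)"
    using AB by (auto simp: bounded_iff intro!: exI[of _ "A + B"] order_trans[OF abs_triangle_ineq] add_mono)
  fix x a assume x: "x \<in> S" and a: "a < f x + g x"
  define d where "d = (f x + g x - a) / 2"
  have d: "d > 0" using a by (simp add: d_def)
  have "\<forall>\<^sub>F y in at x within S. f x - d < f y" "\<forall>\<^sub>F y in at x within S. g x - d < g y"
    using f g x d by (auto simp: real_superharmonic_def)
  then show "\<forall>\<^sub>F y in at x within S. a < f y + g y"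
    by eventually_elim (simp add: d_def field_simps)
next
  fix x r assume r: "0 < (r::real)" "cball x r \<subseteq> S"
  have "integrable unit_ball_dist (\<lambda>u. f (x + r *\<^sub>R u))" "integrable unit_ball_dist (\<lambda>u. g (x + r *\<^sub>R u))"
    using f g r by (auto simp: real_superharmonic_def intro: integrable_ball_bounded)
  then have "(LINT u|unit_ball_dist. f (x + r *\<^sub>R u) + g (x + r *\<^sub>R u))
      = (LINT u|unit_ball_dist. f (x + r *\<^sub>R u)) + (LINT u|unit_ball_dist. g (x + r *\<^sub>R u))" by simp
  also have "\<dots> \<le> f x + g x" using f g r by (intro add_mono) (auto simp: real_superharmonic_def)
  finally show "(LINT u|unit_ball_dist. f (x + r *\<^sub>R u) + g (x + r *\<^sub>R u)) \<le> f x + g x" .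
qed

lemma real_superharmonic_const:
  fixes S :: "'a::euclidean_space set"
  shows "real_superharmonic S (\<lambda>_. c)"
proof -
  have "measure (unit_ball_dist :: 'a measure) UNIV = 1"
    using unit_ball_dist.prob_space by (simp only: space_unit_ball_dist)
  then show ?thesis unfolding real_superharmonic_def by (auto simp: bounded_iff)
qed

lemma real_superharmonic_cmult:
  assumes f: "real_superharmonic S f" and c: "c \<ge> 0"
  shows "real_superharmonic S (\<lambda>x. c * f x)"
proof (cases "c = 0")
  case True
  then show ?thesis using real_superharmonic_const[of S 0] by simp
next
  case False
  with c have c: "c > 0" by simp
  show ?thesis
    unfolding real_superharmonic_def
  proof (intro conjI ballI allI impI)
    show "(\<lambda>x. c * f x) \<in> borel_measurable borel"
      using f by (auto simp: real_superharmonic_def)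
    from f obtain A where A: "\<And>y. y \<in> S \<Longrightarrow> \<bar>f y\<bar> \<le> A"
      by (auto simp: real_superharmonic_def bounded_iff)
    show "bounded ((\<lambda>x. c * f x) ` S)"
      using A c by (auto simp: bounded_iff abs_mult intro!: exI[of _ "c * A"])
    fix x a assume x: "x \<in> S" and a: "a < c * f x"
    have "a / c < f x" using a c by (simp add: field_simps)
    then have "\<forall>\<^sub>F y in at x within S. a / c < f y"
      using f x by (auto simp: real_superharmonic_def)
    then show "\<forall>\<^sub>F y in at x within S. a < c * f y"
      by eventually_elim (use c in \<open>simp add: field_simps\<close>)
  next
    fix x r assume r: "0 < (r::real)" "cball x r \<subseteq> S"
    have "(LINT u|unit_ball_dist. f (x + r *\<^sub>R u)) \<le> f x" using f r by (auto simp: real_superharmonic_def)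
    then show "(LINT u|unit_ball_dist. c * f (x + r *\<^sub>R u)) \<le> c * f x" using c by simp
  qed
qed

lemma real_superharmonic_imp_superharmonic_on:
  fixes S :: "'a::euclidean_space set"
  assumes h: "real_superharmonic S h"
  shows "superharmonic_on S (\<lambda>x. ereal (h x))"
  unfolding superharmonic_on_def
proof (intro conjI ballI allI impI)
  fix C assume "C \<in> components S"
  then show "\<exists>x\<in>C. ereal (h x) \<noteq> \<infinity>" using in_components_nonempty by fastforce
next
  fix x assume x: "x \<in> S"
  show "ereal (h x) \<le> Liminf (at x within S) (\<lambda>x. ereal (h x))"
    unfolding le_Liminf_iff
  proof (intro allI impI)
    fix y assume y: "y < ereal (h x)"
    show "\<forall>\<^sub>F z in at x within S. y < ereal (h z)"
    proof (cases y)
      case (real a)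
      then show ?thesis using y h x by (auto simp: real_superharmonic_def)
    qed (use y in auto)
  qed
next
  fix x r assume r: "0 < (r::real)" "cball x r \<subseteq> S"
  have [measurable]: "h \<in> borel_measurable borel" using h by (simp add: real_superharmonic_def)
  let ?m = "measure lborel (cball x r)"
  let ?P = "\<integral>\<^sup>+u. ennreal (h (x + r *\<^sub>R u)) \<partial>unit_ball_dist"
  let ?N = "\<integral>\<^sup>+u. ennreal (- h (x + r *\<^sub>R u)) \<partial>unit_ball_dist"
  have m: "?m > 0" "emeasure lborel (cball x r) = ennreal ?m" by (auto intro: cball_emeasure r)
  have int: "integrable unit_ball_dist (\<lambda>u. h (x + r *\<^sub>R u))"
    using h r by (auto simp: real_superharmonic_def intro: integrable_ball_bounded)
  have fin: "?P \<noteq> top" "?N \<noteq> top"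
    using int by (auto simp: real_integrable_def)
  have cv: "(\<integral>\<^sup>+z\<in>cball x r. g z \<partial>lborel) = (\<integral>\<^sup>+u. g (x + r *\<^sub>R u) \<partial>unit_ball_dist) * ennreal ?m"
    if [measurable]: "g \<in> borel_measurable borel" for g
  proof -
    have "(\<integral>\<^sup>+u. g (x + r *\<^sub>R u) \<partial>unit_ball_dist) * ennreal ?m
       = (\<integral>\<^sup>+z. indicator (cball x r) z * g z \<partial>lborel) / ennreal ?m * ennreal ?m"
      using nn_integral_unit_ball_affine[of g r x] r m by simp
    also have "\<dots> = (\<integral>\<^sup>+z. indicator (cball x r) z * g z \<partial>lborel)"
      by (rule ennreal_divide_mult_cancel) (use m in auto)
    finally show ?thesis by (simp add: mult.commute)
  qed
  obtain p n where pn: "?P = ennreal p" "p \<ge> 0" "?N = ennreal n" "n \<ge> 0"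
    using fin by (cases ?P; cases ?N) auto
  have "ball_mean (\<lambda>x. ereal (h x)) x r = (enn2ereal (?P * ennreal ?m) - enn2ereal (?N * ennreal ?m)) / ereal ?m"
    unfolding ball_mean_def by (simp add: cv)
  also have "\<dots> = ereal (p - n)"
    using pn m by (simp add: ennreal_mult'[symmetric] enn2ereal_ennreal left_diff_distrib[symmetric])
  also have "p - n = (LINT u|unit_ball_dist. h (x + r *\<^sub>R u))"
    using pn by (subst real_lebesgue_integral_def[OF int]) simp
  also have "\<dots> \<le> h x" using h r by (auto simp: real_superharmonic_def)
  finally show "ball_mean (\<lambda>x. ereal (h x)) x r \<le> ereal (h x)" by simp
qed auto

lemma upper_function_of_real_superharmonic:
  fixes \<Omega> :: "'a::euclidean_space set"
  assumes h: "real_superharmonic \<Omega> h"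
    and bd: "\<And>\<xi> a. \<xi> \<in> frontier \<Omega> \<Longrightarrow> a < f \<xi> \<Longrightarrow> \<forall>\<^sub>F y in at \<xi> within \<Omega>. a < h y"
  shows "upper_function \<Omega> f (\<lambda>y. ereal (h y))"
  unfolding upper_function_def le_Liminf_iff
proof (intro conjI ballI allI impI real_superharmonic_imp_superharmonic_on h)
  fix \<xi> a assume \<xi>: "\<xi> \<in> frontier \<Omega>" and a: "a < ereal (f \<xi>)"
  show "\<forall>\<^sub>F y in at \<xi> within \<Omega>. a < ereal (h y)"
    using bd[OF \<xi>] a by (cases a) auto
qed

text \<open>
  Lower semicontinuity inside and the boundary condition give a lower bound near each point of the
  compact closure.
\<close>

lemma upper_function_bounded_below:
  fixes \<Omega> :: "'a::euclidean_space set"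
  assumes "bounded \<Omega>" "open \<Omega>" and u: "upper_function \<Omega> f h"
  shows "\<exists>C. \<forall>y\<in>\<Omega>. ereal (- C) < h y"
proof (rule ccontr)
  assume "\<not> ?thesis"
  then have "\<exists>y\<in>\<Omega>. h y \<le> ereal (- real n)" for n by (auto simp: not_less)
  then obtain y where y: "\<And>n. y n \<in> \<Omega>" "\<And>n. h (y n) \<le> ereal (- real n)" by metis
  have "compact (closure \<Omega>)" using assms by simp
  then obtain l s where l: "l \<in> closure \<Omega>" "strict_mono s" "(y \<circ> s) \<longlonglongrightarrow> l"
    using y(1) closure_subset unfolding compact_def by (metis subset_iff)
  obtain c where c: "\<forall>\<^sub>F z in at l within \<Omega>. ereal c < h z" "l \<in> \<Omega> \<Longrightarrow> ereal c < h l"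
  proof (cases "l \<in> \<Omega>")
    case True
    then have hl: "h l \<noteq> -\<infinity>" "h l \<le> Liminf (at l within \<Omega>) h"
      using u by (auto simp: upper_function_def superharmonic_on_def)
    from hl(1) obtain c where "ereal c < h l" using ereal_dense2[of "-\<infinity>" "h l"] by auto
    then show ?thesis using that hl(2) by (auto simp: le_Liminf_iff)
  next
    case False
    then have "l \<in> frontier \<Omega>" using l(1) \<open>open \<Omega>\<close> by (simp add: frontier_def interior_open)
    then have "ereal (f l) \<le> Liminf (at l within \<Omega>) h" using u by (auto simp: upper_function_def)
    moreover have "ereal (f l - 1) < ereal (f l)" by simp
    ultimately show ?thesis using that[of "f l - 1"] False by (auto simp: le_Liminf_iff)
  qed
  have "\<forall>\<^sub>F z in nhds l. z \<in> \<Omega> \<longrightarrow> ereal c < h z"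
    using c unfolding eventually_at_filter by (auto elim!: eventually_mono)
  then have "\<forall>\<^sub>F n in sequentially. (y \<circ> s) n \<in> \<Omega> \<longrightarrow> ereal c < h ((y \<circ> s) n)"
    using l(3) by (rule eventually_compose_filterlim)
  moreover have "\<forall>\<^sub>F n in sequentially. real n > - c" using filterlim_real_sequentially by (simp add: filterlim_at_top_dense)
  ultimately have "\<forall>\<^sub>F n in sequentially. False"
  proof eventually_elim
    case (elim n)
    have "ereal c < h (y (s n))" using elim y by simp
    also have "\<dots> \<le> ereal (- real (s n))" by (rule y)
    also have "\<dots> \<le> ereal (- real n)" using seq_suble[OF l(2), of n] by simp
    finally show ?case using elim by simp
  qed
  then show False by simp
qed

text \<open>
  Adding a constant turns the difference of two integrals in \<^const>\<open>ball_mean\<close> into one nonnegative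
  integral, so that the super-mean-value property can be iterated along the walk.
\<close>

lemma superharmonic_shifted_step:
  fixes h :: "'a::euclidean_space \<Rightarrow> ereal"
  assumes bm: "ball_mean h y r \<le> h y" and r: "r > 0" and lb: "\<And>z. z \<in> cball y r \<Longrightarrow> ereal (- C) < h z"
    and C: "C \<ge> 0" and H: "\<And>z. z \<in> cball y r \<Longrightarrow> H z = e2ennreal (h z + ereal C)"
    and hm: "(\<lambda>z. if z \<in> S then h z else -\<infinity>) \<in> borel_measurable borel" and S: "cball y r \<subseteq> S"
    and [measurable]: "H \<in> borel_measurable borel"
  shows "(\<integral>\<^sup>+u. H (y + r *\<^sub>R u) \<partial>unit_ball_dist) \<le> H y"
proof -
  let ?m = "measure lborel (cball y r)" and ?B = "cball y r"
  define h' where "h' z = (if z \<in> S then h z else -\<infinity>)" for z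
  have [measurable]: "h' \<in> borel_measurable borel" using hm unfolding h'_def .
  have h': "h' z = h z" if "z \<in> ?B" for z using that S by (auto simp: h'_def)
  have [measurable]: "?B \<in> sets borel" by simp
  have m: "?m > 0" "emeasure lborel ?B = ennreal ?m" by (auto intro: cball_emeasure r)
  define P where "P = (\<integral>\<^sup>+z\<in>?B. e2ennreal (h z) \<partial>lborel)"
  define N where "N = (\<integral>\<^sup>+z\<in>?B. e2ennreal (- h z) \<partial>lborel)"
  define I where "I = (\<integral>\<^sup>+z\<in>?B. H z \<partial>lborel)"
  have P': "P = (\<integral>\<^sup>+z\<in>?B. e2ennreal (h' z) \<partial>lborel)" and N': "N = (\<integral>\<^sup>+z\<in>?B. e2ennreal (- h' z) \<partial>lborel)"
    unfolding P_def N_def by (intro nn_integral_cong; simp add: h' indicator_def)+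
  have pw: "H z + e2ennreal (- h' z) = e2ennreal (h' z) + ennreal C" if z: "z \<in> ?B" for z
  proof (cases "h z")
    case (real a)
    then have "- C < a" using lb[OF z] by simp
    then show ?thesis using real C h'[OF z] by (cases "a \<ge> 0") (auto simp: H[OF z] e2ennreal_ereal ennreal_neg simp flip: ennreal_plus)
  next
    case PInf
    then show ?thesis using h'[OF z] by (simp add: H[OF z] e2ennreal_neg)
  next
    case MInf
    then show ?thesis using lb[OF z] by simp
  qed
  have "I + N = (\<integral>\<^sup>+z. (H z + e2ennreal (- h' z)) * indicator ?B z \<partial>lborel)"
    unfolding I_def N' by (subst nn_integral_add[symmetric]) (auto simp: distrib_right)
  also have "\<dots> = (\<integral>\<^sup>+z. e2ennreal (h' z) * indicator ?B z + ennreal C * indicator ?B z \<partial>lborel)"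
    by (intro nn_integral_cong) (auto simp: pw indicator_def)
  also have "\<dots> = P + ennreal C * ennreal ?m"
    unfolding P' by (subst nn_integral_add) (auto simp: nn_integral_cmult m)
  finally have IN: "I + N = P + ennreal C * ennreal ?m" .
  have "N \<le> (\<integral>\<^sup>+z. ennreal C * indicator ?B z \<partial>lborel)"
    unfolding N_def
  proof (intro nn_integral_mono)
    fix z
    show "e2ennreal (- h z) * indicator ?B z \<le> ennreal C * indicator ?B z"
    proof (cases "z \<in> ?B")
      case True
      have "- h z \<le> ereal C" using lb[OF True] by (cases "h z") auto
      then have "e2ennreal (- h z) \<le> e2ennreal (ereal C)" by (rule e2ennreal_mono)
      then show ?thesis by (intro mult_right_mono) (simp_all add: e2ennreal_ereal)
    qed simp
  qed
  also have "\<dots> = ennreal C * ennreal ?m" by (simp add: nn_integral_cmult m)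
  finally have Nfin: "N < top" by (simp add: le_less_trans ennreal_mult_less_top)
  have Im: "(\<integral>\<^sup>+u. H (y + r *\<^sub>R u) \<partial>unit_ball_dist) = I / ennreal ?m"
    using nn_integral_unit_ball_affine[of H r y] r m by (simp add: I_def mult.commute)
  show ?thesis
  proof (cases "h y")
    case PInf
    then show ?thesis using H[of y] r by simp
  next
    case MInf
    then show ?thesis using lb[of y] r by simp
  next
    case (real a)
    obtain n where n: "N = ennreal n" "n \<ge> 0" using Nfin by (cases N) auto
    have bm': "(enn2ereal P - ereal n) / ereal ?m \<le> ereal a"
      using bm n unfolding ball_mean_def P_def[symmetric] N_def[symmetric] real by (simp add: enn2ereal_ennreal)
    have "P \<noteq> top"
    proof
      assume "P = top"
      then show False using bm' m by simp
    qed
    then obtain p where p: "P = ennreal p" "p \<ge> 0" by (cases P) auto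
    have "(p - n) / ?m \<le> a" using bm' m p by (simp add: enn2ereal_ennreal)
    then have le: "p - n \<le> a * ?m" using m by (simp add: divide_le_eq)
    have "I + N \<noteq> top" unfolding IN p by (simp add: ennreal_mult_eq_top_iff)
    then obtain i where i: "I = ennreal i" "i \<ge> 0" by (cases I) auto
    have "ennreal (i + n) = ennreal (p + C * ?m)" using IN i n p C m by (simp add: ennreal_mult' ennreal_plus)
    then have "i + n = p + C * ?m" using i n p C m by (subst (asm) ennreal_inj) auto
    then have "i \<le> (a + C) * ?m" using le by (simp add: algebra_simps)
    then have "i / ?m \<le> a + C" using m by (simp add: divide_le_eq)
    then have "I / ennreal ?m \<le> ennreal (a + C)" using i m by (simp add: divide_ennreal ennreal_leI)
    also have "\<dots> = H y" using H[of y] r real by (simp add: e2ennreal_ereal)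
    finally show ?thesis unfolding Im .
  qed
qed

context bounded_open_set
begin

text \<open>
  The limit depends on the choice of a subsequence, which in turn depends on \<open>x\<close>; its law is shown
  later not to.
\<close>

definition exit_point :: "'a \<Rightarrow> (nat \<Rightarrow> 'a) \<Rightarrow> 'a" where
  "exit_point x = (SOME Y. \<exists>r. strict_mono r \<and> Y \<in> borel_measurable paths \<and> (\<forall>\<omega>. Y \<omega> \<in> frontier \<Omega>) \<and>
           (AE \<omega> in paths. (\<lambda>i. walk (r i) x \<omega>) \<longlonglongrightarrow> Y \<omega>))"

lemma exit_point_spec:
  assumes "x \<in> \<Omega>"
  shows "\<exists>r. strict_mono r \<and> (AE \<omega> in paths. (\<lambda>i. walk (r i) x \<omega>) \<longlonglongrightarrow> exit_point x \<omega>)"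
    and exit_point_measurable: "exit_point x \<in> borel_measurable paths"
    and exit_point_in: "exit_point x \<omega> \<in> frontier \<Omega>"
  using someI_ex[OF walk_limit[OF assms]] unfolding exit_point_def[symmetric] by blast+

definition exit_law :: "'a \<Rightarrow> 'a measure" where
  "exit_law x = distr paths (restrict_space borel (frontier \<Omega>)) (exit_point x)"

lemma sets_exit_law: "sets (exit_law x) = sets (restrict_space borel (frontier \<Omega>))"
  by (simp add: exit_law_def)

lemma exit_point_measurable': "x \<in> \<Omega> \<Longrightarrow> exit_point x \<in> paths \<rightarrow>\<^sub>M restrict_space borel (frontier \<Omega>)"
  by (intro measurable_restrict_space2 exit_point_measurable) (auto intro: exit_point_in)

lemma prob_space_exit_law: "x \<in> \<Omega> \<Longrightarrow> prob_space (exit_law x)"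
  unfolding exit_law_def
  by (intro paths.prob_space_distr exit_point_measurable')

lemma integral_exit_law:
  fixes f :: "'a \<Rightarrow> real"
  assumes "x \<in> \<Omega>" "f \<in> borel_measurable (restrict_space borel (frontier \<Omega>))"
  shows "(LINT \<xi>|exit_law x. f \<xi>) = (LINT \<omega>|paths. f (exit_point x \<omega>))"
  unfolding exit_law_def by (rule integral_distr[OF exit_point_measurable'[OF assms(1)] assms(2)])

lemma walk_mean_le:
  assumes [measurable]: "H \<in> borel_measurable borel"
    and sm: "\<And>y. y \<in> \<Omega> \<Longrightarrow> (\<integral>\<^sup>+u. H (y + rho y *\<^sub>R u) \<partial>unit_ball_dist) \<le> H y" and x: "x \<in> \<Omega>"
  shows "walk_mean k H x \<le> H x"
  using x
proof (induction k arbitrary: x)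
  case (Suc k)
  have "walk_mean (Suc k) H x \<le> (\<integral>\<^sup>+u. H (x + rho x *\<^sub>R u) \<partial>unit_ball_dist)"
  proof (subst walk_mean_Suc, simp, rule nn_integral_mono_AE)
    show "AE u in unit_ball_dist. walk_mean k H (x + rho x *\<^sub>R u) \<le> H (x + rho x *\<^sub>R u)"
      using AE_unit_ball_dist by eventually_elim (intro Suc.IH step_in Suc.prems)
  qed
  also have "\<dots> \<le> H x" by (rule sm[OF Suc.prems])
  finally show ?case .
qed simp

text \<open>
  The expectation of \<open>H\<close> along the walk is at most \<open>H x\<close>. At the limit point on the boundary the
  data \<open>\<phi>\<close> lie below the lower limit of \<open>H\<close>, and Fatou's lemma concludes.
\<close>

lemma exit_integral_le:
  fixes H \<phi> :: "'a \<Rightarrow> ennreal"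
  assumes x: "x \<in> \<Omega>" and [measurable]: "H \<in> borel_measurable borel"
    and sm: "\<And>y. y \<in> \<Omega> \<Longrightarrow> (\<integral>\<^sup>+u. H (y + rho y *\<^sub>R u) \<partial>unit_ball_dist) \<le> H y"
    and bd: "\<And>\<xi>. \<xi> \<in> frontier \<Omega> \<Longrightarrow> \<phi> \<xi> \<le> Liminf (at \<xi> within \<Omega>) H"
  shows "(\<integral>\<^sup>+\<omega>. \<phi> (exit_point x \<omega>) \<partial>paths) \<le> H x"
proof -
  from exit_point_spec(1)[OF x] obtain r where r: "strict_mono r"
    "AE \<omega> in paths. (\<lambda>i. walk (r i) x \<omega>) \<longlonglongrightarrow> exit_point x \<omega>" by blast
  have "(\<integral>\<^sup>+\<omega>. \<phi> (exit_point x \<omega>) \<partial>paths) \<le> (\<integral>\<^sup>+\<omega>. liminf (\<lambda>i. H (walk (r i) x \<omega>)) \<partial>paths)"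
  proof (rule nn_integral_mono_AE)
    show "AE \<omega> in paths. \<phi> (exit_point x \<omega>) \<le> liminf (\<lambda>i. H (walk (r i) x \<omega>))"
      using r(2) AE_walk_in[OF x]
    proof eventually_elim
      case (elim \<omega>)
      let ?\<xi> = "exit_point x \<omega>"
      have \<xi>: "?\<xi> \<in> frontier \<Omega>" by (rule exit_point_in[OF x])
      then have "?\<xi> \<notin> \<Omega>" using open_\<Omega> by (simp add: frontier_def interior_open)
      then have lim: "filterlim (\<lambda>i. walk (r i) x \<omega>) (at ?\<xi> within \<Omega>) sequentially"
        using elim by (auto simp: filterlim_at intro!: always_eventually) metis
      show ?case unfolding le_Liminf_iff
      proof (intro allI impI)
        fix y assume "y < \<phi> ?\<xi>"
        then have "\<forall>\<^sub>F z in at ?\<xi> within \<Omega>. y < H z" using bd[OF \<xi>] by (auto simp: le_Liminf_iff)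
        then show "\<forall>\<^sub>F i in sequentially. y < H (walk (r i) x \<omega>)"
          by (rule eventually_compose_filterlim[OF _ lim])
      qed
    qed
  qed
  also have "\<dots> \<le> liminf (\<lambda>i. walk_mean (r i) H x)"
    unfolding walk_mean_def by (rule nn_integral_liminf) measurable
  also have "\<dots> \<le> liminf (\<lambda>i. H x)"
    by (intro Liminf_mono always_eventually allI walk_mean_le sm x) measurable
  also have "\<dots> = H x" by (simp add: Liminf_const)
  finally show ?thesis .
qed

text \<open>
  Apply \<open>exit_integral_le\<close> to the upper function and its boundary data, both raised by the
  constant \<open>C\<close> that makes them nonnegative.
\<close>

theorem upper_function_ge_exit_integral:
  assumes u: "upper_function \<Omega> f h" and f: "continuous_on (frontier \<Omega>) f" and x: "x \<in> \<Omega>"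
  shows "ereal (LINT \<xi>|exit_law x. f \<xi>) \<le> h x"
proof -
  obtain C1 where C1: "\<And>y. y \<in> \<Omega> \<Longrightarrow> ereal (- C1) < h y"
    using upper_function_bounded_below[OF bounded_\<Omega> open_\<Omega> u] by blast
  have "bounded (f ` frontier \<Omega>)"
    using f compact_frontier_bounded[OF bounded_\<Omega>] by (intro compact_imp_bounded compact_continuous_image)
  then obtain C2 where C2: "\<And>\<xi>. \<xi> \<in> frontier \<Omega> \<Longrightarrow> \<bar>f \<xi>\<bar> \<le> C2" by (auto simp: bounded_iff)
  define C where "C = max 0 (max C1 C2)"
  have C: "C \<ge> 0" "\<And>y. y \<in> \<Omega> \<Longrightarrow> ereal (- C) < h y" "\<And>\<xi>. \<xi> \<in> frontier \<Omega> \<Longrightarrow> \<bar>f \<xi>\<bar> \<le> C"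
  proof -
    show "C \<ge> 0" by (simp add: C_def)
    show "ereal (- C) < h y" if "y \<in> \<Omega>" for y
      by (rule le_less_trans[OF _ C1[OF that]]) (simp add: C_def)
    show "\<bar>f \<xi>\<bar> \<le> C" if "\<xi> \<in> frontier \<Omega>" for \<xi> using C2[OF that] by (simp add: C_def)
  qed
  \<comment> \<open>Extended by \<open>-\<infinity>\<close>, the function is lower semicontinuous on the whole space, hence
    Borel.\<close>
  define h' where "h' y = (if y \<in> \<Omega> then h y else -\<infinity>)" for y
  have h'm [measurable]: "h' \<in> borel_measurable borel"
  proof (rule borel_measurableI_greater)
    fix a :: ereal
    have "open {y. a < h' y}"
      unfolding open_subopen[of "{y. a < h' y}"]
    proof (intro ballI)
      fix y assume "y \<in> {y. a < h' y}"
      then have y: "y \<in> \<Omega>" "a < h y" by (auto simp: h'_def split: if_splits)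
      then have "h y \<le> Liminf (at y within \<Omega>) h" using u by (auto simp: upper_function_def superharmonic_on_def)
      then have "\<forall>\<^sub>F z in at y within \<Omega>. a < h z" using y by (auto simp: le_Liminf_iff)
      then have "\<forall>\<^sub>F z in nhds y. z \<in> \<Omega> \<longrightarrow> a < h z"
        unfolding eventually_at_filter using y by (auto elim!: eventually_mono)
      moreover have "\<forall>\<^sub>F z in nhds y. z \<in> \<Omega>" using open_\<Omega> y by (simp add: eventually_nhds_in_open)
      ultimately have "\<forall>\<^sub>F z in nhds y. a < h' z" by eventually_elim (simp add: h'_def)
      then show "\<exists>T. open T \<and> y \<in> T \<and> T \<subseteq> {y. a < h' y}" unfolding eventually_nhds by blast
    qed
    then show "{y \<in> space borel. a < h' y} \<in> sets borel" by simp
  qed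
  define H where "H y = e2ennreal (h' y + ereal C)" for y
  have [measurable]: "H \<in> borel_measurable borel" unfolding H_def by measurable
  have H: "H y = e2ennreal (h y + ereal C)" if "y \<in> \<Omega>" for y using that by (simp add: H_def h'_def)
  have le0: "(\<integral>\<^sup>+\<omega>. ennreal (f (exit_point x \<omega>) + C) \<partial>paths) \<le> H x"
  proof (rule exit_integral_le[OF x, where \<phi>="\<lambda>\<xi>. ennreal (f \<xi> + C)"])
    fix y assume y: "y \<in> \<Omega>"
    note sub = cball_rho_subset[OF y] and pos = rho_pos[OF y]
    show "(\<integral>\<^sup>+u. H (y + rho y *\<^sub>R u) \<partial>unit_ball_dist) \<le> H y"
    proof (rule superharmonic_shifted_step[where h=h and C=C and S=\<Omega>])
      show "ball_mean h y (rho y) \<le> h y" using u sub pos by (auto simp: upper_function_def superharmonic_on_def)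
      show "(\<lambda>z. if z \<in> \<Omega> then h z else -\<infinity>) \<in> borel_measurable borel" using h'm unfolding h'_def .
    qed (use sub pos C H in auto)
  next
    fix \<xi> assume \<xi>: "\<xi> \<in> frontier \<Omega>"
    show "ennreal (f \<xi> + C) \<le> Liminf (at \<xi> within \<Omega>) H"
      unfolding le_Liminf_iff
    proof (intro allI impI)
      fix a assume a: "a < ennreal (f \<xi> + C)"
      then obtain a' where a': "a = ennreal a'" "a' \<ge> 0" by (cases a) auto
      then have "a' - C < f \<xi>" using a by (simp add: ennreal_less_iff)
      then have "\<forall>\<^sub>F z in at \<xi> within \<Omega>. ereal (a' - C) < h z"
        using u \<xi> by (auto simp: upper_function_def le_Liminf_iff)
      moreover have "\<forall>\<^sub>F z in at \<xi> within \<Omega>. z \<in> \<Omega>" by (simp add: eventually_at_filter)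
      ultimately show "\<forall>\<^sub>F z in at \<xi> within \<Omega>. a < H z"
      proof eventually_elim
        case (elim z)
        then show ?case using a' by (cases "h z") (auto simp: H e2ennreal_ereal ennreal_less_iff e2ennreal_infty)
      qed
    qed
  qed measurable
  have fm: "f \<in> borel_measurable (restrict_space borel (frontier \<Omega>))"
    using f by (rule borel_measurable_continuous_on_restrict)
  have fY: "(\<lambda>\<omega>. f (exit_point x \<omega>)) \<in> borel_measurable paths"
    by (rule measurable_compose[OF exit_point_measurable'[OF x] fm])
  have int: "integrable paths (\<lambda>\<omega>. f (exit_point x \<omega>))"
    by (rule paths.integrable_const_bound[of _ C]) (use fY C(3) exit_point_in[OF x] in auto)
  have nn: "f (exit_point x \<omega>) + C \<ge> 0" for \<omega> using C(3)[OF exit_point_in[OF x, of \<omega>]] by linarith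
  have "(\<integral>\<^sup>+\<omega>. ennreal (f (exit_point x \<omega>) + C) \<partial>paths) = ennreal (LINT \<omega>|paths. f (exit_point x \<omega>) + C)"
    using int nn by (intro nn_integral_eq_integral) auto
  also have "(LINT \<omega>|paths. f (exit_point x \<omega>) + C) = (LINT \<xi>|exit_law x. f \<xi>) + C"
  proof -
    have "(LINT \<omega>|(paths :: (nat \<Rightarrow> 'a) measure). C) = C"
      by (simp add: measure_def paths.emeasure_space_1)
    then show ?thesis using int by (simp only: integral_exit_law[OF x fm] Bochner_Integration.integral_add paths.integrable_const)
  qed
  finally have le: "ennreal ((LINT \<xi>|exit_law x. f \<xi>) + C) \<le> e2ennreal (h x + ereal C)"
    using le0 H[OF x] by simp
  show ?thesis
  proof (cases "h x")
    case (real a)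
    have "- C < a" using C(2)[OF x] real by simp
    then show ?thesis using le real by (simp add: e2ennreal_ereal ennreal_le_iff)
  qed (use C(2)[OF x] in auto)
qed

text \<open>
  The minimum principle is the case of zero boundary data.
\<close>

lemma real_superharmonic_nonneg:
  assumes h: "real_superharmonic \<Omega> h" and x: "x \<in> \<Omega>"
    and bd: "\<And>\<xi> e. \<xi> \<in> frontier \<Omega> \<Longrightarrow> e > 0 \<Longrightarrow> \<forall>\<^sub>F y in at \<xi> within \<Omega>. - e < h y"
  shows "h x \<ge> 0"
proof -
  have "\<forall>\<^sub>F y in at \<xi> within \<Omega>. a < h y" if "\<xi> \<in> frontier \<Omega>" "a < 0" for \<xi> a
    using bd[OF that(1), of "- a"] that(2) by simp
  then have "upper_function \<Omega> (\<lambda>_. 0) (\<lambda>y. ereal (h y))"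
    by (intro upper_function_of_real_superharmonic h)
  from upper_function_ge_exit_integral[OF this _ x] show ?thesis by simp
qed

end

section \<open>Potentials\<close>

lemma newton_lsc:
  fixes x :: "'a::euclidean_space"
  assumes d: "DIM('a) \<ge> 3" and a: "a < newton x"
  shows "\<forall>\<^sub>F y in nhds x. a < newton y"
proof -
  let ?R = "\<lambda>n. reg_power (1 / Suc n) (real DIM('a) / 2 - 1) :: 'a \<Rightarrow> real"
  from a have "a < (SUP n. ennreal (?R n x))" by (simp only: reg_power_LIMSEQ_newton(2)[OF d])
  then obtain n where n: "a < ennreal (?R n x)" by (auto simp: less_SUP_iff)
  have "continuous_on UNIV (\<lambda>y. ennreal (?R n y))"
    by (intro continuous_on_ennreal continuous_on_reg_power continuous_intros) auto
  then have "((\<lambda>y. ennreal (?R n y)) \<longlongrightarrow> ennreal (?R n x)) (nhds x)"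
    by (simp add: continuous_on_eq_continuous_at isCont_def tendsto_at_iff_tendsto_nhds)
  from order_tendstoD(1)[OF this n] show ?thesis
  proof eventually_elim
    case (elim y)
    also have "ennreal (?R n y) \<le> newton y"
      unfolding reg_power_LIMSEQ_newton(2)[OF d, of y, symmetric] by (rule SUP_upper) simp
    finally show ?case .
  qed
qed

lemma newton_tendsto:
  fixes x :: "'a::euclidean_space"
  assumes f: "(f \<longlongrightarrow> x) F" and x: "x \<noteq> 0"
  shows "((\<lambda>i. newton (f i)) \<longlongrightarrow> newton x) F"
proof -
  have "\<forall>\<^sub>F i in F. f i \<noteq> 0" using f x by (rule tendsto_imp_eventually_ne)
  then have "\<forall>\<^sub>F i in F. ennreal (norm (f i) powr (2 - real DIM('a))) = newton (f i)"
    by eventually_elim (simp add: newton_def)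
  moreover have "((\<lambda>i. ennreal (norm (f i) powr (2 - real DIM('a)))) \<longlongrightarrow> ennreal (norm x powr (2 - real DIM('a)))) F"
    using f x by (intro tendsto_intros) auto
  moreover have "newton x = ennreal (norm x powr (2 - real DIM('a)))" using x by (simp add: newton_def)
  ultimately show ?thesis by (simp only: Lim_transform_eventually)
qed

definition newton_mean :: "real \<Rightarrow> 'a::euclidean_space \<Rightarrow> ennreal" where
  "newton_mean r x = (\<integral>\<^sup>+u. newton (x + r *\<^sub>R u) \<partial>unit_ball_dist)"

lemma newton_mean_measurable [measurable]: "newton_mean r \<in> borel_measurable borel"
  unfolding newton_mean_def by measurable

lemma newton_mean_minus: "newton_mean r (- x) = newton_mean r x"
proof -
  have "newton_mean r (- x) = (\<integral>\<^sup>+u. newton (- (x + r *\<^sub>R (- u))) \<partial>unit_ball_dist)"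
    unfolding newton_mean_def by simp
  also have "\<dots> = newton_mean r x"
    unfolding newton_minus newton_mean_def
    by (rule nn_integral_unit_ball_uminus[of "\<lambda>u. newton (x + r *\<^sub>R u)"]) measurable
  finally show ?thesis .
qed

lemma newton_mean_shift: "(\<integral>\<^sup>+u. newton (x - (y + r *\<^sub>R u)) \<partial>unit_ball_dist) = newton_mean r (x - y)"
proof -
  have "newton (x - (y + r *\<^sub>R u)) = newton (- (x - y) + r *\<^sub>R u)" for u
    by (subst newton_minus[symmetric]) (simp add: algebra_simps)
  then show ?thesis using newton_mean_minus[of r "x - y"] by (simp add: newton_mean_def)
qed

lemma newton_mean_shift': "(\<integral>\<^sup>+u. newton (x + r *\<^sub>R u - y) \<partial>unit_ball_dist) = newton_mean r (x - y)"
  by (simp add: newton_mean_def algebra_simps)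

text \<open>
  The mass is given as the image of a measure \<open>M\<close> under \<open>V\<close>. This covers at once mass densities,
  laws of the walk, exit laws, and mixtures of them.
\<close>

definition potential :: "'b measure \<Rightarrow> ('b \<Rightarrow> 'a::euclidean_space) \<Rightarrow> 'a \<Rightarrow> ennreal" where
  "potential M V x = (\<integral>\<^sup>+t. newton (x - V t) \<partial>M)"

locale potential_source = sigma_finite_measure M for M :: "'b measure" +
  fixes V :: "'b \<Rightarrow> 'a::euclidean_space"
  assumes dim3: "DIM('a) \<ge> 3" and V [measurable]: "V \<in> borel_measurable M"
begin

lemma potential_measurable [measurable]: "potential M V \<in> borel_measurable borel"
  unfolding potential_def by measurable

lemma potential_lsc:
  assumes a: "a < potential M V x"
  shows "\<forall>\<^sub>F y in nhds x. a < potential M V y"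
  unfolding eventually_nhds_iff_sequentially
proof (intro allI impI)
  fix y assume y: "y \<longlonglongrightarrow> x"
  have "potential M V x \<le> (\<integral>\<^sup>+t. liminf (\<lambda>n. newton (y n - V t)) \<partial>M)"
    unfolding potential_def
  proof (intro nn_integral_mono)
    fix t
    have "(\<lambda>n. y n - V t) \<longlonglongrightarrow> x - V t" by (intro tendsto_intros y)
    then show "newton (x - V t) \<le> liminf (\<lambda>n. newton (y n - V t))"
      unfolding le_Liminf_iff using newton_lsc[OF dim3] eventually_compose_filterlim by blast
  qed
  also have "\<dots> \<le> liminf (\<lambda>n. potential M V (y n))"
    unfolding potential_def by (rule nn_integral_liminf) measurable
  finally show "\<forall>\<^sub>F n in sequentially. a < potential M V (y n)"
    using a by (auto simp: le_Liminf_iff)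
qed

text \<open>
  By Tonelli's theorem, mean-value properties of the kernel pass to its potentials.
\<close>

lemma potential_mean:
  "(\<integral>\<^sup>+u. potential M V (x + r *\<^sub>R u) \<partial>unit_ball_dist) = (\<integral>\<^sup>+t. newton_mean r (x - V t) \<partial>M)"
proof -
  interpret P: pair_sigma_finite "unit_ball_dist :: 'a measure" M ..
  have "(\<integral>\<^sup>+u. potential M V (x + r *\<^sub>R u) \<partial>unit_ball_dist) = (\<integral>\<^sup>+t. (\<integral>\<^sup>+u. newton (x + r *\<^sub>R u - V t) \<partial>unit_ball_dist) \<partial>M)"
    unfolding potential_def
    by (rule P.Fubini'[symmetric]) measurable
  then show ?thesis by (simp only: newton_mean_shift')
qed

lemma potential_mean_le:
  "r \<ge> 0 \<Longrightarrow> (\<integral>\<^sup>+u. potential M V (x + r *\<^sub>R u) \<partial>unit_ball_dist) \<le> potential M V x"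
  unfolding potential_mean unfolding potential_def newton_mean_def
  by (intro nn_integral_mono newton_mean_le dim3)

lemma potential_mean_eq:
  "r \<ge> 0 \<Longrightarrow> AE t in M. r < norm (x - V t) \<Longrightarrow> (\<integral>\<^sup>+u. potential M V (x + r *\<^sub>R u) \<partial>unit_ball_dist) = potential M V x"
  unfolding potential_mean unfolding potential_def newton_mean_def
  by (intro nn_integral_cong_AE) (auto elim!: eventually_mono intro: newton_mean_eq[OF dim3])

lemma potential_real_superharmonic:
  assumes C: "\<And>x. potential M V x \<le> ennreal C"
  shows "real_superharmonic UNIV (\<lambda>x. enn2real (potential M V x))"
  unfolding real_superharmonic_def
proof (intro conjI ballI allI impI)
  have fin: "potential M V x < top" for x using C[of x] le_less_trans by fastforce
  have e: "ennreal (enn2real (potential M V x)) = potential M V x" for x using fin[of x] by simp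
  show "bounded ((\<lambda>x. enn2real (potential M V x)) ` UNIV)"
    unfolding bounded_iff
  proof (intro exI[of _ "max 0 C"] ballI)
    fix z assume "z \<in> range (\<lambda>x. enn2real (potential M V x))"
    then obtain x where x: "z = enn2real (potential M V x)" by auto
    have "potential M V x \<le> ennreal (max 0 C)" using C[of x] by (rule order_trans) (auto intro: ennreal_leI)
    then show "norm z \<le> max 0 C" unfolding x by (simp add: enn2real_leI)
  qed
  fix x a assume a: "a < enn2real (potential M V x)"
  show "\<forall>\<^sub>F y in at x. a < enn2real (potential M V y)"
  proof (cases "a < 0")
    case True
    then show ?thesis by (intro always_eventually allI) (auto intro: less_le_trans)
  next
    case False
    then have "ennreal a < potential M V x" using a by (subst e[symmetric], subst ennreal_less_iff) auto
    from potential_lsc[OF this] have "\<forall>\<^sub>F y in at x. ennreal a < potential M V y"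
      by (auto simp: eventually_at_filter elim: eventually_mono)
    then show ?thesis
    proof eventually_elim
      case (elim y)
      then show ?case using False by (subst (asm) e[symmetric], subst (asm) ennreal_less_iff) auto
    qed
  qed
next
  have fin: "potential M V x < top" for x using C[of x] le_less_trans by fastforce
  have e: "ennreal (enn2real (potential M V x)) = potential M V x" for x using fin[of x] by simp
  fix x r assume r: "0 < (r::real)"
  have "(LINT u|unit_ball_dist. enn2real (potential M V (x + r *\<^sub>R u)))
      = enn2real (\<integral>\<^sup>+u. potential M V (x + r *\<^sub>R u) \<partial>unit_ball_dist)"
    by (subst integral_eq_nn_integral) (auto simp: e)
  also have "\<dots> \<le> enn2real (potential M V x)"
    using potential_mean_le[of r x] r fin by (intro enn2real_mono) auto
  finally show "(LINT u|unit_ball_dist. enn2real (potential M V (x + r *\<^sub>R u))) \<le> enn2real (potential M V x)" .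
qed measurable

end

section \<open>Sweeping point masses, and symmetry of the exit potential\<close>

context bounded_open_set
begin

lemma newton_step_le: "(\<integral>\<^sup>+u. newton (x - (y + rho y *\<^sub>R u)) \<partial>unit_ball_dist) \<le> newton (x - y)"
  unfolding newton_mean_shift newton_mean_def by (rule newton_mean_le[OF dim]) simp

lemma newton_step_eq: "rho y < norm (x - y) \<Longrightarrow> (\<integral>\<^sup>+u. newton (x - (y + rho y *\<^sub>R u)) \<partial>unit_ball_dist) = newton (x - y)"
  unfolding newton_mean_shift newton_mean_def by (rule newton_mean_eq[OF dim]) simp

text \<open>
  The potential at \<open>x\<close> of the unit mass at \<open>y\<close> after it has been spread by \<open>k\<close> steps of the walk.
\<close>

definition swept :: "nat \<Rightarrow> 'a \<Rightarrow> 'a \<Rightarrow> ennreal" where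
  "swept k x y = potential paths (walk k y) x"

lemma swept_eq: "swept k x y = walk_mean k (\<lambda>w. newton (x - w)) y"
  by (simp add: swept_def potential_def walk_mean_def)

lemma sigma_finite_paths: "sigma_finite_measure (paths :: (nat \<Rightarrow> 'a) measure)"
  by unfold_locales

lemma potential_source_walk: "potential_source (paths :: (nat \<Rightarrow> 'a) measure) (walk k y)"
  unfolding potential_source_def potential_source_axioms_def
  by (intro conjI sigma_finite_paths dim) measurable

lemma swept_measurable [measurable (raw)]:
  "f \<in> borel_measurable M \<Longrightarrow> g \<in> borel_measurable M \<Longrightarrow> (\<lambda>z. swept k (f z) (g z)) \<in> borel_measurable M"
proof -
  assume [measurable]: "f \<in> borel_measurable M" "g \<in> borel_measurable M"
  show "(\<lambda>z. swept k (f z) (g z)) \<in> borel_measurable M"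
    unfolding swept_def potential_def by measurable
qed

lemma swept_Suc: "swept (Suc k) x y = walk_mean k (\<lambda>w. newton_mean (rho w) (x - w)) y"
  unfolding swept_eq by (subst walk_mean_Suc') (auto simp: newton_mean_shift)

lemma swept_Suc_le: "swept (Suc k) x y \<le> swept k x y"
  unfolding swept_Suc unfolding swept_eq
  by (intro walk_mean_mono) (use newton_step_le[of x] in \<open>simp add: newton_mean_shift\<close>)

lemma decseq_swept: "decseq (\<lambda>k. swept k x y)"
  by (rule decseq_SucI) (rule swept_Suc_le)

lemma swept_from_outside: "y \<notin> \<Omega> \<Longrightarrow> swept k x y = newton (x - y)"
  by (simp add: swept_def potential_def walk_outside paths.emeasure_space_1)

text \<open>
  A step of the walk replaces a point mass by a uniform ball inside \<open>\<Omega>\<close>, and seen from outside the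
  ball the potential is the same.
\<close>

lemma swept_outside: "x \<notin> \<Omega> \<Longrightarrow> swept k x y = newton (x - y)"
proof (induction k)
  case (Suc k)
  show ?case
  proof (cases "y \<in> \<Omega>")
    case True
    have "swept (Suc k) x y = swept k x y"
      unfolding swept_Suc unfolding swept_eq
    proof (rule walk_mean_cong_in[OF True])
      fix w assume "w \<in> \<Omega>"
      then have "rho w < norm (x - w)" using rho_less_dist[of w x] Suc.prems by (simp add: dist_norm norm_minus_commute)
      then show "newton_mean (rho w) (x - w) = newton (x - w)" by (metis newton_step_eq newton_mean_shift)
    qed
    then show ?thesis using Suc by simp
  next
    case False
    then show ?thesis by (rule swept_from_outside)
  qed
qed (simp add: swept_eq)

definition exit_potential :: "'a \<Rightarrow> 'a \<Rightarrow> ennreal" where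
  "exit_potential x y = potential paths (exit_point y) x"

lemma potential_source_exit: "y \<in> \<Omega> \<Longrightarrow> potential_source (paths :: (nat \<Rightarrow> 'a) measure) (exit_point y)"
  unfolding potential_source_def potential_source_axioms_def
  by (intro conjI sigma_finite_paths dim exit_point_measurable)

text \<open>
  After one averaging step the kernel with pole \<open>x \<in> \<Omega>\<close> is bounded: points near \<open>x\<close> have radii
  bounded below, and at the other points the kernel itself is bounded.
\<close>

lemma swept_step_bounded:
  assumes x: "x \<in> \<Omega>"
  shows "\<exists>C. \<forall>w. newton_mean (rho w) (x - w) \<le> ennreal C"
proof -
  define \<delta> where "\<delta> = infdist x (- \<Omega>)"
  have \<delta>: "\<delta> > 0" using rho_pos[OF x] by (simp add: rho_def \<delta>_def)
  from newton_mean_bounded[OF dim, of "\<delta> / 4"] \<delta> obtain C where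
    C: "C \<ge> 0" "\<And>z::'a. newton_mean (\<delta> / 4) z \<le> ennreal C" unfolding newton_mean_def by auto
  show ?thesis
  proof (intro exI[of _ "max C ((\<delta> / 2) powr (2 - real DIM('a)))"] allI)
    fix w
    show "newton_mean (rho w) (x - w) \<le> ennreal (max C ((\<delta> / 2) powr (2 - real DIM('a))))"
    proof (cases "norm (x - w) \<ge> \<delta> / 2")
      case True
      have "newton_mean (rho w) (x - w) \<le> newton (x - w)"
        unfolding newton_mean_def by (rule newton_mean_le[OF dim]) simp
      also have "\<dots> \<le> ennreal ((\<delta> / 2) powr (2 - real DIM('a)))"
        using True \<delta> dim by (auto simp: newton_def intro!: ennreal_leI powr_mono2')
      finally show ?thesis by (rule order_trans) (auto intro: ennreal_leI)
    next
      case False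
      have "\<delta> \<le> infdist w (- \<Omega>) + dist x w" unfolding \<delta>_def by (rule infdist_triangle)
      then have "\<delta> / 4 \<le> rho w" using False by (simp add: rho_def dist_norm)
      then have "newton_mean (rho w) (x - w) \<le> newton_mean (\<delta> / 4) (x - w)"
        unfolding newton_mean_def using \<delta> by (intro newton_mean_antimono[OF dim]) auto
      also have "\<dots> \<le> ennreal C" by (rule C)
      finally show ?thesis by (rule order_trans) (auto intro: ennreal_leI)
    qed
  qed
qed

text \<open>
  One step is used to make the kernel bounded and still equal to \<open>K(x - \<cdot>)\<close> near the boundary, so
  that dominated convergence applies along the subsequence defining the exit point. Monotonicity
  in \<open>k\<close> then covers the whole sequence.
\<close>

lemma swept_tendsto:
  assumes x: "x \<in> \<Omega>" and y: "y \<in> \<Omega>"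
  shows "(\<lambda>k. swept k x y) \<longlonglongrightarrow> exit_potential x y"
proof -
  from swept_step_bounded[OF x] obtain C where C: "\<And>w. newton_mean (rho w) (x - w) \<le> ennreal C" by blast
  from exit_point_spec(1)[OF y] obtain r where r: "strict_mono r"
    "AE \<omega> in paths. (\<lambda>i. walk (r i) y \<omega>) \<longlonglongrightarrow> exit_point y \<omega>" by blast
  note [measurable] = exit_point_measurable[OF y]
  have [measurable]: "(\<lambda>w. newton_mean (rho w) (x - w)) \<in> borel_measurable borel"
    unfolding newton_mean_def by measurable
  have "(\<lambda>i. \<integral>\<^sup>+\<omega>. newton_mean (rho (walk (r i) y \<omega>)) (x - walk (r i) y \<omega>) \<partial>paths)
      \<longlonglongrightarrow> (\<integral>\<^sup>+\<omega>. newton (x - exit_point y \<omega>) \<partial>paths)"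
  proof (rule nn_integral_dominated_convergence[where w="\<lambda>_. ennreal C"])
    show "(\<integral>\<^sup>+\<omega>. ennreal C \<partial>(paths :: (nat \<Rightarrow> 'a) measure)) < \<infinity>" by (simp add: paths.emeasure_space_1)
    show "AE \<omega> in paths. newton_mean (rho (walk (r i) y \<omega>)) (x - walk (r i) y \<omega>) \<le> ennreal C" for i
      using C by simp
    show "AE \<omega> in paths. (\<lambda>i. newton_mean (rho (walk (r i) y \<omega>)) (x - walk (r i) y \<omega>)) \<longlonglongrightarrow> newton (x - exit_point y \<omega>)"
      using r(2)
    proof eventually_elim
      case (elim \<omega>)
      let ?Y = "exit_point y \<omega>"
      have Y: "?Y \<notin> \<Omega>" using exit_point_in[OF y, of \<omega>] open_\<Omega> by (simp add: frontier_def interior_open)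
      then have ne: "x - ?Y \<noteq> 0" using x by auto
      have "(\<lambda>i. norm (x - walk (r i) y \<omega>) - rho (walk (r i) y \<omega>)) \<longlonglongrightarrow> norm (x - ?Y) - rho ?Y"
        using continuous_on_tendsto_compose[OF continuous_on_rho[OF continuous_on_id, of UNIV] elim]
        by (intro tendsto_intros elim) auto
      moreover have "norm (x - ?Y) - rho ?Y > 0" using ne Y rho_eq_0_iff[of ?Y] by simp
      ultimately have "\<forall>\<^sub>F i in sequentially. norm (x - walk (r i) y \<omega>) - rho (walk (r i) y \<omega>) > 0"
        by (rule order_tendstoD)
      then have "\<forall>\<^sub>F i in sequentially. newton (x - walk (r i) y \<omega>) = newton_mean (rho (walk (r i) y \<omega>)) (x - walk (r i) y \<omega>)"
        by eventually_elim (metis newton_step_eq newton_mean_shift diff_gt_0_iff_gt)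
      moreover have "(\<lambda>i. newton (x - walk (r i) y \<omega>)) \<longlonglongrightarrow> newton (x - ?Y)"
        by (rule newton_tendsto[OF _ ne]) (intro tendsto_intros elim)
      ultimately show ?case by (rule Lim_transform_eventually[rotated])
    qed
  qed measurable
  then have "(\<lambda>i. swept (Suc (r i)) x y) \<longlonglongrightarrow> exit_potential x y"
    by (simp add: swept_Suc walk_mean_def exit_potential_def potential_def)
  moreover have "strict_mono (\<lambda>i. Suc (r i))" using r(1) by (simp add: strict_mono_def)
  moreover have L: "(\<lambda>k. swept k x y) \<longlonglongrightarrow> (INF k. swept k x y)" by (rule LIMSEQ_INF[OF decseq_swept])
  ultimately have "exit_potential x y = (INF k. swept k x y)"
    using LIMSEQ_subseq_LIMSEQ[OF L, of "\<lambda>i. Suc (r i)"] LIMSEQ_unique by (auto simp: comp_def)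
  then show ?thesis using L by simp
qed

lemma exit_potential_eq_INF: "x \<in> \<Omega> \<Longrightarrow> y \<in> \<Omega> \<Longrightarrow> exit_potential x y = (INF k. swept k x y)"
  using LIMSEQ_unique[OF swept_tendsto LIMSEQ_INF[OF decseq_swept]] by blast

lemma swept_boundary: "\<xi> \<in> frontier \<Omega> \<Longrightarrow> newton (\<xi> - y) \<le> Liminf (at \<xi> within \<Omega>) (\<lambda>x. swept k x y)"
proof -
  assume "\<xi> \<in> frontier \<Omega>"
  then have "\<xi> \<notin> \<Omega>" using open_\<Omega> by (simp add: frontier_def interior_open)
  then have e: "newton (\<xi> - y) = swept k \<xi> y" by (simp add: swept_outside)
  show ?thesis unfolding e le_Liminf_iff
  proof (intro allI impI)
    fix a assume "a < swept k \<xi> y"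
    then have "\<forall>\<^sub>F x in nhds \<xi>. a < swept k x y" unfolding swept_def
      by (rule potential_source.potential_lsc[OF potential_source_walk])
    then show "\<forall>\<^sub>F x in at \<xi> within \<Omega>. a < swept k x y"
      by (auto simp: eventually_at_filter elim: eventually_mono)
  qed
qed

text \<open>
  As a function of \<open>x\<close>, the swept potential has the super-mean-value property and lies above \<open>K(\<cdot>
  - y)\<close> at the boundary. By \<open>exit_integral_le\<close> it dominates the integral of \<open>K(\<cdot> - y)\<close> against the
  exit law from \<open>x\<close>, which is \<open>exit_potential y x\<close>. Let \<open>k\<close> tend to infinity.
\<close>

lemma exit_potential_commute_le:
  assumes x: "x \<in> \<Omega>" and y: "y \<in> \<Omega>"
  shows "exit_potential y x \<le> exit_potential x y"
proof -
  have "exit_potential y x \<le> swept k x y" for k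
  proof -
    have "exit_potential y x = (\<integral>\<^sup>+\<omega>. newton (exit_point x \<omega> - y) \<partial>paths)"
      unfolding exit_potential_def potential_def by (simp add: newton_minus_commute[of y])
    also have "\<dots> \<le> swept k x y"
    proof (rule exit_integral_le[OF x, where H="\<lambda>x. swept k x y" and \<phi>="\<lambda>\<xi>. newton (\<xi> - y)"])
      show "(\<integral>\<^sup>+u. swept k (w + rho w *\<^sub>R u) y \<partial>unit_ball_dist) \<le> swept k w y" for w
        unfolding swept_def by (rule potential_source.potential_mean_le[OF potential_source_walk]) simp
    qed (auto intro: swept_boundary)
    finally show ?thesis .
  qed
  then show ?thesis unfolding exit_potential_eq_INF[OF x y] by (intro INF_greatest)
qed

theorem exit_potential_commute: "x \<in> \<Omega> \<Longrightarrow> y \<in> \<Omega> \<Longrightarrow> exit_potential x y = exit_potential y x"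
  by (intro antisym exit_potential_commute_le)

end

section \<open>Potentials of bounded densities\<close>

text \<open>
  Indicators of balls with converging centres converge off a sphere, which is a null set.
\<close>

lemma ball_average_tendsto:
  fixes w :: "'a::euclidean_space \<Rightarrow> ennreal"
  assumes [measurable]: "w \<in> borel_measurable borel" and r: "r > 0"
    and fin: "(\<integral>\<^sup>+u. w (x + (r + 1) *\<^sub>R u) \<partial>unit_ball_dist) < top" and y: "y \<longlonglongrightarrow> x"
  shows "(\<lambda>n. \<integral>\<^sup>+u. w (y n + r *\<^sub>R u) \<partial>unit_ball_dist) \<longlonglongrightarrow> (\<integral>\<^sup>+u. w (x + r *\<^sub>R u) \<partial>unit_ball_dist)"
proof -
  have [measurable]: "cball z s \<in> sets borel" for z :: 'a and s by simp
  define I where "I z = (\<integral>\<^sup>+t. indicator (cball z r) t * w t \<partial>lborel)" for z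
  have rr: "r \<noteq> 0" "r + 1 \<noteq> 0" "\<bar>r\<bar> = r" "\<bar>r + 1\<bar> = r + 1" using r by auto
  have avg: "(\<integral>\<^sup>+u. w (z + r *\<^sub>R u) \<partial>unit_ball_dist) = I z * inverse (emeasure lborel (cball (0::'a) r))" for z
    using nn_integral_unit_ball_affine[of w r z] rr
    by (simp add: I_def divide_ennreal_def emeasure_cball_center[of z])
  have fin': "(\<integral>\<^sup>+t. indicator (cball x (r + 1)) t * w t \<partial>lborel) < top"
  proof -
    have e: "emeasure lborel (cball x (r + 1)) \<noteq> 0" "emeasure lborel (cball x (r + 1)) \<noteq> top"
      using cball_emeasure[of "r + 1" x] r by auto
    have "(\<integral>\<^sup>+t. indicator (cball x (r + 1)) t * w t \<partial>lborel)
       = (\<integral>\<^sup>+u. w (x + (r + 1) *\<^sub>R u) \<partial>unit_ball_dist) * emeasure lborel (cball x (r + 1))"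
      using nn_integral_unit_ball_affine[of w "r + 1" x] rr ennreal_divide_mult_cancel[OF e] by simp
    also have "\<dots> < top" using fin e by (simp add: ennreal_mult_less_top top.not_eq_extremum)
    finally show ?thesis .
  qed
  have "\<forall>\<^sub>F n in sequentially. dist (y n) x < 1" using y by (rule tendstoD) simp
  then obtain N where N: "\<And>n. n \<ge> N \<Longrightarrow> dist (y n) x < 1" by (auto simp: eventually_sequentially)
  have "(\<lambda>n. I (y (n + N))) \<longlonglongrightarrow> I x"
    unfolding I_def
  proof (rule nn_integral_dominated_convergence[where w="\<lambda>t. indicator (cball x (r + 1)) t * w t"])
    show "AE t in lborel. indicator (cball (y (n + N)) r) t * w t \<le> indicator (cball x (r + 1)) t * w t" for n
    proof (intro AE_I2 mult_right_mono)
      fix t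
      have "dist x t \<le> dist (y (n + N)) x + dist (y (n + N)) t" by (metis dist_commute dist_triangle)
      then show "indicator (cball (y (n + N)) r) t \<le> (indicator (cball x (r + 1)) t :: ennreal)"
        using N[of "n + N"] by (auto simp: indicator_def)
    qed simp
    show "AE t in lborel. (\<lambda>n. indicator (cball (y (n + N)) r) t * w t) \<longlonglongrightarrow> indicator (cball x r) t * w t"
      using AE_not_sphere[of x r]
    proof eventually_elim
      case (elim t)
      have lim: "(\<lambda>n. dist (y (n + N)) t) \<longlonglongrightarrow> dist x t"
        by (intro tendsto_intros LIMSEQ_ignore_initial_segment[OF y])
      have "\<forall>\<^sub>F n in sequentially. indicator (cball x r) t * w t = indicator (cball (y (n + N)) r) t * w t"
      proof (cases "dist x t < r")
        case True
        from order_tendstoD(2)[OF lim True] show ?thesis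
          by eventually_elim (use True in simp)
      next
        case False
        then have "dist x t > r" using elim by simp
        from order_tendstoD(1)[OF lim this] show ?thesis
          by eventually_elim (use False elim in simp)
      qed
      then show ?case by (rule Lim_transform_eventually[OF tendsto_const])
    qed
  qed (use fin' in auto)
  then have "(I \<circ> y) \<longlonglongrightarrow> I x" unfolding comp_def by (rule LIMSEQ_offset)
  moreover have "inverse (emeasure lborel (cball (0::'a) r)) \<noteq> top"
    using cball_emeasure[OF r, of "0::'a"] by (auto simp: ennreal_inverse_eq_top_iff)
  moreover have "inverse (emeasure lborel (cball (0::'a) r)) \<noteq> 0"
    using cball_emeasure[OF r, of "0::'a"] by auto
  ultimately show ?thesis unfolding avg comp_def
    by (intro tendsto_mult_ennreal tendsto_const) auto
qed

definition density_potential :: "('a::euclidean_space \<Rightarrow> ennreal) \<Rightarrow> 'a \<Rightarrow> ennreal" where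
  "density_potential g = potential (density lborel g) (\<lambda>z. z)"

definition bounded_density :: "real \<Rightarrow> real \<Rightarrow> ('a::euclidean_space \<Rightarrow> ennreal) \<Rightarrow> bool" where
  "bounded_density B R g \<longleftrightarrow> B \<ge> 0 \<and> R > 0 \<and> g \<in> borel_measurable borel \<and> (\<forall>z. g z \<le> ennreal B * indicator (cball 0 R) z)"

lemma bounded_density_measurable: "bounded_density B R g \<Longrightarrow> g \<in> borel_measurable borel"
  by (simp add: bounded_density_def)

lemma bounded_density_finite_measure:
  fixes g :: "'a::euclidean_space \<Rightarrow> ennreal"
  assumes g: "bounded_density B R g"
  shows "finite_measure (density lborel g)"
proof
  note [measurable] = bounded_density_measurable[OF g]
  have R: "R > 0" using g by (simp add: bounded_density_def)
  have "emeasure (density lborel g) (space (density lborel g)) = (\<integral>\<^sup>+z. g z \<partial>lborel)"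
    by (simp add: emeasure_density)
  also have "\<dots> \<le> (\<integral>\<^sup>+z. ennreal B * indicator (cball 0 R) z \<partial>(lborel :: 'a measure))"
    using g by (intro nn_integral_mono) (auto simp: bounded_density_def)
  also have "\<dots> = ennreal B * emeasure lborel (cball (0::'a) R)" by (rule nn_integral_cmult_indicator) simp
  also have "\<dots> < top" using cball_emeasure[OF R, of "0::'a"] by (simp add: ennreal_mult_less_top)
  finally show "emeasure (density lborel g) (space (density lborel g)) \<noteq> \<infinity>" by simp
qed

lemma density_potential_eq:
  assumes [measurable]: "g \<in> borel_measurable borel"
  shows "density_potential g x = (\<integral>\<^sup>+z. g z * newton (x - z) \<partial>lborel)"
  unfolding density_potential_def potential_def by (subst nn_integral_density) auto

lemma potential_source_density:
  fixes g :: "'a::euclidean_space \<Rightarrow> ennreal"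
  assumes d: "DIM('a) \<ge> 3" and g: "bounded_density B R g"
  shows "potential_source (density lborel g) (\<lambda>z. z)"
proof -
  interpret finite_measure "density lborel g" by (rule bounded_density_finite_measure[OF g])
  show ?thesis unfolding potential_source_def potential_source_axioms_def
    using d by (auto intro: sigma_finite_measure_axioms)
qed

lemma density_potential_ball:
  fixes x :: "'a::euclidean_space"
  assumes R: "R > 0"
  shows "density_potential (\<lambda>z. ennreal B * indicator (cball 0 R) z) x
    = ennreal B * emeasure lborel (cball (0::'a) R) * newton_mean R x"
proof -
  have [measurable]: "cball (0::'a) R \<in> sets borel" by simp
  have e: "emeasure lborel (cball (0::'a) R) \<noteq> 0" "emeasure lborel (cball (0::'a) R) \<noteq> top"
    using cball_emeasure[OF R, of "0::'a"] by auto
  have "newton_mean R x = (\<integral>\<^sup>+u. newton (x - (0 + R *\<^sub>R u)) \<partial>unit_ball_dist)"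
    by (subst newton_mean_shift) simp
  also have "\<dots> = (\<integral>\<^sup>+z. indicator (cball 0 R) z * newton (x - z) \<partial>lborel) / emeasure lborel (cball (0::'a) R)"
    using nn_integral_unit_ball_affine[of "\<lambda>z. newton (x - z)" R 0] R by simp
  finally have "newton_mean R x * emeasure lborel (cball (0::'a) R) = (\<integral>\<^sup>+z. indicator (cball 0 R) z * newton (x - z) \<partial>lborel)"
    using ennreal_divide_mult_cancel[OF e] by simp
  moreover have "density_potential (\<lambda>z. ennreal B * indicator (cball 0 R) z) x
      = (\<integral>\<^sup>+z. ennreal B * (indicator (cball 0 R) z * newton (x - z)) \<partial>lborel)"
    by (subst density_potential_eq) (auto simp: mult.assoc)
  moreover have "\<dots> = ennreal B * (\<integral>\<^sup>+z. indicator (cball 0 R) z * newton (x - z) \<partial>lborel)"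
    by (rule nn_integral_cmult) measurable
  ultimately show ?thesis by (simp only: mult_ac)
qed

lemma density_potential_bounded:
  fixes g :: "'a::euclidean_space \<Rightarrow> ennreal"
  assumes d: "DIM('a) \<ge> 3" and g: "bounded_density B R g"
  shows "\<exists>C\<ge>0. \<forall>x. density_potential g x \<le> ennreal C"
proof -
  note [measurable] = bounded_density_measurable[OF g]
  have [measurable]: "cball (0::'a) R \<in> sets borel" by simp
  have R: "R > 0" and B: "B \<ge> 0" using g by (simp_all add: bounded_density_def)
  from newton_mean_bounded[OF d R] obtain C where C: "C \<ge> 0" "\<And>x::'a. newton_mean R x \<le> ennreal C"
    unfolding newton_mean_def by blast
  have "density_potential g x \<le> ennreal (B * measure lborel (cball (0::'a) R) * C)" for x
  proof -
    have "density_potential g x \<le> density_potential (\<lambda>z. ennreal B * indicator (cball 0 R) z) x"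
      by (subst (1 2) density_potential_eq)
         (use g in \<open>auto intro!: nn_integral_mono mult_right_mono simp: bounded_density_def\<close>)
    also have "\<dots> \<le> ennreal B * emeasure lborel (cball (0::'a) R) * ennreal C"
      unfolding density_potential_ball[OF R] by (intro mult_left_mono C) auto
    also have "\<dots> = ennreal (B * measure lborel (cball (0::'a) R) * C)"
      using B C cball_emeasure[OF R, of "0::'a"] by (simp add: ennreal_mult)
    finally show ?thesis .
  qed
  then show ?thesis using B C by (intro exI[of _ "B * measure lborel (cball (0::'a) R) * C"]) auto
qed

text \<open>
  The constant density \<open>B\<close> on the ball has a continuous potential, namely a multiple of a ball
  mean of \<open>K\<close>. It is the sum of the potentials of \<open>g\<close> and of the complementary density, and both
  are lower semicontinuous. Hence both are continuous.
\<close>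

lemma continuous_on_density_potential:
  fixes g :: "'a::euclidean_space \<Rightarrow> ennreal"
  assumes d: "DIM('a) \<ge> 3" and g: "bounded_density B R g"
  shows "continuous_on A (\<lambda>x. enn2real (density_potential g x))"
proof (rule continuous_on_subset[of UNIV], unfold continuous_on_sequentially, intro ballI allI impI)
  fix y and x :: 'a assume y: "(\<forall>n. y n \<in> UNIV) \<and> y \<longlonglongrightarrow> x"
  note [measurable] = bounded_density_measurable[OF g]
  have [measurable]: "cball (0::'a) R \<in> sets borel" by simp
  have R: "R > 0" and B: "B \<ge> 0" using g by (simp_all add: bounded_density_def)
  define q where "q z = ennreal B * indicator (cball 0 R) z" for z :: 'a
  define g2 where "g2 z = q z - g z" for z
  have [measurable]: "q \<in> borel_measurable borel" unfolding q_def by measurable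
  have q: "bounded_density B R q" using R B by (auto simp: bounded_density_def q_def)
  have [measurable]: "g2 \<in> borel_measurable borel" unfolding g2_def by measurable
  have "g2 z \<le> ennreal B * indicator (cball 0 R) z" for z unfolding g2_def q_def by (rule diff_le_self_ennreal)
  then have g2: "bounded_density B R g2" using R B by (simp add: bounded_density_def)
  note [measurable] = bounded_density_measurable[OF q] bounded_density_measurable[OF g2]
  have gq: "q z = g z + g2 z" for z using g by (simp add: bounded_density_def q_def g2_def add_diff_inverse_ennreal)
  have fin: "density_potential f x = ennreal (enn2real (density_potential f x))" if "bounded_density B R f" for f and x :: 'a
    using density_potential_bounded[OF d that] by (auto simp: top.not_eq_extremum intro!: ennreal_enn2real[symmetric] intro: le_less_trans)
  have sum: "enn2real (density_potential q x) = enn2real (density_potential g x) + enn2real (density_potential g2 x)" for x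
  proof -
    have "density_potential q x = density_potential g x + density_potential g2 x"
      by (subst (1 2 3) density_potential_eq) (auto simp: gq distrib_right nn_integral_add)
    then show ?thesis by (subst (asm) fin[OF g], subst (asm) fin[OF g2]) (simp add: enn2real_plus)
  qed
  have lsc: "\<forall>\<^sub>F n in sequentially. a < enn2real (density_potential f (y n))"
    if f: "bounded_density B R f" and a: "a < enn2real (density_potential f x)" for f a
  proof (cases "a < 0")
    case True
    then show ?thesis by (intro always_eventually allI) (auto intro: less_le_trans)
  next
    case False
    then have "ennreal a < density_potential f x" using a by (subst fin[OF f], subst ennreal_less_iff) auto
    then have "\<forall>\<^sub>F z in nhds x. ennreal a < density_potential f z"
      unfolding density_potential_def by (rule potential_source.potential_lsc[OF potential_source_density[OF d f]])
    then have "\<forall>\<^sub>F n in sequentially. ennreal a < density_potential f (y n)"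
      using y by (auto intro: eventually_compose_filterlim)
    then show ?thesis
    proof eventually_elim
      case (elim n)
      then show ?case using False by (subst (asm) fin[OF f], subst (asm) ennreal_less_iff) auto
    qed
  qed
  have qlim: "(\<lambda>n. enn2real (density_potential q (y n))) \<longlonglongrightarrow> enn2real (density_potential q x)"
  proof -
    have "newton_mean (R + 1) x < top"
      using newton_mean_bounded[OF d, of "R + 1"] R unfolding newton_mean_def by (auto intro: le_less_trans)
    then have "(\<lambda>n. newton_mean R (y n)) \<longlonglongrightarrow> newton_mean R x"
      unfolding newton_mean_def using y R by (intro ball_average_tendsto) auto
    moreover have "ennreal B * emeasure lborel (cball (0::'a) R) < top"
      using cball_emeasure[OF R, of "0::'a"] by (simp add: ennreal_mult_less_top)
    ultimately have "(\<lambda>n. density_potential q (y n)) \<longlonglongrightarrow> density_potential q x"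
      unfolding q_def density_potential_ball[OF R] by (intro ennreal_tendsto_cmult)
    moreover have "density_potential q x \<noteq> top" by (subst fin[OF q]) simp
    ultimately show ?thesis by (intro tendsto_enn2real) (simp_all add: top.not_eq_extremum)
  qed
  show "((\<lambda>x. enn2real (density_potential g x)) \<circ> y) \<longlonglongrightarrow> enn2real (density_potential g x)"
    unfolding comp_def
  proof (rule order_tendstoI)
    fix a assume "a < enn2real (density_potential g x)"
    then show "\<forall>\<^sub>F n in sequentially. a < enn2real (density_potential g (y n))" by (rule lsc[OF g])
  next
    fix a assume a: "enn2real (density_potential g x) < a"
    define e where "e = (a - enn2real (density_potential g x)) / 2"
    have e: "e > 0" using a by (simp add: e_def)
    have "\<forall>\<^sub>F n in sequentially. enn2real (density_potential q (y n)) < enn2real (density_potential q x) + e"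
      using qlim e by (intro order_tendstoD) auto
    moreover have "\<forall>\<^sub>F n in sequentially. enn2real (density_potential g2 x) - e < enn2real (density_potential g2 (y n))"
      using e by (intro lsc[OF g2]) auto
    ultimately show "\<forall>\<^sub>F n in sequentially. enn2real (density_potential g (y n)) < a"
      by eventually_elim (simp add: sum e_def field_simps)
  qed
qed simp

locale bounded_density_source = bounded_open_set \<Omega> for \<Omega> :: "'a::euclidean_space set" +
  fixes g :: "'a \<Rightarrow> ennreal" and B R :: real
  assumes g: "bounded_density B R g"
begin

abbreviation "source \<equiv> density lborel g"

lemma g_measurable [measurable]: "g \<in> borel_measurable borel"
  by (rule bounded_density_measurable[OF g])

sublocale src: finite_measure source
  by (rule bounded_density_finite_measure[OF g])

lemma density_potential_source: "density_potential g x = (\<integral>\<^sup>+z. newton (x - z) \<partial>source)"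
  by (simp add: density_potential_def potential_def)

lemma density_potential_measurable [measurable]: "density_potential g \<in> borel_measurable borel"
  unfolding density_potential_def by (rule potential_source.potential_measurable[OF potential_source_density[OF dim g]])

lemma ennreal_density_potential: "ennreal (enn2real (density_potential g x)) = density_potential g x"
  using density_potential_bounded[OF dim g] by (auto simp: top.not_eq_extremum intro!: ennreal_enn2real intro: le_less_trans)

text \<open>
  The potential of the mass distribution \<open>g\<close> after each of its points has performed \<open>k\<close> steps of
  the walk.
\<close>

definition swept_potential :: "nat \<Rightarrow> 'a \<Rightarrow> ennreal" where
  "swept_potential k = potential (source \<Otimes>\<^sub>M paths) (\<lambda>p. walk k (fst p) (snd p))"

lemma potential_source_swept: "potential_source (source \<Otimes>\<^sub>M (paths :: (nat \<Rightarrow> 'a) measure)) (\<lambda>p. walk k (fst p) (snd p))"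
proof -
  interpret P: pair_sigma_finite source "paths :: (nat \<Rightarrow> 'a) measure" ..
  show ?thesis
    unfolding potential_source_def potential_source_axioms_def
    by (intro conjI P.sigma_finite_measure_axioms dim) measurable
qed

lemma swept_potential_eq: "swept_potential k x = (\<integral>\<^sup>+z. swept k x z \<partial>source)"
  unfolding swept_potential_def swept_def potential_def
  by (subst paths.nn_integral_fst[symmetric]) auto

lemma swept_potential_0: "swept_potential 0 x = density_potential g x"
  by (simp add: swept_potential_eq swept_eq density_potential_source)

lemma swept_potential_outside: "x \<notin> \<Omega> \<Longrightarrow> swept_potential k x = density_potential g x"
  by (simp add: swept_potential_eq swept_outside density_potential_source)

lemma swept_potential_le: "swept_potential k x \<le> density_potential g x"
  unfolding swept_potential_0[symmetric] unfolding swept_potential_eq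
  by (intro nn_integral_mono) (use decseq_swept in \<open>auto simp: decseq_def\<close>)

text \<open>
  Inside \<open>\<Omega>\<close> this is \<open>exit_potential\<close>. As a countable infimum it is jointly measurable, which is
  not evident for the arbitrarily chosen exit points.
\<close>

definition limit_kernel :: "'a \<Rightarrow> 'a \<Rightarrow> ennreal" where
  "limit_kernel x z = (INF k. swept k x z)"

lemma limit_kernel_measurable [measurable (raw)]:
  "f \<in> borel_measurable M \<Longrightarrow> h \<in> borel_measurable M \<Longrightarrow> (\<lambda>z. limit_kernel (f z) (h z)) \<in> borel_measurable M"
proof -
  assume [measurable]: "f \<in> borel_measurable M" "h \<in> borel_measurable M"
  show "(\<lambda>z. limit_kernel (f z) (h z)) \<in> borel_measurable M"
    unfolding limit_kernel_def by measurable
qed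

lemma limit_kernel_inside: "x \<in> \<Omega> \<Longrightarrow> z \<in> \<Omega> \<Longrightarrow> limit_kernel x z = exit_potential x z"
  by (simp add: limit_kernel_def exit_potential_eq_INF)

lemma limit_kernel_outside: "z \<notin> \<Omega> \<Longrightarrow> limit_kernel x z = newton (x - z)"
  by (simp add: limit_kernel_def swept_from_outside)

definition limit_potential :: "'a \<Rightarrow> ennreal" where
  "limit_potential x = (\<integral>\<^sup>+z. limit_kernel x z \<partial>source)"

lemma limit_potential_measurable [measurable]: "limit_potential \<in> borel_measurable borel"
  unfolding limit_potential_def by measurable

lemma limit_potential_le: "limit_potential x \<le> density_potential g x"
  unfolding limit_potential_def density_potential_source limit_kernel_def
  by (intro nn_integral_mono INF_lower2[of 0]) (auto simp: swept_eq)

lemma limit_potential_eq_INF: "limit_potential x = (INF k. swept_potential k x)"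
  unfolding limit_potential_def limit_kernel_def swept_potential_eq
proof (rule nn_integral_monotone_convergence_INF_decseq)
  show "decseq (\<lambda>i. swept i x)" by (intro decseq_SucI le_funI swept_Suc_le)
  show "(\<integral>\<^sup>+z. swept i x z \<partial>source) < \<infinity>" for i
    using swept_potential_le[of i x] ennreal_density_potential[of x] unfolding swept_potential_eq
    by (metis ennreal_less_top infinity_ennreal_def le_less_trans)
qed measurable

lemma swept_potential_tendsto: "(\<lambda>k. swept_potential k x) \<longlonglongrightarrow> limit_potential x"
  unfolding limit_potential_eq_INF
proof (rule LIMSEQ_INF, rule decseq_SucI)
  show "swept_potential (Suc n) x \<le> swept_potential n x" for n
    unfolding swept_potential_eq by (intro nn_integral_mono swept_Suc_le)
qed

text \<open>
  Mass swept out of \<open>\<Omega>\<close> lies outside of every ball in \<open>\<Omega>\<close>, so its potential is harmonic there.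
\<close>

lemma limit_kernel_mean:
  assumes r: "r > 0" "cball x r \<subseteq> \<Omega>"
  shows "(\<integral>\<^sup>+u. limit_kernel (x + r *\<^sub>R u) z \<partial>unit_ball_dist) = limit_kernel x z"
proof -
  have x: "x \<in> \<Omega>" using r by auto
  have out: "r < norm (x - w)" if "w \<notin> \<Omega>" for w using that r by (force simp: dist_norm)
  show ?thesis
  proof (cases "z \<in> \<Omega>")
    case True
    have "(\<integral>\<^sup>+u. limit_kernel (x + r *\<^sub>R u) z \<partial>unit_ball_dist) = (\<integral>\<^sup>+u. exit_potential (x + r *\<^sub>R u) z \<partial>unit_ball_dist)"
    proof (rule nn_integral_cong_AE)
      show "AE u in unit_ball_dist. limit_kernel (x + r *\<^sub>R u) z = exit_potential (x + r *\<^sub>R u) z"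
        using AE_unit_ball_dist
      proof eventually_elim
        case (elim u)
        then have "x + r *\<^sub>R u \<in> \<Omega>" using cball_param[of r u x] r by auto
        then show ?case using True by (rule limit_kernel_inside)
      qed
    qed
    also have "\<dots> = exit_potential x z"
      unfolding exit_potential_def
    proof (rule potential_source.potential_mean_eq[OF potential_source_exit[OF True]])
      show "AE \<omega> in paths. r < norm (x - exit_point z \<omega>)"
        using exit_point_in[OF True] open_\<Omega> by (intro AE_I2 out) (auto simp: frontier_def interior_open)
    qed (use r in simp)
    finally show ?thesis by (simp add: limit_kernel_inside[OF x True])
  next
    case False
    have "(\<integral>\<^sup>+u. limit_kernel (x + r *\<^sub>R u) z \<partial>unit_ball_dist) = newton_mean r (x - z)"
      by (simp add: limit_kernel_outside[OF False] newton_mean_shift')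
    also have "\<dots> = newton (x - z)"
      unfolding newton_mean_def using r out[OF False] by (intro newton_mean_eq[OF dim]) auto
    finally show ?thesis by (simp add: limit_kernel_outside[OF False])
  qed
qed

lemma limit_potential_mean:
  assumes r: "r > 0" "cball x r \<subseteq> \<Omega>"
  shows "(\<integral>\<^sup>+u. limit_potential (x + r *\<^sub>R u) \<partial>unit_ball_dist) = limit_potential x"
proof -
  interpret P: pair_sigma_finite "unit_ball_dist :: 'a measure" source ..
  have "(\<integral>\<^sup>+u. limit_potential (x + r *\<^sub>R u) \<partial>unit_ball_dist)
     = (\<integral>\<^sup>+z. (\<integral>\<^sup>+u. limit_kernel (x + r *\<^sub>R u) z \<partial>unit_ball_dist) \<partial>source)"
    unfolding limit_potential_def by (rule P.Fubini'[symmetric]) measurable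
  then show ?thesis by (simp add: limit_kernel_mean[OF r] limit_potential_def)
qed

lemma ennreal_limit_potential: "ennreal (enn2real (limit_potential x)) = limit_potential x"
  using limit_potential_le[of x] ennreal_density_potential[of x]
  by (metis ennreal_enn2real ennreal_less_top le_less_trans)

text \<open>
  A bounded function that equals its mean over balls of a fixed radius is continuous.
\<close>

lemma limit_potential_tendsto:
  assumes x: "x \<in> \<Omega>" and y: "y \<longlonglongrightarrow> x"
  shows "(\<lambda>n. enn2real (limit_potential (y n))) \<longlonglongrightarrow> enn2real (limit_potential x)"
proof -
  obtain e where e: "e > 0" "cball x e \<subseteq> \<Omega>" using x open_\<Omega> open_contains_cball by blast
  define r where "r = e / 2"
  have r: "r > 0" using e by (simp add: r_def)
  obtain C where C: "C \<ge> 0" "\<And>x. density_potential g x \<le> ennreal C"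
    using density_potential_bounded[OF dim g] by blast
  have "(\<lambda>n. \<integral>\<^sup>+u. limit_potential (y n + r *\<^sub>R u) \<partial>unit_ball_dist) \<longlonglongrightarrow> (\<integral>\<^sup>+u. limit_potential (x + r *\<^sub>R u) \<partial>unit_ball_dist)"
  proof (rule ball_average_tendsto[OF limit_potential_measurable r _ y])
    have "(\<integral>\<^sup>+u. limit_potential (x + (r + 1) *\<^sub>R u) \<partial>unit_ball_dist) \<le> (\<integral>\<^sup>+u. ennreal C \<partial>(unit_ball_dist :: 'a measure))"
      by (intro nn_integral_mono order_trans[OF limit_potential_le C(2)])
    also have "\<dots> < top" by (simp add: ennreal_mult_less_top unit_ball_dist.emeasure_space_1[unfolded space_unit_ball_dist])
    finally show "(\<integral>\<^sup>+u. limit_potential (x + (r + 1) *\<^sub>R u) \<partial>unit_ball_dist) < top" .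
  qed
  moreover have "(\<integral>\<^sup>+u. limit_potential (x + r *\<^sub>R u) \<partial>unit_ball_dist) = limit_potential x"
    using e by (intro limit_potential_mean[OF r]) (auto simp: r_def)
  moreover have "\<forall>\<^sub>F n in sequentially. (\<integral>\<^sup>+u. limit_potential (y n + r *\<^sub>R u) \<partial>unit_ball_dist) = limit_potential (y n)"
    using tendstoD[OF y r]
  proof eventually_elim
    case (elim n)
    show ?case
    proof (rule limit_potential_mean[OF r], rule subsetI)
      fix z assume "z \<in> cball (y n) r"
      then have "dist x z \<le> e" using elim dist_triangle[of x z "y n"] by (simp add: dist_commute r_def)
      then show "z \<in> \<Omega>" using e by auto
    qed
  qed
  ultimately have "(\<lambda>n. limit_potential (y n)) \<longlonglongrightarrow> limit_potential x"
    by (auto intro: Lim_transform_eventually)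
  then show ?thesis by (intro tendsto_enn2real) (simp_all add: ennreal_limit_potential)
qed

lemma real_superharmonic_minus_limit_potential:
  "real_superharmonic \<Omega> (\<lambda>x. - enn2real (limit_potential x))"
  unfolding real_superharmonic_def
proof (intro conjI ballI allI impI)
  obtain C where C: "C \<ge> 0" "\<And>x. density_potential g x \<le> ennreal C"
    using density_potential_bounded[OF dim g] by blast
  have "enn2real (limit_potential x) \<le> C" for x
    using C limit_potential_le[of x] by (intro enn2real_leI) (auto intro: order_trans)
  then show "bounded ((\<lambda>x. - enn2real (limit_potential x)) ` \<Omega>)"
    by (auto simp: bounded_iff intro!: exI[of _ C])
  fix x a assume x: "x \<in> \<Omega>" and a: "a < - enn2real (limit_potential x)"
  show "\<forall>\<^sub>F y in at x within \<Omega>. a < - enn2real (limit_potential y)"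
  proof (rule sequentially_imp_eventually_within, intro allI impI)
    fix y assume "(\<forall>n. y n \<in> \<Omega> \<and> y n \<noteq> x) \<and> y \<longlonglongrightarrow> x"
    then have "(\<lambda>n. - enn2real (limit_potential (y n))) \<longlonglongrightarrow> - enn2real (limit_potential x)"
      by (intro tendsto_minus limit_potential_tendsto x) auto
    then show "\<forall>\<^sub>F n in sequentially. a < - enn2real (limit_potential (y n))" using a by (rule order_tendstoD)
  qed
next
  fix x r assume r: "0 < (r::real)" "cball x r \<subseteq> \<Omega>"
  have "(LINT u|unit_ball_dist. enn2real (limit_potential (x + r *\<^sub>R u)))
      = enn2real (\<integral>\<^sup>+u. limit_potential (x + r *\<^sub>R u) \<partial>unit_ball_dist)"
    by (subst integral_eq_nn_integral) (auto simp: ennreal_limit_potential)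
  also have "\<dots> = enn2real (limit_potential x)" by (simp only: limit_potential_mean[OF r])
  finally show "(LINT u|unit_ball_dist. - enn2real (limit_potential (x + r *\<^sub>R u))) \<le> - enn2real (limit_potential x)" by simp
qed measurable

text \<open>
  A potential of mass outside \<open>\<Omega>\<close> is harmonic in \<open>\<Omega>\<close> and continuous, so it is recovered from its
  boundary values. Applied to \<open>u\<close> and to \<open>C - u\<close>, \<open>exit_integral_le\<close> gives the two inequalities.
  Mass on the boundary is admitted, even if the boundary has positive Lebesgue measure.
\<close>

lemma density_potential_exit_mean:
  assumes x: "x \<in> \<Omega>" and vanish: "\<And>z. z \<in> \<Omega> \<Longrightarrow> g z = 0"
  shows "(\<integral>\<^sup>+\<omega>. density_potential g (exit_point x \<omega>) \<partial>paths) = density_potential g x"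
proof (rule antisym)
  obtain C where C: "C \<ge> 0" "\<And>x. density_potential g x \<le> ennreal C"
    using density_potential_bounded[OF dim g] by blast
  note [measurable] = exit_point_measurable[OF x]
  define u where "u x = enn2real (density_potential g x)" for x
  have u: "ennreal (u x) = density_potential g x" for x by (simp add: u_def ennreal_density_potential)
  have [measurable]: "u \<in> borel_measurable borel" unfolding u_def by measurable
  have u0: "u x \<ge> 0" for x by (simp add: u_def)
  have uC: "u x \<le> C" for x unfolding u_def by (rule enn2real_leI[OF C(1,2)])
  have mean: "(\<integral>\<^sup>+v. density_potential g (y + rho y *\<^sub>R v) \<partial>unit_ball_dist) = density_potential g y" if y: "y \<in> \<Omega>" for y
    unfolding density_potential_def
  proof (rule potential_source.potential_mean_eq[OF potential_source_density[OF dim g]])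
    have "AE z in lborel. g z \<noteq> 0 \<longrightarrow> rho y < norm (y - z)"
    proof (intro AE_I2 impI)
      fix z assume "g z \<noteq> 0"
      then have "z \<notin> \<Omega>" using vanish by blast
      then show "rho y < norm (y - z)" using rho_less_dist[OF y] by (simp add: dist_norm)
    qed
    then show "AE z in source. rho y < norm (y - z)" by (subst AE_density) (auto simp: zero_less_iff_neq_zero)
  qed simp
  have lim: "(u \<longlongrightarrow> u \<xi>) (at \<xi> within \<Omega>)" for \<xi>
    using continuous_on_density_potential[OF dim g, of UNIV]
    unfolding u_def[abs_def] continuous_on_def by (auto intro: tendsto_within_subset)
  have mono: "(\<integral>\<^sup>+\<omega>. ennreal (f (exit_point x \<omega>)) \<partial>paths) \<le> ennreal (f x)"
    if [measurable]: "f \<in> borel_measurable borel" and lim: "\<And>\<xi>. (f \<longlongrightarrow> f \<xi>) (at \<xi> within \<Omega>)"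
      and m: "\<And>y. y \<in> \<Omega> \<Longrightarrow> (\<integral>\<^sup>+v. ennreal (f (y + rho y *\<^sub>R v)) \<partial>unit_ball_dist) \<le> ennreal (f y)" for f
  proof (rule exit_integral_le[OF x, where H="\<lambda>y. ennreal (f y)" and \<phi>="\<lambda>y. ennreal (f y)"])
    fix \<xi> assume "\<xi> \<in> frontier \<Omega>"
    show "ennreal (f \<xi>) \<le> Liminf (at \<xi> within \<Omega>) (\<lambda>y. ennreal (f y))"
      unfolding le_Liminf_iff by (intro allI impI order_tendstoD(1)[OF tendsto_ennrealI[OF lim]])
  qed (use m in auto)
  show "(\<integral>\<^sup>+\<omega>. density_potential g (exit_point x \<omega>) \<partial>paths) \<le> density_potential g x"
    unfolding u[symmetric] by (rule mono[OF _ lim]) (auto simp: u mean)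
  have m: "(\<lambda>\<omega>. ennreal (u (exit_point x \<omega>))) \<in> borel_measurable paths"
    "(\<lambda>\<omega>. ennreal (C - u (exit_point x \<omega>))) \<in> borel_measurable paths"
    by (rule measurable_compose[OF exit_point_measurable[OF x]], measurable)+
  have "(\<integral>\<^sup>+\<omega>. ennreal (C - u (exit_point x \<omega>)) \<partial>paths) \<le> ennreal (C - u x)"
  proof (rule mono[of "\<lambda>y. C - u y"])
    fix y assume y: "y \<in> \<Omega>"
    have fin: "(\<integral>\<^sup>+v. density_potential g (y + rho y *\<^sub>R v) \<partial>unit_ball_dist) \<noteq> top"
      unfolding mean[OF y] by (simp flip: u)
    have "(\<integral>\<^sup>+v. ennreal (C - u (y + rho y *\<^sub>R v)) \<partial>unit_ball_dist)
        = (\<integral>\<^sup>+v. ennreal C - density_potential g (y + rho y *\<^sub>R v) \<partial>unit_ball_dist)"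
      by (intro nn_integral_cong) (simp add: ennreal_minus u0 flip: u)
    also have "\<dots> = (\<integral>\<^sup>+v. ennreal C \<partial>(unit_ball_dist :: 'a measure)) - density_potential g y"
      using fin C by (subst nn_integral_diff) (auto simp: mean[OF y])
    also have "\<dots> = ennreal (C - u y)"
      by (simp add: unit_ball_dist.emeasure_space_1[unfolded space_unit_ball_dist] ennreal_minus u0 flip: u)
    finally show "(\<integral>\<^sup>+v. ennreal (C - u (y + rho y *\<^sub>R v)) \<partial>unit_ball_dist) \<le> ennreal (C - u y)" by simp
  qed (auto intro!: tendsto_intros lim)
  then have "(\<integral>\<^sup>+\<omega>. ennreal (C - u (exit_point x \<omega>)) \<partial>paths) + (\<integral>\<^sup>+\<omega>. ennreal (u (exit_point x \<omega>)) \<partial>paths)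
      \<le> ennreal (C - u x) + (\<integral>\<^sup>+\<omega>. ennreal (u (exit_point x \<omega>)) \<partial>paths)"
    by (rule add_right_mono)
  also have "(\<integral>\<^sup>+\<omega>. ennreal (C - u (exit_point x \<omega>)) \<partial>paths) + (\<integral>\<^sup>+\<omega>. ennreal (u (exit_point x \<omega>)) \<partial>paths) = ennreal C"
  proof -
    have "(\<integral>\<^sup>+\<omega>. ennreal (C - u (exit_point x \<omega>)) \<partial>paths) + (\<integral>\<^sup>+\<omega>. ennreal (u (exit_point x \<omega>)) \<partial>paths)
        = (\<integral>\<^sup>+\<omega>. ennreal (C - u (exit_point x \<omega>)) + ennreal (u (exit_point x \<omega>)) \<partial>paths)"
      by (rule nn_integral_add[symmetric, OF m(2) m(1)])
    also have "\<dots> = (\<integral>\<^sup>+\<omega>. ennreal C \<partial>(paths :: (nat \<Rightarrow> 'a) measure))"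
      by (intro nn_integral_cong) (simp add: u0 uC flip: ennreal_plus)
    finally show ?thesis by (simp add: paths.emeasure_space_1)
  qed
  finally have "ennreal C \<le> ennreal (C - u x) + (\<integral>\<^sup>+\<omega>. ennreal (u (exit_point x \<omega>)) \<partial>paths)" .
  moreover have "ennreal C = ennreal (C - u x) + ennreal (u x)" by (simp add: u0 uC flip: ennreal_plus)
  ultimately have "ennreal (u x) \<le> (\<integral>\<^sup>+\<omega>. ennreal (u (exit_point x \<omega>)) \<partial>paths)"
    by (simp add: ennreal_add_left_cancel_le)
  then show "density_potential g x \<le> (\<integral>\<^sup>+\<omega>. density_potential g (exit_point x \<omega>) \<partial>paths)" by (simp add: u)
qed

end

context bounded_density_source
begin

lemma bounded_density_restrict:
  "A \<in> sets borel \<Longrightarrow> bounded_density B R (\<lambda>z. indicator A z * g z)"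
proof -
  assume [measurable]: "A \<in> sets borel"
  have "indicator A z * g z \<le> ennreal B * indicator (cball 0 R) z" for z
    using g by (cases "z \<in> A") (simp_all add: bounded_density_def)
  then show ?thesis using g by (simp add: bounded_density_def)
qed

text \<open>
  By Tonelli's theorem the right-hand side is the integral over the mass at \<open>z\<close> of \<open>exit_potential
  z x\<close>, whereas the left-hand side integrates \<open>exit_potential x z\<close>. For mass inside \<open>\<Omega>\<close> the two
  agree by symmetry; mass outside is handled by \<open>density_potential_exit_mean\<close>.
\<close>

theorem limit_potential_eq_exit_mean:
  assumes x: "x \<in> \<Omega>"
  shows "limit_potential x = (\<integral>\<^sup>+\<omega>. density_potential g (exit_point x \<omega>) \<partial>paths)"
proof -
  note [measurable] = exit_point_measurable[OF x]
  have [measurable]: "\<Omega> \<in> sets borel" "- \<Omega> \<in> sets borel" using open_\<Omega> by auto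
  define g' where "g' z = indicator (- \<Omega>) z * g z" for z
  have g': "bounded_density B R g'" unfolding g'_def by (rule bounded_density_restrict) measurable
  interpret out: bounded_density_source \<Omega> g' B R
    by unfold_locales (rule g')
  have split: "(\<integral>\<^sup>+z. f z \<partial>source) = (\<integral>\<^sup>+z. indicator \<Omega> z * f z \<partial>source) + (\<integral>\<^sup>+z. f z \<partial>density lborel g')"
    if [measurable]: "f \<in> borel_measurable borel" for f
  proof -
    have "(\<integral>\<^sup>+z. f z \<partial>density lborel g') = (\<integral>\<^sup>+z. indicator (- \<Omega>) z * f z \<partial>source)"
      by (subst (1 2) nn_integral_density) (auto intro!: nn_integral_cong simp: g'_def mult_ac)
    moreover have "(\<integral>\<^sup>+z. indicator \<Omega> z * f z \<partial>source) + (\<integral>\<^sup>+z. indicator (- \<Omega>) z * f z \<partial>source)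
       = (\<integral>\<^sup>+z. indicator \<Omega> z * f z + indicator (- \<Omega>) z * f z \<partial>source)"
      by (rule nn_integral_add[symmetric]) auto
    moreover have "indicator \<Omega> z * f z + indicator (- \<Omega>) z * f z = f z" for z by (simp add: indicator_def)
    ultimately show ?thesis by simp
  qed
  have fub: "(\<integral>\<^sup>+\<omega>. (\<integral>\<^sup>+z. newton (exit_point x \<omega> - z) \<partial>N) \<partial>paths) = (\<integral>\<^sup>+z. exit_potential z x \<partial>N)"
    if N: "sigma_finite_measure N" and [measurable_cong, simp]: "sets N = sets borel" for N :: "'a measure"
  proof -
    interpret N: sigma_finite_measure N by (rule N)
    interpret P: pair_sigma_finite "paths :: (nat \<Rightarrow> 'a) measure" N ..
    show ?thesis unfolding exit_potential_def potential_def newton_minus_commute[of _ "exit_point x _"]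
      by (rule P.Fubini'[symmetric]) measurable
  qed
  have [measurable]: "(\<lambda>z. exit_potential z x) \<in> borel_measurable borel"
    unfolding exit_potential_def by (rule potential_source.potential_measurable[OF potential_source_exit[OF x]])
  have "(\<integral>\<^sup>+\<omega>. density_potential g (exit_point x \<omega>) \<partial>paths) = (\<integral>\<^sup>+z. exit_potential z x \<partial>source)"
    unfolding density_potential_source by (rule fub) (auto intro: src.sigma_finite_measure_axioms)
  also have "\<dots> = (\<integral>\<^sup>+z. indicator \<Omega> z * exit_potential z x \<partial>source) + (\<integral>\<^sup>+z. exit_potential z x \<partial>density lborel g')"
    by (rule split) measurable
  also have "(\<integral>\<^sup>+z. indicator \<Omega> z * exit_potential z x \<partial>source) = (\<integral>\<^sup>+z. indicator \<Omega> z * limit_kernel x z \<partial>source)"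
    using x by (intro nn_integral_cong) (auto simp: indicator_def limit_kernel_inside exit_potential_commute)
  also have "(\<integral>\<^sup>+z. exit_potential z x \<partial>density lborel g') = (\<integral>\<^sup>+\<omega>. density_potential g' (exit_point x \<omega>) \<partial>paths)"
    unfolding out.density_potential_source by (rule fub[symmetric]) (auto intro: out.src.sigma_finite_measure_axioms)
  also have "\<dots> = density_potential g' x"
    by (rule out.density_potential_exit_mean[OF x]) (simp add: g'_def)
  also have "\<dots> = (\<integral>\<^sup>+z. limit_kernel x z \<partial>density lborel g')"
    unfolding out.density_potential_source
    by (subst (1 2) nn_integral_density) (auto intro!: nn_integral_cong simp: g'_def indicator_def limit_kernel_outside)
  also have "(\<integral>\<^sup>+z. indicator \<Omega> z * limit_kernel x z \<partial>source) + (\<integral>\<^sup>+z. limit_kernel x z \<partial>density lborel g') = limit_potential x"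
    unfolding limit_potential_def by (rule split[symmetric]) measurable
  finally show ?thesis by simp
qed

end

section \<open>Density of differences of potentials\<close>

text \<open>
  The kernel minus its mean over a ball of radius \<open>r\<close>. It is nonnegative, integrable, and
  supported in the ball of radius \<open>r\<close>: after normalisation it is an approximate identity made of
  potentials.
\<close>

definition newton_gap :: "real \<Rightarrow> 'a::euclidean_space \<Rightarrow> ennreal" where
  "newton_gap r z = newton z - newton_mean r z"

lemma newton_gap_measurable [measurable]: "newton_gap r \<in> borel_measurable borel"
  unfolding newton_gap_def by measurable

lemma newton_eq_mean_plus_gap:
  fixes z :: "'a::euclidean_space"
  assumes "DIM('a) \<ge> 3" "r \<ge> 0"
  shows "newton z = newton_mean r z + newton_gap r z"
  using newton_mean_le[OF assms, of z] by (simp add: newton_gap_def newton_mean_def add_diff_inverse_ennreal)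

lemma newton_gap_eq_0:
  fixes z :: "'a::euclidean_space"
  assumes "DIM('a) \<ge> 3" "r \<ge> 0" "r < norm z"
  shows "newton_gap r z = 0"
proof -
  have "newton_mean r z = newton z" using newton_mean_eq[OF assms] by (simp add: newton_mean_def)
  moreover have "z \<noteq> 0" using assms by auto
  then have "newton z \<noteq> top" using newton_finite[of z] by auto
  ultimately show ?thesis by (simp add: newton_gap_def)
qed

lemma nn_integral_newton_gap_translate:
  fixes x :: "'a::euclidean_space"
  shows "(\<integral>\<^sup>+z. newton_gap r (x - z) \<partial>lborel) = (\<integral>\<^sup>+z. newton_gap r (z::'a) \<partial>lborel)"
proof -
  have "newton_gap r (x - z) = newton_gap r (- x + z)" for z
    using newton_mean_minus[of r "x - z"] newton_minus[of "x - z"] by (simp add: newton_gap_def)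
  then have "(\<integral>\<^sup>+z. newton_gap r (x - z) \<partial>lborel) = (\<integral>\<^sup>+z. newton_gap r z \<partial>distr lborel borel ((+) (- x)))"
    by (subst nn_integral_distr) auto
  then show ?thesis by (simp only: lborel_distr_plus)
qed

text \<open>
  The integral is positive because the mean is bounded while the kernel is not.
\<close>

lemma nn_integral_newton_gap:
  assumes d: "DIM('a::euclidean_space) \<ge> 3" and r: "r > 0"
  shows "0 < (\<integral>\<^sup>+z. newton_gap r (z::'a) \<partial>lborel)" "(\<integral>\<^sup>+z. newton_gap r (z::'a) \<partial>lborel) < top"
proof -
  obtain C where C: "C \<ge> 0" "\<And>x::'a. newton_mean r x \<le> ennreal C"
    using newton_mean_bounded[OF d r] unfolding newton_mean_def by blast
  have [measurable]: "cball (0::'a) s \<in> sets borel" for s by simp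
  have e: "emeasure lborel (cball (0::'a) r) \<noteq> 0" "emeasure lborel (cball (0::'a) r) \<noteq> top"
    using cball_emeasure[OF r, of "0::'a"] by auto
  have "(\<integral>\<^sup>+z. newton_gap r (z::'a) \<partial>lborel) \<le> (\<integral>\<^sup>+z. indicator (cball 0 r) (z::'a) * newton z \<partial>lborel)"
  proof (intro nn_integral_mono)
    fix z :: 'a
    show "newton_gap r z \<le> indicator (cball 0 r) z * newton z"
      using newton_gap_eq_0[OF d, of r z] r
      by (cases "norm z \<le> r") (auto simp: newton_gap_def intro: diff_le_self_ennreal)
  qed
  also have "\<dots> = newton_mean r (0::'a) * emeasure lborel (cball (0::'a) r)"
    using nn_integral_unit_ball_affine[of newton r "0::'a"] r ennreal_divide_mult_cancel[OF e]
    by (simp add: newton_mean_def)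
  also have "\<dots> \<le> ennreal C * emeasure lborel (cball (0::'a) r)" by (intro mult_right_mono C) auto
  also have "\<dots> < top" using e by (simp add: ennreal_mult_less_top top.not_eq_extremum)
  finally show "(\<integral>\<^sup>+z. newton_gap r (z::'a) \<partial>lborel) < top" .
  show "0 < (\<integral>\<^sup>+z. newton_gap r (z::'a) \<partial>lborel)"
  proof (rule ccontr)
    assume "\<not> ?thesis"
    then have "AE z in lborel. newton_gap r (z::'a) = 0"
      by (subst (asm) zero_less_iff_neq_zero) (auto simp: nn_integral_0_iff_AE)
    then have ae: "AE z in lborel. newton (z::'a) \<le> ennreal C"
    proof eventually_elim
      case (elim z)
      then show ?case using newton_eq_mean_plus_gap[OF d, of r z] C(2)[of z] r by simp
    qed
    have "\<forall>\<^sub>F z in nhds (0::'a). ennreal C < newton z"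
      by (rule newton_lsc[OF d]) (simp add: newton_def)
    then obtain s where s: "s > 0" "\<And>z::'a. norm z < s \<Longrightarrow> ennreal C < newton z"
      by (auto simp: eventually_nhds_metric dist_norm)
    have "AE z in lborel. (z::'a) \<notin> cball 0 (s / 2)"
      using ae
    proof eventually_elim
      case (elim z)
      have "\<not> norm z < s"
      proof
        assume "norm z < s"
        from s(2)[OF this] elim show False by simp
      qed
      then show ?case using s(1) by simp
    qed
    then have "emeasure lborel (cball (0::'a) (s / 2)) = 0"
      by (subst (asm) AE_iff_measurable[of "cball 0 (s/2)"]) auto
    then show False using cball_emeasure[of "s / 2" "0::'a"] s(1) by simp
  qed
qed

text \<open>
  Averaging the density is the same as averaging the kernel.
\<close>

lemma density_potential_smoothing:
  fixes g :: "'a::euclidean_space \<Rightarrow> ennreal"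
  assumes d: "DIM('a) \<ge> 3" and [measurable]: "g \<in> borel_measurable borel" and r: "r \<ge> 0"
  shows "density_potential g x = density_potential (\<lambda>z. \<integral>\<^sup>+u. g (z + r *\<^sub>R u) \<partial>unit_ball_dist) x
           + (\<integral>\<^sup>+z. g z * newton_gap r (x - z) \<partial>lborel)"
proof -
  interpret P: pair_sigma_finite "unit_ball_dist :: 'a measure" "lborel :: 'a measure" ..
  have "density_potential (\<lambda>z. \<integral>\<^sup>+u. g (z + r *\<^sub>R u) \<partial>unit_ball_dist) x
     = (\<integral>\<^sup>+w. (\<integral>\<^sup>+u. g (w + r *\<^sub>R u) * newton (x - w) \<partial>unit_ball_dist) \<partial>lborel)"
    by (subst density_potential_eq) (auto simp: nn_integral_multc)
  also have "\<dots> = (\<integral>\<^sup>+u. (\<integral>\<^sup>+w. g (w + r *\<^sub>R u) * newton (x - w) \<partial>lborel) \<partial>unit_ball_dist)"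
    by (rule P.Fubini') measurable
  also have "\<dots> = (\<integral>\<^sup>+u. (\<integral>\<^sup>+z. g z * newton (x + r *\<^sub>R u - z) \<partial>lborel) \<partial>unit_ball_dist)"
  proof (rule nn_integral_cong)
    fix u :: 'a
    have "(\<integral>\<^sup>+z. g z * newton (x + r *\<^sub>R u - z) \<partial>lborel)
      = (\<integral>\<^sup>+z. g z * newton (x + r *\<^sub>R u - z) \<partial>distr lborel borel ((+) (r *\<^sub>R u)))"
      by (simp only: lborel_distr_plus)
    also have "\<dots> = (\<integral>\<^sup>+w. g (w + r *\<^sub>R u) * newton (x - w) \<partial>lborel)"
      by (subst nn_integral_distr) (auto simp: add.commute algebra_simps)
    finally show "(\<integral>\<^sup>+w. g (w + r *\<^sub>R u) * newton (x - w) \<partial>lborel) = (\<integral>\<^sup>+z. g z * newton (x + r *\<^sub>R u - z) \<partial>lborel)" ..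
  qed
  also have "\<dots> = (\<integral>\<^sup>+z. (\<integral>\<^sup>+u. g z * newton (x + r *\<^sub>R u - z) \<partial>unit_ball_dist) \<partial>lborel)"
    by (rule P.Fubini'[symmetric]) measurable
  also have "\<dots> = (\<integral>\<^sup>+z. g z * newton_mean r (x - z) \<partial>lborel)"
    by (simp add: nn_integral_cmult newton_mean_shift')
  finally have "density_potential (\<lambda>z. \<integral>\<^sup>+u. g (z + r *\<^sub>R u) \<partial>unit_ball_dist) x = (\<integral>\<^sup>+z. g z * newton_mean r (x - z) \<partial>lborel)" .
  moreover have "density_potential g x = (\<integral>\<^sup>+z. g z * newton_mean r (x - z) + g z * newton_gap r (x - z) \<partial>lborel)"
    by (subst density_potential_eq) (auto simp: newton_eq_mean_plus_gap[OF d r] distrib_left)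
  ultimately show ?thesis by (simp add: nn_integral_add)
qed

lemma bounded_density_average:
  fixes g :: "'a::euclidean_space \<Rightarrow> ennreal"
  assumes g: "bounded_density B R g" and r: "r \<ge> 0"
  shows "bounded_density B (R + r) (\<lambda>z. \<integral>\<^sup>+u. g (z + r *\<^sub>R u) \<partial>unit_ball_dist)"
proof -
  note [measurable] = bounded_density_measurable[OF g]
  have "(\<integral>\<^sup>+u. g (z + r *\<^sub>R u) \<partial>unit_ball_dist) \<le> ennreal B * indicator (cball 0 (R + r)) z" for z
  proof -
    have "(\<integral>\<^sup>+u. g (z + r *\<^sub>R u) \<partial>unit_ball_dist) \<le> (\<integral>\<^sup>+u. ennreal B * indicator (cball 0 (R + r)) z \<partial>(unit_ball_dist :: 'a measure))"
    proof (rule nn_integral_mono_AE)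
      show "AE u in unit_ball_dist. g (z + r *\<^sub>R u) \<le> ennreal B * indicator (cball 0 (R + r)) z"
        using AE_unit_ball_dist
      proof eventually_elim
        case (elim u)
        have le: "g (z + r *\<^sub>R u) \<le> ennreal B * indicator (cball 0 R) (z + r *\<^sub>R u)"
          using g by (simp add: bounded_density_def)
        have "norm z \<le> R + r" if "norm (z + r *\<^sub>R u) \<le> R"
        proof -
          have "norm z \<le> norm (z + r *\<^sub>R u) + norm (r *\<^sub>R u)"
            using norm_triangle_ineq4[of "z + r *\<^sub>R u" "r *\<^sub>R u"] by simp
          also have "norm (r *\<^sub>R u) \<le> r" using elim r by (simp add: mult_left_le)
          finally show ?thesis using that by simp
        qed
        then have "(indicator (cball 0 R) (z + r *\<^sub>R u) :: ennreal) \<le> indicator (cball 0 (R + r)) z"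
          by (auto simp: indicator_def)
        then show ?case using le by (meson mult_left_mono order_trans zero_le)
      qed
    qed
    then show ?thesis by (simp add: unit_ball_dist.emeasure_space_1[unfolded space_unit_ball_dist])
  qed
  then show ?thesis using g r by (auto simp: bounded_density_def)
qed

text \<open>
  Extend \<open>f + B \<ge> 0\<close> continuously, cut it off to a density \<open>g\<close>, and let \<open>g'\<close> be the density
  obtained by averaging \<open>g\<close> over balls of small radius \<open>r\<close>. The difference of their potentials is
  the convolution of \<open>g\<close> with \<open>newton_gap r\<close>, so after division by the integral \<open>\<kappa>\<close> of the gap it
  is uniformly close to \<open>f + B\<close>.
\<close>

proposition potential_differences_dense:
  fixes f :: "'a::euclidean_space \<Rightarrow> real"
  assumes d: "DIM('a) \<ge> 3" and K: "compact K" and f: "continuous_on K f" and e: "e > 0"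
  shows "\<exists>g1 g2 B R1 R2 c b. bounded_density B R1 g1 \<and> bounded_density B R2 g2 \<and> c \<ge> 0 \<and>
    (\<forall>x\<in>K. \<bar>f x - (c * enn2real (density_potential g1 x) + c * - enn2real (density_potential g2 x) + b)\<bar> \<le> e)"
proof -
  obtain R0 where R0: "R0 > 0" "\<And>x. x \<in> K \<Longrightarrow> norm x \<le> R0"
    using compact_imp_bounded[OF K] by (auto simp: bounded_pos)
  have "bounded (f ` K)" by (intro compact_imp_bounded compact_continuous_image f K)
  then obtain B where B: "B > 0" "\<And>x. x \<in> K \<Longrightarrow> norm (f x) \<le> B" by (auto simp: bounded_pos)
  obtain F where F: "continuous_on UNIV F" "\<And>x. x \<in> K \<Longrightarrow> F x = f x" "\<And>x. norm (F x) \<le> B"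
    by (rule Tietze[OF f, of UNIV B]) (use B K compact_imp_closed in auto)
  have [measurable]: "F \<in> borel_measurable borel" using F(1) by (rule borel_measurable_continuous_onI)
  have "uniformly_continuous_on (cball 0 (R0 + 1)) F"
    by (intro compact_uniformly_continuous continuous_on_subset[OF F(1)]) auto
  then obtain \<delta> where \<delta>: "\<delta> > 0" "\<And>x z. x \<in> cball 0 (R0 + 1) \<Longrightarrow> z \<in> cball 0 (R0 + 1) \<Longrightarrow> dist z x < \<delta> \<Longrightarrow> dist (F z) (F x) < e"
    using e unfolding uniformly_continuous_on_def by blast
  define r where "r = min 1 (\<delta> / 2)"
  have r: "r > 0" "r \<le> 1" "r < \<delta>" using \<delta>(1) by (auto simp: r_def)
  \<comment> \<open>The cutoff lies at distance 1 from the ball containing \<open>K\<close>, and \<open>r \<le> 1\<close>, so on \<open>K\<close>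
    the convolution sees only \<open>F + B\<close>.\<close>
  define g where "g z = ennreal (F z + B) * indicator (cball 0 (R0 + 1)) z" for z
  define g' where "g' z = (\<integral>\<^sup>+u. g (z + r *\<^sub>R u) \<partial>unit_ball_dist)" for z
  have [measurable]: "cball (0::'a) s \<in> sets borel" for s by simp
  have [measurable]: "g \<in> borel_measurable borel" unfolding g_def by measurable
  have FB: "F z + B \<le> 2 * B" "F z + B \<ge> 0" for z using F(3)[of z] by auto
  have g: "bounded_density (2 * B) (R0 + 1) g"
    using B R0 FB by (auto simp: bounded_density_def g_def intro!: mult_right_mono ennreal_leI)
  have g': "bounded_density (2 * B) (R0 + 1 + r) g'"
    unfolding g'_def[abs_def] using r by (intro bounded_density_average[OF g]) auto
  define \<kappa> where "\<kappa> = enn2real (\<integral>\<^sup>+z. newton_gap r (z::'a) \<partial>lborel)"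
  have \<kappa>: "\<kappa> > 0" "(\<integral>\<^sup>+z. newton_gap r (z::'a) \<partial>lborel) = ennreal \<kappa>"
    using nn_integral_newton_gap[OF d r(1)] by (auto simp: \<kappa>_def enn2real_positive_iff)
  have fin: "density_potential f x = ennreal (enn2real (density_potential f x))" if "bounded_density B R f" for B R f and x :: 'a
    using density_potential_bounded[OF d that] by (auto simp: top.not_eq_extremum intro!: ennreal_enn2real[symmetric] intro: le_less_trans)
  define u where "u x = enn2real (density_potential g x)" for x
  define u' where "u' x = enn2real (density_potential g' x)" for x
  have main: "\<bar>F x + B - (u x - u' x) / \<kappa>\<bar> \<le> e" if x: "x \<in> K" for x
  proof -
    define J where "J = (\<integral>\<^sup>+z. g z * newton_gap r (x - z) \<partial>lborel)"
    have eq: "density_potential g x = density_potential g' x + J"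
      unfolding J_def g'_def[abs_def] using r by (intro density_potential_smoothing[OF d]) auto
    have near: "g z = ennreal (F z + B) \<and> \<bar>F z - F x\<bar> \<le> e" if "newton_gap r (x - z) \<noteq> 0" for z
    proof -
      have n: "norm (x - z) \<le> r" using that newton_gap_eq_0[OF d, of r "x - z"] r by fastforce
      have "norm z \<le> norm x + norm (x - z)" using norm_triangle_ineq4[of x "x - z"] by simp
      then have z: "z \<in> cball 0 (R0 + 1)" using n r R0(2)[OF x] by simp
      moreover have "x \<in> cball 0 (R0 + 1)" using R0(2)[OF x] by simp
      ultimately have "dist (F z) (F x) < e" using n r by (intro \<delta>) (auto simp: dist_norm norm_minus_commute)
      then show ?thesis using z by (simp add: g_def dist_real_def)
    qed
    have "J \<le> (\<integral>\<^sup>+z. ennreal (F x + B + e) * newton_gap r (x - z) \<partial>lborel)"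
      unfolding J_def
    proof (intro nn_integral_mono)
      fix z
      show "g z * newton_gap r (x - z) \<le> ennreal (F x + B + e) * newton_gap r (x - z)"
        using near[of z] by (cases "newton_gap r (x - z) = 0") (auto intro!: mult_right_mono ennreal_leI)
    qed
    also have "\<dots> = ennreal ((F x + B + e) * \<kappa>)"
      using FB(2)[of x] e \<kappa>(1) by (simp add: nn_integral_cmult nn_integral_newton_gap_translate \<kappa>(2) ennreal_mult)
    finally have up: "J \<le> ennreal ((F x + B + e) * \<kappa>)" .
    have "ennreal ((F x + B - e) * \<kappa>) = ennreal (F x + B - e) * ennreal \<kappa>"
      using \<kappa>(1) by (intro ennreal_mult'') auto
    also have "\<dots> = (\<integral>\<^sup>+z. ennreal (F x + B - e) * newton_gap r (x - z) \<partial>lborel)"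
      by (simp add: nn_integral_cmult nn_integral_newton_gap_translate \<kappa>(2))
    also have "\<dots> \<le> J"
      unfolding J_def
    proof (intro nn_integral_mono)
      fix z
      show "ennreal (F x + B - e) * newton_gap r (x - z) \<le> g z * newton_gap r (x - z)"
        using near[of z] by (cases "newton_gap r (x - z) = 0") (auto intro!: mult_right_mono ennreal_leI)
    qed
    finally have lo: "ennreal ((F x + B - e) * \<kappa>) \<le> J" .
    obtain j where j: "J = ennreal j" "j \<ge> 0" using le_less_trans[OF up ennreal_less_top] by (cases J) auto
    have "u x = u' x + j"
    proof -
      have "density_potential g' x < top" by (subst fin[OF g']) simp
      then show ?thesis unfolding u_def u'_def eq j(1) using j(2) by (subst enn2real_plus) auto
    qed
    moreover have "j \<le> (F x + B + e) * \<kappa>"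
      using up j FB(2)[of x] e \<kappa>(1) by (simp add: ennreal_le_iff)
    moreover have "(F x + B - e) * \<kappa> \<le> j" using lo j by (simp add: ennreal_le_iff)
    ultimately have "(u x - u' x) / \<kappa> \<le> F x + B + e" "F x + B - e \<le> (u x - u' x) / \<kappa>"
      using \<kappa>(1) by (simp_all add: pos_divide_le_eq pos_le_divide_eq)
    then show ?thesis by simp
  qed
  show ?thesis
  proof (rule exI[of _ g], rule exI[of _ g'], rule exI[of _ "2 * B"], rule exI[of _ "R0 + 1"], rule exI[of _ "R0 + 1 + r"],
      rule exI[of _ "1 / \<kappa>"], rule exI[of _ "- B"], intro conjI ballI g g')
    show "0 \<le> 1 / \<kappa>" using \<kappa> by simp
    fix x assume x: "x \<in> K"
    have "f x - (1 / \<kappa> * enn2real (density_potential g x) + 1 / \<kappa> * - enn2real (density_potential g' x) + - B)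
      = F x + B - (u x - u' x) / \<kappa>"
      by (simp add: F(2)[OF x] u_def u'_def diff_divide_distrib)
    then show "\<bar>f x - (1 / \<kappa> * enn2real (density_potential g x) + 1 / \<kappa> * - enn2real (density_potential g' x) + - B)\<bar> \<le> e"
      using main[OF x] by simp
  qed
qed

section \<open>Resolutivity and harmonic measure\<close>

context bounded_open_set
begin

text \<open>
  Upper functions in the real-valued class can come arbitrarily close to the integral against the
  exit law. By \<open>upper_function_ge_exit_integral\<close> they cannot go below it.
\<close>

definition resolutive :: "('a \<Rightarrow> real) \<Rightarrow> bool" where
  "resolutive f \<longleftrightarrow> (\<forall>x\<in>\<Omega>. \<forall>e>0. \<exists>h. real_superharmonic \<Omega> h \<and>
     (\<forall>\<xi>\<in>frontier \<Omega>. \<forall>a<f \<xi>. \<forall>\<^sub>F y in at \<xi> within \<Omega>. a < h y) \<and>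
     h x \<le> (LINT \<xi>|exit_law x. f \<xi>) + e)"

lemma integrable_exit_law:
  fixes f :: "'a \<Rightarrow> real"
  assumes x: "x \<in> \<Omega>" and f: "continuous_on (frontier \<Omega>) f"
  shows "integrable (exit_law x) f"
proof -
  interpret prob_space "exit_law x" by (rule prob_space_exit_law[OF x])
  have "bounded (f ` frontier \<Omega>)"
    using f compact_frontier_bounded[OF bounded_\<Omega>] by (intro compact_imp_bounded compact_continuous_image)
  then obtain C where C: "\<And>\<xi>. \<xi> \<in> frontier \<Omega> \<Longrightarrow> norm (f \<xi>) \<le> C" by (auto simp: bounded_iff)
  have "space (exit_law x) = frontier \<Omega>" by (simp add: exit_law_def space_restrict_space)
  then show ?thesis
    using C by (intro integrable_const_bound[of _ C] AE_I2 continuous_on_imp_measurable_restrict_space[OF sets_exit_law f]) auto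
qed

lemma exit_law_integral_const: "x \<in> \<Omega> \<Longrightarrow> (LINT \<xi>|exit_law x. c) = (c::real)"
  using prob_space.prob_space[OF prob_space_exit_law] by simp

lemma resolutive_add:
  assumes f: "resolutive f" "continuous_on (frontier \<Omega>) f" and g: "resolutive g" "continuous_on (frontier \<Omega>) g"
  shows "resolutive (\<lambda>\<xi>. f \<xi> + g \<xi>)"
  unfolding resolutive_def
proof (intro ballI allI impI)
  fix x e assume x: "x \<in> \<Omega>" and e: "(e::real) > 0"
  obtain h k where h: "real_superharmonic \<Omega> h" "\<And>\<xi> a. \<xi> \<in> frontier \<Omega> \<Longrightarrow> a < f \<xi> \<Longrightarrow> \<forall>\<^sub>F y in at \<xi> within \<Omega>. a < h y"
      "h x \<le> (LINT \<xi>|exit_law x. f \<xi>) + e / 2"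
    and k: "real_superharmonic \<Omega> k" "\<And>\<xi> a. \<xi> \<in> frontier \<Omega> \<Longrightarrow> a < g \<xi> \<Longrightarrow> \<forall>\<^sub>F y in at \<xi> within \<Omega>. a < k y"
      "k x \<le> (LINT \<xi>|exit_law x. g \<xi>) + e / 2"
  proof -
    have e2: "e / 2 > 0" using e by simp
    from f(1)[unfolded resolutive_def, rule_format, OF x e2] g(1)[unfolded resolutive_def, rule_format, OF x e2]
    show ?thesis using that by blast
  qed
  show "\<exists>h. real_superharmonic \<Omega> h \<and>
     (\<forall>\<xi>\<in>frontier \<Omega>. \<forall>a<f \<xi> + g \<xi>. \<forall>\<^sub>F y in at \<xi> within \<Omega>. a < h y) \<and>
     h x \<le> (LINT \<xi>|exit_law x. f \<xi> + g \<xi>) + e"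
  proof (intro exI[of _ "\<lambda>y. h y + k y"] conjI ballI allI impI real_superharmonic_add h(1) k(1))
    fix \<xi> a assume \<xi>: "\<xi> \<in> frontier \<Omega>" and a: "a < f \<xi> + g \<xi>"
    define t where "t = (f \<xi> + g \<xi> - a) / 2"
    have t: "t > 0" using a by (simp add: t_def)
    have "\<forall>\<^sub>F y in at \<xi> within \<Omega>. f \<xi> - t < h y" "\<forall>\<^sub>F y in at \<xi> within \<Omega>. g \<xi> - t < k y"
      using t by (auto intro!: h(2) k(2) \<xi>)
    then show "\<forall>\<^sub>F y in at \<xi> within \<Omega>. a < h y + k y"
      by eventually_elim (simp add: t_def field_simps)
  next
    show "h x + k x \<le> (LINT \<xi>|exit_law x. f \<xi> + g \<xi>) + e"
      using h(3) k(3) integrable_exit_law[OF x] f(2) g(2) by simp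
  qed
qed

lemma resolutive_const: "resolutive (\<lambda>_. c)"
  unfolding resolutive_def
proof (intro ballI allI impI exI[of _ "\<lambda>_. c"] conjI real_superharmonic_const)
  fix x e assume "x \<in> \<Omega>" "0 < (e::real)"
  then show "c \<le> (LINT \<xi>|exit_law x. c) + e" by (simp only: exit_law_integral_const)
qed simp

lemma resolutive_cmult:
  assumes f: "resolutive f" and c: "c \<ge> 0"
  shows "resolutive (\<lambda>\<xi>. c * f \<xi>)"
proof (cases "c = 0")
  case True
  then show ?thesis using resolutive_const[of 0] by simp
next
  case False
  then have c: "c > 0" using c by simp
  show ?thesis unfolding resolutive_def
  proof (intro ballI allI impI)
    fix x e assume x: "x \<in> \<Omega>" and e: "(e::real) > 0"
    obtain h where h: "real_superharmonic \<Omega> h" "\<And>\<xi> a. \<xi> \<in> frontier \<Omega> \<Longrightarrow> a < f \<xi> \<Longrightarrow> \<forall>\<^sub>F y in at \<xi> within \<Omega>. a < h y"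
      "h x \<le> (LINT \<xi>|exit_law x. f \<xi>) + e / c"
    proof -
      have ec: "e / c > 0" using e c by simp
      from f[unfolded resolutive_def, rule_format, OF x ec] show ?thesis using that by blast
    qed
    show "\<exists>h. real_superharmonic \<Omega> h \<and>
     (\<forall>\<xi>\<in>frontier \<Omega>. \<forall>a<c * f \<xi>. \<forall>\<^sub>F y in at \<xi> within \<Omega>. a < h y) \<and>
     h x \<le> (LINT \<xi>|exit_law x. c * f \<xi>) + e"
    proof (intro exI[of _ "\<lambda>y. c * h y"] conjI ballI allI impI real_superharmonic_cmult h(1))
      fix \<xi> a assume \<xi>: "\<xi> \<in> frontier \<Omega>" and a: "a < c * f \<xi>"
      have "a / c < f \<xi>" using a c by (simp add: pos_divide_less_eq mult.commute)
      from h(2)[OF \<xi> this] show "\<forall>\<^sub>F y in at \<xi> within \<Omega>. a < c * h y"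
        by eventually_elim (use c in \<open>simp add: pos_divide_less_eq mult.commute\<close>)
    next
      have "c * h x \<le> c * ((LINT \<xi>|exit_law x. f \<xi>) + e / c)" using h(3) c by (intro mult_left_mono) auto
      then show "c * h x \<le> (LINT \<xi>|exit_law x. c * f \<xi>) + e" using c by (simp add: distrib_left)
    qed (use c in auto)
  qed
qed

lemma resolutive_uniform_limit:
  assumes f: "continuous_on (frontier \<Omega>) f"
    and ap: "\<And>e. e > 0 \<Longrightarrow> \<exists>f'. resolutive f' \<and> continuous_on (frontier \<Omega>) f' \<and> (\<forall>\<xi>\<in>frontier \<Omega>. \<bar>f \<xi> - f' \<xi>\<bar> \<le> e)"
  shows "resolutive f"
  unfolding resolutive_def
proof (intro ballI allI impI)
  fix x e assume x: "x \<in> \<Omega>" and e: "(e::real) > 0"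
  obtain f' where f': "resolutive f'" "continuous_on (frontier \<Omega>) f'" "\<And>\<xi>. \<xi> \<in> frontier \<Omega> \<Longrightarrow> \<bar>f \<xi> - f' \<xi>\<bar> \<le> e / 3"
    using ap[of "e / 3"] e by auto
  obtain h where h: "real_superharmonic \<Omega> h" "\<And>\<xi> a. \<xi> \<in> frontier \<Omega> \<Longrightarrow> a < f' \<xi> \<Longrightarrow> \<forall>\<^sub>F y in at \<xi> within \<Omega>. a < h y"
    "h x \<le> (LINT \<xi>|exit_law x. f' \<xi>) + e / 3"
  proof -
    have e3: "e / 3 > 0" using e by simp
    from f'(1)[unfolded resolutive_def, rule_format, OF x e3] show ?thesis using that by blast
  qed
  show "\<exists>h. real_superharmonic \<Omega> h \<and>
     (\<forall>\<xi>\<in>frontier \<Omega>. \<forall>a<f \<xi>. \<forall>\<^sub>F y in at \<xi> within \<Omega>. a < h y) \<and>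
     h x \<le> (LINT \<xi>|exit_law x. f \<xi>) + e"
  proof (intro exI[of _ "\<lambda>y. h y + e / 3"] conjI ballI allI impI real_superharmonic_add h(1) real_superharmonic_const)
    fix \<xi> a assume \<xi>: "\<xi> \<in> frontier \<Omega>" and a: "a < f \<xi>"
    have "a - e / 3 < f' \<xi>" using f'(3)[OF \<xi>] a by linarith
    from h(2)[OF \<xi> this] show "\<forall>\<^sub>F y in at \<xi> within \<Omega>. a < h y + e / 3"
      by eventually_elim simp
  next
    have sp: "space (exit_law x) = frontier \<Omega>" by (simp add: exit_law_def space_restrict_space)
    have "(LINT \<xi>|exit_law x. f' \<xi>) \<le> (LINT \<xi>|exit_law x. f \<xi> + e / 3)"
    proof (rule integral_mono)
      show "integrable (exit_law x) f'" by (rule integrable_exit_law[OF x f'(2)])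
      show "integrable (exit_law x) (\<lambda>\<xi>. f \<xi> + e / 3)"
        by (intro integrable_exit_law x continuous_intros f)
      fix \<xi> assume "\<xi> \<in> space (exit_law x)"
      then have "\<bar>f \<xi> - f' \<xi>\<bar> \<le> e / 3" unfolding sp by (rule f'(3))
      then show "f' \<xi> \<le> f \<xi> + e / 3" by linarith
    qed
    also have "\<dots> = (LINT \<xi>|exit_law x. f \<xi>) + (LINT \<xi>|exit_law x. e / 3)"
      by (intro Bochner_Integration.integral_add integrable_exit_law x f continuous_intros)
    also have "(LINT \<xi>|exit_law x. e / 3) = e / 3" by (rule exit_law_integral_const[OF x])
    finally show "h x + e / 3 \<le> (LINT \<xi>|exit_law x. f \<xi>) + e" using h(3) by simp
  qed
qed

lemma exit_law_integral_density_potential: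
  assumes g: "bounded_density B R g" and x: "x \<in> \<Omega>"
  shows "(LINT \<xi>|exit_law x. enn2real (density_potential g \<xi>)) = enn2real (bounded_density_source.limit_potential \<Omega> g x)"
proof -
  interpret bounded_density_source \<Omega> g B R by unfold_locales (rule g)
  note [measurable] = exit_point_measurable[OF x]
  have "(LINT \<xi>|exit_law x. enn2real (density_potential g \<xi>)) = (LINT \<omega>|paths. enn2real (density_potential g (exit_point x \<omega>)))"
    by (rule integral_exit_law[OF x]) (auto intro: measurable_restrict_space1)
  also have "\<dots> = enn2real (\<integral>\<^sup>+\<omega>. density_potential g (exit_point x \<omega>) \<partial>paths)"
    by (subst integral_eq_nn_integral) (auto simp: ennreal_density_potential)
  finally show ?thesis by (simp add: limit_potential_eq_exit_mean[OF x])
qed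

text \<open>
  For the potential itself the swept potentials serve as upper functions: they have the same
  values on the boundary and decrease to the right limit. For its negative, the limit is harmonic
  and lies below the potential, so the negative of the limit is an upper function that attains the
  integral.
\<close>

lemma resolutive_density_potential:
  assumes g: "bounded_density B R g"
  shows "resolutive (\<lambda>\<xi>. enn2real (density_potential g \<xi>))"
    and "resolutive (\<lambda>\<xi>. - enn2real (density_potential g \<xi>))"
proof -
  interpret bounded_density_source \<Omega> g B R by unfold_locales (rule g)
  obtain C where C: "C \<ge> 0" "\<And>x. density_potential g x \<le> ennreal C"
    using density_potential_bounded[OF dim g] by blast
  let ?u = "\<lambda>\<xi>. enn2real (density_potential g \<xi>)"
  have out: "\<xi> \<notin> \<Omega>" if "\<xi> \<in> frontier \<Omega>" for \<xi> using that open_\<Omega> by (simp add: frontier_def interior_open)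
  have sh: "real_superharmonic UNIV (\<lambda>x. enn2real (swept_potential k x))" for k
    unfolding swept_potential_def
    by (rule potential_source.potential_real_superharmonic[OF potential_source_swept, where C=C])
       (metis swept_potential_def swept_potential_le C(2) order_trans)
  show "resolutive ?u" unfolding resolutive_def
  proof (intro ballI allI impI)
    fix x e assume x: "x \<in> \<Omega>" and e: "(e::real) > 0"
    have "(\<lambda>k. enn2real (swept_potential k x)) \<longlonglongrightarrow> enn2real (limit_potential x)"
      using swept_potential_tendsto[of x] by (intro tendsto_enn2real) (simp_all add: ennreal_limit_potential)
    then have "\<forall>\<^sub>F k in sequentially. enn2real (swept_potential k x) < enn2real (limit_potential x) + e"
      using e by (intro order_tendstoD) auto
    then obtain k where k: "enn2real (swept_potential k x) < enn2real (limit_potential x) + e"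
      by (auto simp: eventually_sequentially)
    show "\<exists>h. real_superharmonic \<Omega> h \<and> (\<forall>\<xi>\<in>frontier \<Omega>. \<forall>a<?u \<xi>. \<forall>\<^sub>F y in at \<xi> within \<Omega>. a < h y) \<and>
       h x \<le> (LINT \<xi>|exit_law x. ?u \<xi>) + e"
    proof (intro exI[of _ "\<lambda>x. enn2real (swept_potential k x)"] conjI ballI allI impI)
      show "real_superharmonic \<Omega> (\<lambda>x. enn2real (swept_potential k x))"
        by (rule real_superharmonic_subset[OF sh]) simp
      show "enn2real (swept_potential k x) \<le> (LINT \<xi>|exit_law x. ?u \<xi>) + e"
        using k by (simp add: exit_law_integral_density_potential[OF g x])
      fix \<xi> a assume \<xi>: "\<xi> \<in> frontier \<Omega>" and a: "a < ?u \<xi>"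
      then have "a < enn2real (swept_potential k \<xi>)" by (simp add: swept_potential_outside out)
      then have "\<forall>\<^sub>F y in at \<xi>. a < enn2real (swept_potential k y)"
        using sh[of k] by (simp add: real_superharmonic_def)
      then show "\<forall>\<^sub>F y in at \<xi> within \<Omega>. a < enn2real (swept_potential k y)"
        using filter_leD[OF at_le[of \<Omega> UNIV \<xi>]] by simp
    qed
  qed
  show "resolutive (\<lambda>\<xi>. - ?u \<xi>)" unfolding resolutive_def
  proof (intro ballI allI impI)
    fix x e assume x: "x \<in> \<Omega>" and e: "(e::real) > 0"
    show "\<exists>h. real_superharmonic \<Omega> h \<and> (\<forall>\<xi>\<in>frontier \<Omega>. \<forall>a<(- ?u \<xi>). \<forall>\<^sub>F y in at \<xi> within \<Omega>. a < h y) \<and>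
       h x \<le> (LINT \<xi>|exit_law x. - ?u \<xi>) + e"
    proof (intro exI[of _ "\<lambda>x. - enn2real (limit_potential x)"] conjI ballI allI impI real_superharmonic_minus_limit_potential)
      show "- enn2real (limit_potential x) \<le> (LINT \<xi>|exit_law x. - ?u \<xi>) + e"
        using e by (simp add: exit_law_integral_density_potential[OF g x])
      fix \<xi> a assume \<xi>: "\<xi> \<in> frontier \<Omega>" and a: "a < - ?u \<xi>"
      have "(?u \<longlongrightarrow> ?u \<xi>) (at \<xi> within \<Omega>)"
        using continuous_on_density_potential[OF dim g, of UNIV]
        unfolding continuous_on_def by (auto intro: tendsto_within_subset)
      then have "\<forall>\<^sub>F y in at \<xi> within \<Omega>. ?u y < - a" using a by (intro order_tendstoD) auto
      then show "\<forall>\<^sub>F y in at \<xi> within \<Omega>. a < - enn2real (limit_potential y)"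
      proof eventually_elim
        case (elim y)
        have "enn2real (limit_potential y) \<le> ?u y"
          using limit_potential_le[of y] ennreal_density_potential[of y]
          by (intro enn2real_leI) auto
        then show ?case using elim by simp
      qed
    qed
  qed
qed

theorem resolutive_continuous:
  assumes f: "continuous_on (frontier \<Omega>) f"
  shows "resolutive f"
proof (rule resolutive_uniform_limit[OF f])
  fix e :: real assume e: "e > 0"
  from potential_differences_dense[OF dim compact_frontier_bounded[OF bounded_\<Omega>] f e]
  obtain g1 g2 B R1 R2 c b where
    g: "bounded_density B R1 g1" "bounded_density B R2 g2" and c: "c \<ge> 0" and
    ap: "\<forall>\<xi>\<in>frontier \<Omega>. \<bar>f \<xi> - (c * enn2real (density_potential g1 \<xi>) + c * - enn2real (density_potential g2 \<xi>) + b)\<bar> \<le> e"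
    by blast
  show "\<exists>f'. resolutive f' \<and> continuous_on (frontier \<Omega>) f' \<and> (\<forall>\<xi>\<in>frontier \<Omega>. \<bar>f \<xi> - f' \<xi>\<bar> \<le> e)"
  proof (intro exI conjI)
    show "resolutive (\<lambda>\<xi>. c * enn2real (density_potential g1 \<xi>) + c * - enn2real (density_potential g2 \<xi>) + b)"
      by (intro resolutive_add resolutive_cmult resolutive_density_potential(1)[OF g(1)] resolutive_density_potential(2)[OF g(2)]
          resolutive_const c continuous_intros continuous_on_density_potential[OF dim g(1)] continuous_on_density_potential[OF dim g(2)])
    show "continuous_on (frontier \<Omega>) (\<lambda>\<xi>. c * enn2real (density_potential g1 \<xi>) + c * - enn2real (density_potential g2 \<xi>) + b)"
      by (intro continuous_intros continuous_on_density_potential[OF dim g(1)] continuous_on_density_potential[OF dim g(2)])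
  qed (rule ap)
qed

theorem perron_solution_eq_exit_integral:
  assumes f: "continuous_on (frontier \<Omega>) f" and x: "x \<in> \<Omega>"
  shows "perron_solution \<Omega> f x = ereal (LINT \<xi>|exit_law x. f \<xi>)"
proof (rule antisym)
  show "ereal (LINT \<xi>|exit_law x. f \<xi>) \<le> perron_solution \<Omega> f x"
    unfolding perron_solution_def
    by (intro INF_greatest) (auto intro: upper_function_ge_exit_integral[OF _ f x])
  show "perron_solution \<Omega> f x \<le> ereal (LINT \<xi>|exit_law x. f \<xi>)"
  proof (rule ereal_le_epsilon2)
    fix e :: real assume "0 < e"
    obtain h where h: "real_superharmonic \<Omega> h" "\<And>\<xi> a. \<xi> \<in> frontier \<Omega> \<Longrightarrow> a < f \<xi> \<Longrightarrow> \<forall>\<^sub>F y in at \<xi> within \<Omega>. a < h y"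
      "h x \<le> (LINT \<xi>|exit_law x. f \<xi>) + e"
      using resolutive_continuous[OF f, unfolded resolutive_def, rule_format, OF x \<open>0 < e\<close>] by blast
    have "upper_function \<Omega> f (\<lambda>y. ereal (h y))"
      by (rule upper_function_of_real_superharmonic[OF h(1,2)])
    then have "perron_solution \<Omega> f x \<le> ereal (h x)"
      unfolding perron_solution_def by (intro INF_lower2[where i="\<lambda>y. ereal (h y)"]) auto
    also have "\<dots> \<le> ereal (LINT \<xi>|exit_law x. f \<xi>) + ereal e" using h(3) by simp
    finally show "perron_solution \<Omega> f x \<le> ereal (LINT \<xi>|exit_law x. f \<xi>) + ereal e" .
  qed
qed

theorem harmonic_measure_eq_exit_law:
  assumes x: "x \<in> \<Omega>"
  shows "harmonic_measure \<Omega> x = exit_law x"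
  unfolding harmonic_measure_def
proof (rule the_equality)
  have fin: "finite_measure (exit_law x)"
    using prob_space_exit_law[OF x] by (simp add: prob_space_def)
  show hx: "is_harmonic_measure \<Omega> x (exit_law x)"
    unfolding is_harmonic_measure_def
    using fin sets_exit_law perron_solution_eq_exit_integral[OF _ x] by simp
  fix \<mu> assume \<mu>: "is_harmonic_measure \<Omega> x \<mu>"
  show "\<mu> = exit_law x"
  proof (rule finite_measure_eqI_continuous[where K="frontier \<Omega>"])
    fix f :: "'a \<Rightarrow> real" assume f: "continuous_on (frontier \<Omega>) f"
    have "ereal (LINT \<xi>|\<mu>. f \<xi>) = ereal (LINT \<xi>|exit_law x. f \<xi>)"
      using \<mu> hx f unfolding is_harmonic_measure_def by metis
    then show "(LINT \<xi>|\<mu>. f \<xi>) = (LINT \<xi>|exit_law x. f \<xi>)" by simp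
  qed (use \<mu> fin sets_exit_law in \<open>auto simp: is_harmonic_measure_def\<close>)
qed

end

section \<open>Harmonic measure and the Green function\<close>

text \<open>
  Away from its pole the kernel is harmonic, so its negative is superharmonic too.
\<close>

lemma real_superharmonic_minus_newton:
  fixes y :: "'a::euclidean_space"
  assumes d: "DIM('a) \<ge> 3" and r: "r > 0" and away: "\<And>z. z \<in> S \<Longrightarrow> r \<le> norm (z - y)"
  shows "real_superharmonic S (\<lambda>z. - enn2real (newton (z - y)))"
  unfolding real_superharmonic_def
proof (intro conjI ballI allI impI)
  have bnd: "newton (z - y) \<le> ennreal (r powr (2 - real DIM('a)))" if "z \<in> S" for z
    using away[OF that] r d by (auto simp: newton_def intro!: ennreal_leI powr_mono2')
  then have "enn2real (newton (z - y)) \<le> r powr (2 - real DIM('a))" if "z \<in> S" for z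
    using that by (intro enn2real_leI) auto
  then show "bounded ((\<lambda>z. - enn2real (newton (z - y))) ` S)"
    by (auto simp: bounded_iff intro!: exI[of _ "r powr (2 - real DIM('a))"])
  fix x a assume x: "x \<in> S" and a: "a < - enn2real (newton (x - y))"
  have "x - y \<noteq> 0" using away[OF x] r by auto
  then have "((\<lambda>z. newton (z - y)) \<longlongrightarrow> newton (x - y)) (at x within S)"
    by (intro newton_tendsto tendsto_intros)
  moreover have "newton (x - y) = ennreal (enn2real (newton (x - y)))"
    using newton_finite[OF \<open>x - y \<noteq> 0\<close>] by simp
  ultimately have "((\<lambda>z. enn2real (newton (z - y))) \<longlongrightarrow> enn2real (newton (x - y))) (at x within S)"
    by (intro tendsto_enn2real) auto
  then have "\<forall>\<^sub>F z in at x within S. enn2real (newton (z - y)) < - a" using a by (intro order_tendstoD) auto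
  then show "\<forall>\<^sub>F z in at x within S. a < - enn2real (newton (z - y))" by eventually_elim simp
next
  fix x s assume s: "0 < (s::real)" "cball x s \<subseteq> S"
  have ys: "s < norm (x - y)"
  proof (rule ccontr)
    assume "\<not> s < norm (x - y)"
    then have "y \<in> S" using s by (auto simp: dist_norm)
    then show False using away[of y] r by simp
  qed
  have "AE u in unit_ball_dist. ennreal (enn2real (newton (x + s *\<^sub>R u - y))) = newton (x + s *\<^sub>R u - y)"
    using AE_unit_ball_dist
  proof eventually_elim
    case (elim u)
    then have "x + s *\<^sub>R u \<in> S" using cball_param[of s u x] s by auto
    then have "x + s *\<^sub>R u - y \<noteq> 0" using away[of "x + s *\<^sub>R u"] r by auto
    then show ?case using newton_finite[of "x + s *\<^sub>R u - y"] by simp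
  qed
  then have "(\<integral>\<^sup>+u. ennreal (enn2real (newton (x + s *\<^sub>R u - y))) \<partial>unit_ball_dist) = (\<integral>\<^sup>+u. newton (x + s *\<^sub>R u - y) \<partial>unit_ball_dist)"
    by (rule nn_integral_cong_AE)
  also have "\<dots> = newton_mean s (x - y)" by (rule newton_mean_shift')
  also have "\<dots> = newton (x - y)"
    unfolding newton_mean_def using s ys by (intro newton_mean_eq[OF d]) auto
  finally have "(LINT u|unit_ball_dist. enn2real (newton (x + s *\<^sub>R u - y))) = enn2real (newton (x - y))"
    by (subst integral_eq_nn_integral) auto
  then show "(LINT u|unit_ball_dist. - enn2real (newton (x + s *\<^sub>R u - y))) \<le> - enn2real (newton (x - y))" by simp
qed measurable

context bounded_open_set
begin

lemma measure_le_cutoff_integral: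
  assumes x: "x \<in> \<Omega>" and C: "closed C" "C \<noteq> {}"
  shows "measure (exit_law x) (C \<inter> frontier \<Omega>) \<le> (LINT \<xi>|exit_law x. closed_cutoff C n \<xi>)"
proof -
  interpret prob_space "exit_law x" by (rule prob_space_exit_law[OF x])
  have A: "C \<inter> frontier \<Omega> \<in> sets (exit_law x)"
    unfolding sets_exit_law using C by (auto simp: sets_restrict_space)
  have "measure (exit_law x) (C \<inter> frontier \<Omega>) = (LINT \<xi>|exit_law x. indicator (C \<inter> frontier \<Omega>) \<xi>)"
    using A by simp
  also have "\<dots> \<le> (LINT \<xi>|exit_law x. closed_cutoff C n \<xi>)"
  proof (rule integral_mono)
    show "integrable (exit_law x) (closed_cutoff C n)"
      by (rule integrable_exit_law[OF x continuous_on_closed_cutoff[OF C(2)]])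
    show "integrable (exit_law x) (indicator (C \<inter> frontier \<Omega>) :: 'a \<Rightarrow> real)"
      by (rule integrable_real_indicator[OF A]) (simp add: emeasure_eq_measure)
    show "indicator (C \<inter> frontier \<Omega>) \<xi> \<le> closed_cutoff C n \<xi>" for \<xi>
      using closed_cutoff_bounds[of C n \<xi>] closed_cutoff_eq_1[of \<xi> C n] by (auto simp: indicator_def)
  qed
  finally show ?thesis .
qed

lemma swept_Suc_bounded:
  assumes y: "y \<in> \<Omega>"
  shows "\<exists>C\<ge>0. \<forall>k x. swept (Suc k) x y \<le> ennreal C"
proof -
  from newton_mean_bounded[OF dim rho_pos[OF y]] obtain C where
    C: "C \<ge> 0" "\<And>x::'a. newton_mean (rho y) x \<le> ennreal C" unfolding newton_mean_def by blast
  have "swept (Suc k) x y \<le> ennreal C" for k x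
  proof -
    have "swept (Suc k) x y \<le> swept (Suc 0) x y" using decseq_swept[of x y] by (rule decseqD) simp
    also have "\<dots> = newton_mean (rho y) (x - y)" by (simp add: swept_Suc)
    also have "\<dots> \<le> ennreal C" by (rule C)
    finally show ?thesis .
  qed
  then show ?thesis using C(1) by blast
qed

text \<open>
  The minimum principle on \<open>\<Omega> - 2B\<close> for \<open>h + L (swept (k + 1) \<cdot> y - K(\<cdot> - y))\<close>. At boundary points
  of \<open>\<Omega>\<close> the bracket has lower limit at least 0, since \<open>swept\<close> agrees with \<open>K(\<cdot> - y)\<close> outside \<open>\<Omega>\<close>
  and is lower semicontinuous. At the remaining boundary points, on the sphere of radius \<open>2r\<close>, \<open>h\<close>
  is at least \<open>I\<close>, while \<open>L K(\<cdot> - y) \<le> I\<close> as \<open>y\<close> is at distance at least \<open>r\<close>. At least one step of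
  sweeping is taken in order that the potential be bounded.
\<close>

lemma superharmonic_ge_green_approximation:
  fixes x0 x y :: 'a
  assumes r: "r > 0" and x: "x \<in> \<Omega>" "x \<notin> cball x0 (2 * r)" and y: "y \<in> \<Omega>" "y \<in> cball x0 r"
    and h: "real_superharmonic \<Omega> h" "\<And>\<xi> e. \<xi> \<in> frontier \<Omega> \<Longrightarrow> e > 0 \<Longrightarrow> \<forall>\<^sub>F z in at \<xi> within \<Omega>. - e < h z"
    and I: "I \<ge> 0" "\<And>z. z \<in> cball x0 (2 * r) \<inter> \<Omega> \<Longrightarrow> I \<le> h z"
  defines "L \<equiv> I * r powr (real DIM('a) - 2)"
  shows "L * (enn2real (newton (x - y)) - enn2real (swept (Suc k) x y)) \<le> h x"
proof -
  define D where "D = \<Omega> - cball x0 (2 * r)"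
  interpret D: bounded_open_set D
    using open_\<Omega> bounded_\<Omega> dim by unfold_locales (auto simp: D_def intro: open_Diff bounded_subset)
  define N where "N z = enn2real (newton (z - y))" for z
  define W where "W z = enn2real (swept (Suc k) z y)" for z
  define s where "s z = (h z + L * W z) + L * - N z" for z
  obtain C where C: "C \<ge> 0" "\<And>k x. swept (Suc k) x y \<le> ennreal C" using swept_Suc_bounded[OF y(1)] by blast
  have L0: "L \<ge> 0" using I by (simp add: L_def)
  have away: "r \<le> norm (z - y)" if "2 * r \<le> dist x0 z" for z
    using that y(2) dist_triangle[of x0 z y] by (simp add: dist_norm norm_minus_commute)
  have dD: "2 * r \<le> dist x0 z" if "z \<in> D" for z using that by (auto simp: D_def)
  have W: "real_superharmonic UNIV W"
    unfolding W_def swept_def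
    by (rule potential_source.potential_real_superharmonic[OF potential_source_walk, where C=C])
       (use C(2) in \<open>simp add: swept_def\<close>)
  have sD: "real_superharmonic D s"
    unfolding s_def N_def
    by (intro real_superharmonic_add real_superharmonic_cmult L0 real_superharmonic_subset[OF h(1)]
        real_superharmonic_subset[OF W] real_superharmonic_minus_newton[OF dim r] away dD)
       (auto simp: D_def)
  have "s x \<ge> 0"
  proof (rule D.real_superharmonic_nonneg[OF sD])
    show "x \<in> D" using x by (simp add: D_def)
    fix \<xi> e assume \<xi>: "\<xi> \<in> frontier D" and e: "(e::real) > 0"
    have "\<xi> \<in> closure D" "\<xi> \<notin> D" using \<xi> D.open_\<Omega> by (auto simp: frontier_def interior_open)
    have "closure D \<subseteq> {z. 2 * r \<le> dist x0 z}"
      by (rule closure_minimal) (auto simp: dD intro!: closed_Collect_le continuous_intros)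
    then have dx: "2 * r \<le> dist x0 \<xi>" using \<open>\<xi> \<in> closure D\<close> by auto
    have ne: "\<xi> - y \<noteq> 0" using away[OF dx] r by auto
    have Nlim: "(N \<longlongrightarrow> N \<xi>) (at \<xi> within D)"
    proof -
      have "((\<lambda>z. newton (z - y)) \<longlongrightarrow> newton (\<xi> - y)) (at \<xi> within D)"
        by (intro newton_tendsto tendsto_intros ne)
      then show ?thesis unfolding N_def using newton_finite[OF ne] by (intro tendsto_enn2real) auto
    qed
    \<comment> \<open>The denominator \<open>L + 1\<close> allows \<open>L = 0\<close>.\<close>
    define \<eta> where "\<eta> = e / (3 * (L + 1))"
    have \<eta>: "\<eta> > 0" "L * \<eta> \<le> e / 3" using e L0 by (auto simp: \<eta>_def field_simps)
    have N\<eta>: "\<forall>\<^sub>F z in at \<xi> within D. N z < N \<xi> + \<eta>" using Nlim \<eta> by (intro order_tendstoD) auto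
    have le: "at \<xi> within D \<le> at \<xi> within \<Omega>" by (rule at_le) (auto simp: D_def)
    show "\<forall>\<^sub>F z in at \<xi> within D. - e < s z"
    proof (cases "\<xi> \<in> \<Omega>")
      case True
      then have \<xi>2: "\<xi> \<in> cball x0 (2 * r) \<inter> \<Omega>" using \<open>\<xi> \<notin> D\<close> by (simp add: D_def)
      have "I - e / 3 < h \<xi>" using I(2)[OF \<xi>2] e by simp
      then have "\<forall>\<^sub>F z in at \<xi> within \<Omega>. I - e / 3 < h z"
        using h(1) True unfolding real_superharmonic_def by blast
      then have hI: "\<forall>\<^sub>F z in at \<xi> within D. I - e / 3 < h z" by (rule filter_leD[OF le])
      have "N \<xi> \<le> r powr (2 - real DIM('a))"
        unfolding N_def using away[OF dx] ne r dim
        by (intro enn2real_leI) (auto simp: newton_def intro!: ennreal_leI powr_mono2')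
      then have "L * N \<xi> \<le> L * r powr (2 - real DIM('a))" using L0 by (intro mult_left_mono)
      also have "\<dots> = I" unfolding L_def using r by (simp add: mult.assoc flip: powr_add)
      finally have LN: "L * N \<xi> \<le> I" .
      show ?thesis using hI N\<eta>
      proof eventually_elim
        case (elim z)
        have "L * N z \<le> L * (N \<xi> + \<eta>)" using elim L0 by (intro mult_left_mono) auto
        moreover have "L * W z \<ge> 0" using L0 by (simp add: W_def)
        ultimately show ?case using elim(1) LN \<eta>(2) e unfolding s_def by (simp add: distrib_left)
      qed
    next
      case False
      have "\<xi> \<in> closure \<Omega>" using \<open>\<xi> \<in> closure D\<close> closure_mono[of D \<Omega>] by (auto simp: D_def)
      then have \<xi>\<Omega>: "\<xi> \<in> frontier \<Omega>" using False open_\<Omega> by (simp add: frontier_def interior_open)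
      have h0: "\<forall>\<^sub>F z in at \<xi> within D. - (e / 3) < h z"
        using h(2)[OF \<xi>\<Omega>, of "e / 3"] e by (intro filter_leD[OF le]) simp
      have "W \<xi> = N \<xi>" by (simp add: W_def N_def swept_outside[OF False])
      then have "N \<xi> - \<eta> < W \<xi>" using \<eta> by simp
      then have "\<forall>\<^sub>F z in at \<xi>. N \<xi> - \<eta> < W z" using W unfolding real_superharmonic_def by simp
      then have "\<forall>\<^sub>F z in at \<xi> within D. N \<xi> - \<eta> < W z"
        using filter_leD[OF at_le[of D UNIV \<xi>]] by simp
      with h0 N\<eta> show ?thesis
      proof eventually_elim
        case (elim z)
        have "L * (N z - W z) \<le> L * (2 * \<eta>)" using elim L0 by (intro mult_left_mono) auto
        then show ?case using elim(1) \<eta>(2) unfolding s_def by (simp add: algebra_simps)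
      qed
    qed
  qed
  then show ?thesis by (simp add: s_def N_def W_def algebra_simps)
qed

text \<open>
  The previous estimate holds for upper functions close to the Perron solutions of the cutoffs of
  \<open>F\<close>. Pass to the limit in the upper function, then in the cutoff, and finally in the number \<open>k\<close>
  of sweeping steps.
\<close>

lemma harmonic_measure_lower_bound:
  fixes x0 x y :: 'a
  assumes r: "r > 0" and x: "x \<in> \<Omega>" "x \<notin> cball x0 (2 * r)" and y: "y \<in> \<Omega>" "y \<in> cball x0 r"
    and I: "I \<ge> 0" "\<And>z. z \<in> cball x0 (2 * r) \<inter> \<Omega> \<Longrightarrow> I \<le> measure (exit_law z) (F \<inter> frontier \<Omega>)"
    and F: "closed F" "F \<noteq> {}"
  shows "I * r powr (real DIM('a) - 2) * (enn2real (newton (x - y)) - enn2real (exit_potential x y))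
    \<le> measure (exit_law x) (F \<inter> frontier \<Omega>)"
proof -
  define L where "L = I * r powr (real DIM('a) - 2)"
  define G where "G k = L * (enn2real (newton (x - y)) - enn2real (swept (Suc k) x y))" for k
  have fin: "finite_measure (exit_law x)" using prob_space_exit_law[OF x(1)] by (simp add: prob_space_def)
  have le: "G k \<le> (LINT \<xi>|exit_law x. closed_cutoff F n \<xi>)" for k n
  proof (rule field_le_epsilon)
    fix e :: real assume e: "e > 0"
    note cF = continuous_on_closed_cutoff[OF F(2)]
    obtain h where h: "real_superharmonic \<Omega> h"
      "\<And>\<xi> a. \<xi> \<in> frontier \<Omega> \<Longrightarrow> a < closed_cutoff F n \<xi> \<Longrightarrow> \<forall>\<^sub>F y in at \<xi> within \<Omega>. a < h y"
      "h x \<le> (LINT \<xi>|exit_law x. closed_cutoff F n \<xi>) + e"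
      using resolutive_continuous[OF cF, unfolded resolutive_def, rule_format, OF x(1) e] by blast
    have up: "upper_function \<Omega> (closed_cutoff F n) (\<lambda>y. ereal (h y))"
      by (rule upper_function_of_real_superharmonic[OF h(1,2)])
    have "G k \<le> h x" unfolding G_def L_def
    proof (rule superharmonic_ge_green_approximation[OF r x y h(1) _ I(1)])
      fix \<xi> e assume "\<xi> \<in> frontier \<Omega>" "(e::real) > 0"
      moreover have "- e < closed_cutoff F n \<xi>" using \<open>e > 0\<close> closed_cutoff_bounds(1)[of F n \<xi>] by linarith
      ultimately show "\<forall>\<^sub>F z in at \<xi> within \<Omega>. - e < h z" using h(2) by blast
    next
      fix z assume z: "z \<in> cball x0 (2 * r) \<inter> \<Omega>"
      then have "z \<in> \<Omega>" by simp
      have "I \<le> (LINT \<xi>|exit_law z. closed_cutoff F n \<xi>)"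
        using I(2)[OF z] measure_le_cutoff_integral[OF \<open>z \<in> \<Omega>\<close> F, of n] by simp
      also have "\<dots> \<le> h z" using upper_function_ge_exit_integral[OF up cF \<open>z \<in> \<Omega>\<close>] by simp
      finally show "I \<le> h z" .
    qed
    then show "G k \<le> (LINT \<xi>|exit_law x. closed_cutoff F n \<xi>) + e" using h(3) by simp
  qed
  have "(\<lambda>n. LINT \<xi>|exit_law x. closed_cutoff F n \<xi>) \<longlonglongrightarrow> measure (exit_law x) (F \<inter> frontier \<Omega>)"
    by (rule closed_cutoff_integral_tendsto[OF fin sets_exit_law _ F]) simp
  then have Gle: "G k \<le> measure (exit_law x) (F \<inter> frontier \<Omega>)" for k
    by (rule LIMSEQ_le_const) (use le in auto)
  obtain C where C: "C \<ge> 0" "\<And>k x. swept (Suc k) x y \<le> ennreal C" using swept_Suc_bounded[OF y(1)] by blast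
  have lim: "(\<lambda>k. swept (Suc k) x y) \<longlonglongrightarrow> exit_potential x y"
    using swept_tendsto[OF x(1) y(1)] by (rule LIMSEQ_Suc)
  then have "exit_potential x y \<le> ennreal C" by (rule LIMSEQ_le_const2) (use C in auto)
  then have "exit_potential x y < top" by (rule le_less_trans) simp
  then have "ennreal (enn2real (exit_potential x y)) = exit_potential x y" by simp
  then have lim': "(\<lambda>k. enn2real (swept (Suc k) x y)) \<longlonglongrightarrow> enn2real (exit_potential x y)"
    using lim by (intro tendsto_enn2real) simp_all
  have "G \<longlonglongrightarrow> L * (enn2real (newton (x - y)) - enn2real (exit_potential x y))"
    unfolding G_def[abs_def] by (intro tendsto_mult tendsto_diff tendsto_const lim')
  then show ?thesis unfolding L_def[symmetric] by (rule LIMSEQ_le_const2) (use Gle in auto)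
qed

lemma green_function_eq:
  assumes x: "x \<in> \<Omega>" and y: "y \<in> \<Omega>" and ne: "x \<noteq> y"
  shows "green_function \<Omega> x y =
    1 / ((real DIM('a) - 2) * (real DIM('a) * unit_ball_vol (real DIM('a)))) *
    (enn2real (newton (x - y)) - enn2real (exit_potential x y))"
proof -
  define c where "c = 1 / ((real DIM('a) - 2) * (real DIM('a) * unit_ball_vol (real DIM('a))))"
  have fs: "fundamental_solution z = c * enn2real (newton z)" if "z \<noteq> 0" for z :: 'a
    using that by (simp add: fundamental_solution_def newton_def c_def)
  have fsm: "fundamental_solution \<in> borel_measurable (borel :: 'a measure)"
    unfolding fundamental_solution_def by measurable
  note [measurable] = exit_point_measurable[OF y]
  have Y: "x - exit_point y \<omega> \<noteq> 0" for \<omega>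
    using exit_point_in[OF y, of \<omega>] x open_\<Omega> by (auto simp: frontier_def interior_open)
  have "(LINT z|harmonic_measure \<Omega> y. fundamental_solution (x - z)) = (LINT \<omega>|paths. fundamental_solution (x - exit_point y \<omega>))"
    unfolding harmonic_measure_eq_exit_law[OF y]
    by (rule integral_exit_law[OF y]) (intro measurable_restrict_space1 measurable_compose[OF _ fsm] borel_measurable_diff measurable_ident_sets, auto)
  also have "\<dots> = c * (LINT \<omega>|paths. enn2real (newton (x - exit_point y \<omega>)))"
    by (simp add: fs[OF Y])
  also have "(LINT \<omega>|paths. enn2real (newton (x - exit_point y \<omega>))) = enn2real (exit_potential x y)"
    unfolding exit_potential_def potential_def
    by (subst integral_eq_nn_integral) (auto simp: newton_finite[OF Y])
  finally show ?thesis using ne by (simp add: green_function_def fs c_def[symmetric] right_diff_distrib)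
qed

end

text \<open>
  The constant \<open>c\<close> is the reciprocal of the normalisation of the fundamental solution.
\<close>

theorem lemma3p3:
  fixes n :: nat
  assumes "n \<ge> 2"
    and "DIM('a::euclidean_space) = n + 1"
  shows "\<exists>c>0. \<forall>(\<Omega>::'a set) x0 r.
    bounded \<Omega> \<longrightarrow> open \<Omega> \<longrightarrow> connected \<Omega> \<longrightarrow>
    x0 \<in> frontier \<Omega> \<longrightarrow> 0 < r \<longrightarrow> r < diameter (frontier \<Omega>) \<longrightarrow>
    (\<forall>a>0. \<forall>x \<in> \<Omega> - cball x0 (2 * r). \<forall>y \<in> cball x0 r \<inter> \<Omega>.
       hm \<Omega> x (cball x0 (a * r))
         \<ge> c * (INF z\<in>cball x0 (2 * r) \<inter> \<Omega>. hm \<Omega> z (cball x0 (a * r)))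
             * r ^ (n - 1) * green_function \<Omega> x y)"
proof -
  define d where "d = real DIM('a)"
  define c where "c = (d - 2) * (d * unit_ball_vol d)"
  have d: "DIM('a) \<ge> 3" "d = real n + 1" using assms by (simp_all add: d_def)
  have c: "c > 0" using d assms(1) by (simp add: c_def)
  show ?thesis
  proof (intro exI[of _ c] conjI c allI impI ballI)
    fix \<Omega> :: "'a set" and x0 x y and r a :: real
    assume \<Omega>: "bounded \<Omega>" "open \<Omega>" and r: "0 < r" and a: "0 < a"
      and x: "x \<in> \<Omega> - cball x0 (2 * r)" and y: "y \<in> cball x0 r \<inter> \<Omega>"
    interpret bounded_open_set \<Omega> using \<Omega> d by unfold_locales auto
    define F where "F = cball x0 (a * r)"
    define I where "I = (INF z\<in>cball x0 (2 * r) \<inter> \<Omega>. hm \<Omega> z F)"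
    have "0 < a * r" using r a by simp
    then have F: "closed F" "F \<noteq> {}" by (auto simp: F_def)
    have hm: "hm \<Omega> z F = measure (exit_law z) (F \<inter> frontier \<Omega>)" if "z \<in> \<Omega>" for z
      by (simp add: hm_def harmonic_measure_eq_exit_law[OF that])
    have "y \<in> cball x0 (2 * r) \<inter> \<Omega>" using y r by auto
    then have I0: "I \<ge> 0" unfolding I_def by (intro cINF_greatest) (auto simp: hm_def)
    have I: "I \<le> measure (exit_law z) (F \<inter> frontier \<Omega>)" if z: "z \<in> cball x0 (2 * r) \<inter> \<Omega>" for z
      unfolding I_def using z hm[of z]
      by (intro cINF_lower2[OF _ z]) (auto simp: hm_def intro!: bdd_belowI[of _ 0])
    have ne: "x \<noteq> y" using x y r by auto
    have pow: "r powr (real DIM('a) - 2) = r ^ (n - 1)"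
      using r assms by (simp add: of_nat_diff flip: powr_realpow)
    have "c * I * r ^ (n - 1) * green_function \<Omega> x y
      = I * r powr (real DIM('a) - 2) * (enn2real (newton (x - y)) - enn2real (exit_potential x y))"
      using c x y ne unfolding pow by (simp add: green_function_eq flip: d_def c_def)
    also have "\<dots> \<le> measure (exit_law x) (F \<inter> frontier \<Omega>)"
      by (rule harmonic_measure_lower_bound[OF r _ _ _ _ I0 I F]) (use x y in auto)
    also have "\<dots> = hm \<Omega> x F" using x by (simp add: hm)
    finally show "c * (INF z\<in>cball x0 (2 * r) \<inter> \<Omega>. hm \<Omega> z (cball x0 (a * r))) * r ^ (n - 1) * green_function \<Omega> x y
      \<le> hm \<Omega> x (cball x0 (a * r))"
      by (simp add: I_def F_def)
  qed
qed

end
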